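(* Let $A$ and $B$ be pointed topological spaces with closed base points, let $X$ be a $CW(A)$-complex and let $\alpha:A\to B$ and $\beta:B\to A$ be continuous maps. (i) If $\beta\alpha=\mathrm{Id}_A$, then there exist a $CW(B)$-complex $Y$ and maps $\varphi:X\to Y$ and $\psi:Y\to X$ such that $\psi\varphi=\mathrm{Id}_X$. (ii) If $\beta$ is a homotopy equivalence, then there exist a $CW(B)$-complex $Y$ and a homotopy equivalence $\varphi:X\to Y$. (iii) If $\beta\alpha=\mathrm{Id}_A$ and $\alpha\beta\simeq\mathrm{Id}_B$, then there exist a $CW(B)$-complex $Y$ and maps $\varphi:X\to Y$ and $\psi:Y\to X$ such that $\psi\varphi=\mathrm{Id}_X$ and $\varphi\psi\simeq\mathrm{Id}_Y$.
   Context: All spaces are pointed, all maps are pointed, and homotopies (hence homotopy equivalences) preserve base points. $\mathrm{C}X$ is the reduced cone, $\Sigma X$ the reduced suspension, $\Sigma^0A=A$. Let $A$ be a pointed space. For $n\ge 1$, $X$ is obtained from a pointed space $Z$ by attaching $n$-cells of type $A$ if $X$ is a pushout of $Z\xleftarrow{\,g\,}\bigvee_{\alpha\in J}\Sigma^{n-1}A\xrightarrow{\,i\,}\bigvee_{\alpha\in J}\mathrm{C}\Sigma^{n-1}A$ for some index set $J$ and some map $g$, where $i$ is the wedge of the inclusions as bases of the cones. $X$ is obtained from $Z$ by attaching $0$-cells of type $A$ if $X=Z\vee\bigvee_{\alpha\in J}A$. A $CW(A)$-complex is a space $X$ that is the colimit of a sequence $*=X^{-1}\to X^0\to X^1\to\cdots$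 such that, for all $n\ge 0$, $X^n$ is obtained from $X^{n-1}$ by attaching $n$-cells of type $A$. *)

theory Defs
  imports "HOL-Analysis.Analysis"
begin

section \<open>Pointed spaces and pointed maps\<close>

type_synonym 'a pointed = "'a topology \<times> 'a"

abbreviation points :: "'a pointed \<Rightarrow> 'a set" where
  "points X \<equiv> topspace (fst X)"

abbreviation base :: "'a pointed \<Rightarrow> 'a" where
  "base X \<equiv> snd X"

definition pointed_space :: "'a pointed \<Rightarrow> bool" where
  "pointed_space X \<longleftrightarrow> base X \<in> points X"

definition pointed_map :: "'a pointed \<Rightarrow> 'b pointed \<Rightarrow> ('a \<Rightarrow> 'b) \<Rightarrow> bool" where
  "pointed_map X Y f \<longleftrightarrow> continuous_map (fst X) (fst Y) f \<and> f (base X) = base Y"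

definition pointed_homotopic ::
    "'a pointed \<Rightarrow> 'b pointed \<Rightarrow> ('a \<Rightarrow> 'b) \<Rightarrow> ('a \<Rightarrow> 'b) \<Rightarrow> bool" where
  "pointed_homotopic X Y f g \<longleftrightarrow>
     homotopic_with (\<lambda>h. h (base X) = base Y) (fst X) (fst Y) f g"

definition pointed_homotopy_equivalence ::
    "'a pointed \<Rightarrow> 'b pointed \<Rightarrow> ('a \<Rightarrow> 'b) \<Rightarrow> bool" where
  "pointed_homotopy_equivalence X Y f \<longleftrightarrow>
     pointed_map X Y f \<and>
     (\<exists>g. pointed_map Y X g \<and>
          pointed_homotopic X X (g \<circ> f) id \<and> pointed_homotopic Y Y (f \<circ> g) id)"


section \<open>Quotients, cones and suspensions\<close>

text \<open>The set \<^term>\<open>f ` topspace X\<close> with the quotient topology induced by \<^term>\<open>f\<close>.\<close>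

definition quotient_space :: "'a topology \<Rightarrow> ('a \<Rightarrow> 'b) \<Rightarrow> 'b topology" where
  "quotient_space X f =
     topology (\<lambda>U. U \<subseteq> f ` topspace X \<and> openin X {x \<in> topspace X. f x \<in> U})"

lemma openin_quotient_space:
  "openin (quotient_space X f) U \<longleftrightarrow>
     U \<subseteq> f ` topspace X \<and> openin X {x \<in> topspace X. f x \<in> U}"
proof -
  have *: "{x \<in> topspace X. f x \<in> S \<inter> T} =
      {x \<in> topspace X. f x \<in> S} \<inter> {x \<in> topspace X. f x \<in> T}" for S T
    by auto
  have **: "{x \<in> topspace X. f x \<in> \<Union>K} = (\<Union>S\<in>K. {x \<in> topspace X. f x \<in> S})" for K
    by auto
  have "istopology (\<lambda>U. U \<subseteq> f ` topspace X \<and> openin X {x \<in> topspace X. f x \<in> U})"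
    unfolding istopology_def * ** by (auto intro!: openin_Int openin_Union)
  then show ?thesis
    by (simp add: quotient_space_def topology_inverse')
qed

lemma topspace_quotient_space [simp]: "topspace (quotient_space X f) = f ` topspace X"
proof (rule antisym)
  show "topspace (quotient_space X f) \<subseteq> f ` topspace X"
    using openin_topspace[of "quotient_space X f"] unfolding openin_quotient_space by blast
  have "{x \<in> topspace X. f x \<in> f ` topspace X} = topspace X"
    by auto
  then show "f ` topspace X \<subseteq> topspace (quotient_space X f)"
    by (intro openin_subset) (simp add: openin_quotient_space)
qed

lemma quotient_map_quotient_space: "quotient_map X (quotient_space X f) f"
  by (auto simp: quotient_map_def openin_quotient_space)

text \<open>
  The quotient \<open>X / C\<close> is realised on \<open>(X - C) \<union> {c}\<close>, where the chosen point
  \<open>c \<in> C\<close> represents the collapsed set.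
\<close>

definition collapse :: "'a set \<Rightarrow> 'a \<Rightarrow> 'a \<Rightarrow> 'a" where
  "collapse C c x = (if x \<in> C then c else x)"

text \<open>The cone is collapsed at time \<open>1\<close>; its base is at time \<open>0\<close>.\<close>

definition cone_map :: "'a pointed \<Rightarrow> 'a \<times> real \<Rightarrow> 'a \<times> real" where
  "cone_map X = collapse (points X \<times> {1} \<union> {base X} \<times> {0..1}) (base X, 1)"

definition reduced_cone :: "'a pointed \<Rightarrow> ('a \<times> real) pointed" where
  "reduced_cone X =
     (quotient_space (prod_topology (fst X) (top_of_set {0..1})) (cone_map X), (base X, 1))"

definition cone_base :: "'a pointed \<Rightarrow> 'a \<Rightarrow> 'a \<times> real" where
  "cone_base X x = cone_map X (x, 0)"

definition suspension :: "'a pointed \<Rightarrow> ('a \<times> real) pointed" where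
  "suspension X =
     (quotient_space (prod_topology (fst X) (top_of_set {0..1}))
        (collapse (points X \<times> {0, 1} \<union> {base X} \<times> {0..1}) (base X, 0)), (base X, 0))"

text \<open>
  To iterate the suspension inside a single type, points are renamed along the injections
  \<open>a \<mapsto> (a, [])\<close> and \<open>((a, ts), t) \<mapsto> (a, t # ts)\<close>; a renaming is a homeomorphism
  of pointed spaces.
\<close>

definition rename :: "('a \<Rightarrow> 'b) \<Rightarrow> 'a pointed \<Rightarrow> 'b pointed" where
  "rename f X = (quotient_space (fst X) f, f (base X))"

primrec iterated_suspension :: "nat \<Rightarrow> 'a pointed \<Rightarrow> ('a \<times> real list) pointed" where
  "iterated_suspension 0 A = rename (\<lambda>a. (a, [])) A"
| "iterated_suspension (Suc n) A =
     rename (\<lambda>((a, ts), t). (a, t # ts)) (suspension (iterated_suspension n A))"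

lemma rename_homeomorphic:
  assumes "inj_on f (points X)"
  shows "homeomorphic_map (fst X) (fst (rename f X)) f"
  using assms quotient_map_quotient_space[of "fst X" f]
  by (simp add: rename_def homeomorphic_map_def)

lemma pointed_space_reduced_cone: "pointed_space X \<Longrightarrow> pointed_space (reduced_cone X)"
  by (simp add: pointed_space_def reduced_cone_def cone_map_def collapse_def
      image_eqI[where x = "(base X, 1)"])

lemma pointed_space_suspension: "pointed_space X \<Longrightarrow> pointed_space (suspension X)"
  by (simp add: pointed_space_def suspension_def collapse_def
      image_eqI[where x = "(base X, 0)"])

lemma pointed_space_iterated_suspension:
  "pointed_space A \<Longrightarrow> pointed_space (iterated_suspension n A)"
proof (induction n)
  case 0
  then show ?case by (simp add: pointed_space_def rename_def)
next
  case (Suc n)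
  then show ?case
    using pointed_space_suspension[of "iterated_suspension n A"]
    by (simp add: pointed_space_def rename_def)
qed


section \<open>Wedges\<close>

text \<open>
  The wedge of copies of \<^term>\<open>X\<close> indexed by \<^term>\<open>J\<close>: the point \<^term>\<open>None\<close> is the
  common base point (present also for empty \<^term>\<open>J\<close>), and the topology is the final one for
  the inclusions \<^term>\<open>wedge_incl X j\<close>, \<open>j \<in> J\<close>.
\<close>

definition wedge_incl :: "'a pointed \<Rightarrow> 'j \<Rightarrow> 'a \<Rightarrow> ('j \<times> 'a) option" where
  "wedge_incl X j x = (if x = base X then None else Some (j, x))"

definition wedge :: "'j set \<Rightarrow> 'a pointed \<Rightarrow> ('j \<times> 'a) option pointed" where
  "wedge J X =
     (topology (\<lambda>U. U \<subseteq> insert None (Some ` (J \<times> (points X - {base X}))) \<and>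
        (\<forall>j\<in>J. openin (fst X) {x \<in> points X. wedge_incl X j x \<in> U})), None)"

definition wedge_map ::
    "'b pointed \<Rightarrow> ('a \<Rightarrow> 'b) \<Rightarrow> ('j \<times> 'a) option \<Rightarrow> ('j \<times> 'b) option" where
  "wedge_map Y f p = (case p of None \<Rightarrow> None | Some (j, x) \<Rightarrow> wedge_incl Y j (f x))"

lemma openin_wedge:
  "openin (fst (wedge J X)) U \<longleftrightarrow>
     U \<subseteq> insert None (Some ` (J \<times> (points X - {base X}))) \<and>
     (\<forall>j\<in>J. openin (fst X) {x \<in> points X. wedge_incl X j x \<in> U})"
proof -
  have *: "{x \<in> points X. wedge_incl X j x \<in> S \<inter> T} =
      {x \<in> points X. wedge_incl X j x \<in> S} \<inter> {x \<in> points X. wedge_incl X j x \<in> T}" for S T and j :: 'a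
    by auto
  have **: "{x \<in> points X. wedge_incl X j x \<in> \<Union>K} =
      (\<Union>S\<in>K. {x \<in> points X. wedge_incl X j x \<in> S})" for K and j :: 'a
    by auto
  have "istopology (\<lambda>U. U \<subseteq> N \<and>
      (\<forall>j\<in>J. openin (fst X) {x \<in> points X. wedge_incl X j x \<in> U}))" for N
    unfolding istopology_def * ** by (simp add: openin_Int Union_least le_infI1) (blast intro: openin_Union)
  then show ?thesis
    by (simp add: wedge_def topology_inverse')
qed

lemma points_wedge:
  "points (wedge J X) = insert None (Some ` (J \<times> (points X - {base X})))"
proof (rule antisym)
  show "points (wedge J X) \<subseteq> insert None (Some ` (J \<times> (points X - {base X})))"
    using openin_topspace[of "fst (wedge J X)"] unfolding openin_wedge by blast
  have "{x \<in> points X. wedge_incl X j x \<in> insert None (Some ` (J \<times> (points X - {base X})))}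
      = points X" if "j \<in> J" for j
    using that by (auto simp: wedge_incl_def)
  then show "insert None (Some ` (J \<times> (points X - {base X}))) \<subseteq> points (wedge J X)"
    by (intro openin_subset) (simp add: openin_wedge)
qed


section \<open>Pushouts and sequential colimits\<close>

text \<open>
  \<open>X\<close>, with structure maps \<open>j : Z \<rightarrow> X\<close> and \<open>h : V \<rightarrow> X\<close>, is a pushout of
  \<open>Z \<leftarrow> W \<rightarrow> V\<close> (with maps \<open>g\<close> and \<open>i\<close>): it is the quotient of the disjoint sum of \<open>Z\<close>
  and \<open>V\<close> by the equivalence relation generated by \<open>g w \<sim> i w\<close>.  The universal property, for
  test spaces of arbitrary type, is \<open>pointed_pushout_universal\<close> below.
\<close>

definition pointed_pushout ::
    "'w pointed \<Rightarrow> ('w \<Rightarrow> 'z) \<Rightarrow> ('w \<Rightarrow> 'v) \<Rightarrow> 'z pointed \<Rightarrow> 'v pointed \<Rightarrow>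
     'x pointed \<Rightarrow> ('z \<Rightarrow> 'x) \<Rightarrow> ('v \<Rightarrow> 'x) \<Rightarrow> bool" where
  "pointed_pushout W g i Z V X j h \<longleftrightarrow>
     pointed_map W Z g \<and> pointed_map W V i \<and> pointed_map Z X j \<and> pointed_map V X h \<and>
     points X = case_sum j h ` (points Z <+> points V) \<and>
     (\<forall>p \<in> points Z <+> points V. \<forall>q \<in> points Z <+> points V.
        case_sum j h p = case_sum j h q \<longleftrightarrow>
        equivclp (\<lambda>p q. \<exists>w \<in> points W. p = Inl (g w) \<and> q = Inr (i w)) p q) \<and>
     (\<forall>U \<subseteq> points X.
        openin (fst X) U \<longleftrightarrow>
        openin (fst Z) {z \<in> points Z. j z \<in> U} \<and> openin (fst V) {v \<in> points V. h v \<in> U})"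

text \<open>
  \<open>X\<close>, with structure maps \<open>k n : S n \<rightarrow> X\<close>, is a colimit of the sequence of the \<open>S n\<close>
  and \<open>f n : S n \<rightarrow> S (n + 1)\<close>: it is the quotient of the disjoint sum of the \<open>S n\<close> by the
  equivalence relation generated by \<open>x \<sim> f n x\<close>.  The universal property is
  \<open>sequential_colimit_universal\<close> below.
\<close>

definition sequential_colimit ::
    "(nat \<Rightarrow> 's pointed) \<Rightarrow> (nat \<Rightarrow> 's \<Rightarrow> 's) \<Rightarrow> 'x pointed \<Rightarrow> (nat \<Rightarrow> 's \<Rightarrow> 'x) \<Rightarrow> bool" where
  "sequential_colimit S f X k \<longleftrightarrow>
     (\<forall>n. pointed_map (S n) (S (Suc n)) (f n)) \<and> (\<forall>n. pointed_map (S n) X (k n)) \<and>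
     quotient_map (sum_topology (\<lambda>n. fst (S n)) UNIV) (fst X) (\<lambda>(n, x). k n x) \<and>
     (\<forall>m n. \<forall>x \<in> points (S m). \<forall>y \<in> points (S n).
        k m x = k n y \<longleftrightarrow>
        equivclp (\<lambda>p q. \<exists>n. \<exists>x \<in> points (S n). p = (n, x) \<and> q = (Suc n, f n x)) (m, x) (n, y))"

lemma equivclp_imp_eq:
  assumes "equivclp r p q" and "\<And>x y. r x y \<Longrightarrow> u x = u y"
  shows "u p = u q"
  using assms(1) by (induction rule: equivclp_induct) (use assms(2) in auto)

lemma pointed_pushout_universal:
  assumes Z: "pointed_space Z"
    and po: "pointed_pushout W g i Z V X j h"
    and u: "pointed_map Z T u" and v: "pointed_map V T v"
    and uv: "\<And>w. w \<in> points W \<Longrightarrow> u (g w) = v (i w)"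
  shows "\<exists>r. pointed_map X T r \<and>
       (\<forall>z \<in> points Z. r (j z) = u z) \<and> (\<forall>y \<in> points V. r (h y) = v y) \<and>
       (\<forall>r'. (\<forall>z \<in> points Z. r' (j z) = u z) \<and> (\<forall>y \<in> points V. r' (h y) = v y) \<longrightarrow>
          (\<forall>x \<in> points X. r' x = r x))"
proof -
  let ?D = "points Z <+> points V"
  let ?R = "\<lambda>p q. \<exists>w \<in> points W. p = Inl (g w) \<and> q = Inr (i w)"
  let ?k = "case_sum j h" and ?t = "case_sum u v"
  have ker: "\<And>p q. p \<in> ?D \<Longrightarrow> q \<in> ?D \<Longrightarrow> ?k p = ?k q \<longleftrightarrow> equivclp ?R p q"
    and sur: "points X = ?k ` ?D"
    and op: "\<And>U. U \<subseteq> points X \<Longrightarrow> openin (fst X) U \<longleftrightarrow>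
        openin (fst Z) {z \<in> points Z. j z \<in> U} \<and> openin (fst V) {y \<in> points V. h y \<in> U}"
    and j0: "j (base Z) = base X"
    using po unfolding pointed_pushout_def pointed_map_def by auto
  have tt: "?t p = ?t q" if "p \<in> ?D" "q \<in> ?D" "?k p = ?k q" for p q
  proof (rule equivclp_imp_eq[where u = ?t])
    show "equivclp ?R p q" using ker that by blast
  qed (use uv in auto)
  define r where "r x = ?t (SOME p. p \<in> ?D \<and> ?k p = x)" for x
  have r: "r (?k p) = ?t p" if "p \<in> ?D" for p
    unfolding r_def
    using someI[of "\<lambda>q. q \<in> ?D \<and> ?k q = ?k p" p] that by (intro tt) blast+
  have rj: "r (j z) = u z" if "z \<in> points Z" for z
    using r[OF InlI[OF that]] by simp
  have rh: "r (h y) = v y" if "y \<in> points V" for y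
    using r[OF InrI[OF that]] by simp
  have cu: "continuous_map (fst Z) (fst T) u" and cv: "continuous_map (fst V) (fst T) v"
    using u v by (auto simp: pointed_map_def)
  have "continuous_map (fst X) (fst T) r"
    unfolding continuous_map_def
  proof (intro conjI allI impI)
    show "r \<in> points X \<rightarrow> points T"
      unfolding sur using cu cv rj rh by (auto simp: continuous_map_def Pi_iff)
    fix U assume U: "openin (fst T) U"
    let ?P = "{x \<in> points X. r x \<in> U}"
    have "{z \<in> points Z. j z \<in> ?P} = {z \<in> points Z. u z \<in> U}"
      using rj sur by force
    moreover have "{y \<in> points V. h y \<in> ?P} = {y \<in> points V. v y \<in> U}"
      using rh sur by force
    ultimately show "openin (fst X) ?P"
      using op[of ?P] U cu cv by (simp add: continuous_map_def)
  qed
  moreover have "r (base X) = base T"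
    using rj[of "base Z"] j0 u Z by (auto simp: pointed_map_def pointed_space_def)
  moreover have "\<forall>x \<in> points X. r' x = r x"
    if "(\<forall>z \<in> points Z. r' (j z) = u z) \<and> (\<forall>y \<in> points V. r' (h y) = v y)" for r'
    using that rj rh unfolding sur by auto
  ultimately show ?thesis
    using rj rh unfolding pointed_map_def by (intro exI[of _ r]) simp
qed

lemma sequential_colimit_universal:
  assumes S: "\<And>n. pointed_space (S n)"
    and co: "sequential_colimit S f X k"
    and u: "\<And>n. pointed_map (S n) T (u n)"
    and uf: "\<And>n x. x \<in> points (S n) \<Longrightarrow> u (Suc n) (f n x) = u n x"
  shows "\<exists>r. pointed_map X T r \<and> (\<forall>n. \<forall>x \<in> points (S n). r (k n x) = u n x) \<and>
       (\<forall>r'. (\<forall>n. \<forall>x \<in> points (S n). r' (k n x) = u n x) \<longrightarrow>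
          (\<forall>x \<in> points X. r' x = r x))"
proof -
  let ?D = "sum_topology (\<lambda>n. fst (S n)) UNIV"
  let ?R = "\<lambda>p q. \<exists>n. \<exists>x \<in> points (S n). p = (n, x) \<and> q = (Suc n, f n x)"
  let ?k = "\<lambda>(n, x). k n x" and ?t = "\<lambda>(n, x). u n x"
  have qm: "quotient_map ?D (fst X) ?k"
    and ker: "\<And>m n x y. x \<in> points (S m) \<Longrightarrow> y \<in> points (S n) \<Longrightarrow>
        k m x = k n y \<longleftrightarrow> equivclp ?R (m, x) (n, y)"
    and k0: "k 0 (base (S 0)) = base X"
    using co unfolding sequential_colimit_def pointed_map_def by auto
  have D: "topspace ?D = {(n, x). x \<in> points (S n)}"
    by auto
  have ct: "continuous_map ?D (fst T) ?t"
    unfolding continuous_map_def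
  proof (intro conjI allI impI)
    show "?t \<in> topspace ?D \<rightarrow> points T"
      using u by (auto simp: D pointed_map_def continuous_map_def Pi_iff)
    fix U assume U: "openin (fst T) U"
    have "openin (fst (S n)) {x \<in> points (S n). u n x \<in> U}" for n
      using u[of n] U by (simp add: pointed_map_def continuous_map_def)
    then show "openin ?D {p \<in> topspace ?D. ?t p \<in> U}"
      by (auto simp: openin_sum_topology D)
  qed
  have tt: "?t p = ?t q" if "p \<in> topspace ?D" "q \<in> topspace ?D" "?k p = ?k q" for p q
  proof (rule equivclp_imp_eq[where u = ?t])
    show "equivclp ?R p q" using ker that by (auto simp: D)
  qed (use uf in auto)
  obtain r where r: "continuous_map (fst X) (fst T) r"
    and rt: "\<And>p. p \<in> topspace ?D \<Longrightarrow> r (?k p) = ?t p"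
  proof (rule quotient_map_lift_exists[OF qm ct tt])
    fix g assume "continuous_map (fst X) (fst T) g"
      and "\<And>p. p \<in> topspace ?D \<Longrightarrow> g (?k p) = ?t p"
    then show thesis by (rule that)
  qed
  have rk: "r (k n x) = u n x" if "x \<in> points (S n)" for n x
    using rt[of "(n, x)"] that by (simp add: D)
  have "r (base X) = base T"
    using rk[of "base (S 0)" 0] k0 u[of 0] S[of 0] by (simp add: pointed_map_def pointed_space_def)
  moreover have "\<forall>x \<in> points X. r' x = r x"
    if "\<forall>n. \<forall>x \<in> points (S n). r' (k n x) = u n x" for r'
  proof
    fix x assume "x \<in> points X"
    then have "x \<in> ?k ` topspace ?D"
      using quotient_imp_surjective_map[OF qm] by simp
    then obtain n y where "y \<in> points (S n)" "x = k n y"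
      unfolding D by auto
    then show "r' x = r x"
      using that rk by simp
  qed
  ultimately show ?thesis
    using r rk unfolding pointed_map_def by (intro exI[of _ r]) simp
qed


section \<open>CW(A)-complexes\<close>

definition one_point :: "unit pointed" where
  "one_point = (discrete_topology {()}, ())"

text \<open>
  \<open>attach_cells A n Z X f\<close>: \<open>X\<close> is obtained from \<open>Z\<close> by attaching \<open>n\<close>-cells of type \<open>A\<close>,
  with structure map \<open>f : Z \<rightarrow> X\<close>.  For \<open>n = 0\<close> the wedge \<open>Z \<or> \<Or>\<^sub>J A\<close> is the coproduct
  of pointed spaces, that is, the pushout over the one-point space.

  It is harmless to take the index set \<open>J\<close> in the type of \<open>X\<close>: if \<open>A\<close> has a
  point other than its base point then every cell contains a point of \<open>X\<close> lying in no other cell,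
  and otherwise \<open>J\<close> may be replaced by the empty set.
\<close>

definition attach_cells ::
    "'a pointed \<Rightarrow> nat \<Rightarrow> 'z pointed \<Rightarrow> 'x pointed \<Rightarrow> ('z \<Rightarrow> 'x) \<Rightarrow> bool" where
  "attach_cells A n Z X f \<longleftrightarrow>
     (\<exists>J :: 'x set.
        case n of
          0 \<Rightarrow> (\<exists>h. pointed_pushout one_point (\<lambda>_. base Z) (\<lambda>_. None) Z (wedge J A) X f h)
        | Suc m \<Rightarrow>
            (let S = iterated_suspension m A in
             \<exists>g h. pointed_pushout (wedge J S) g (wedge_map (reduced_cone S) (cone_base S))
                     Z (wedge J (reduced_cone S)) X f h))"

text \<open>
  Here \<^term>\<open>S n\<close> is the skeleton \<open>X\<^sup>n\<^sup>-\<^sup>1\<close>, so \<^term>\<open>S 0\<close> is a point.  The maps \<open>f n\<close> and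
  hence \<open>k n\<close> are automatically injective, so it is no restriction that the skeleta
  live in the type of \<open>X\<close>.
\<close>

definition CW_complex :: "'a pointed \<Rightarrow> 'x pointed \<Rightarrow> bool" where
  "CW_complex A X \<longleftrightarrow>
     (\<exists>(S :: nat \<Rightarrow> 'x pointed) f k.
        points (S 0) = {base (S 0)} \<and>
        (\<forall>n. attach_cells A n (S n) (S (Suc n)) (f n)) \<and>
        sequential_colimit S f X k)"

text \<open>
  A complex built from cells of type \<open>B\<close> indexed by subsets of a type \<open>'x\<close> can be realised
  in the type \<open>'x \<times> 'b \<times> real list\<close>: a point other than the base point is determined by the
  index of the open cell containing it, a point of \<open>B\<close>, and a list of cube coordinates whose length
  is the dimension of the cell.
\<close>

end

theory Submission
  imports Defs
begin

text \<open>
  Cells are replaced one dimension at a time: if \<open>\<phi> : X\<^sup>n \<rightarrow> Y\<^sup>n\<close> is constructed and \<open>g\<close> attaches cells of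
  type \<open>A\<close> to \<open>X\<^sup>n\<close>, then cells of type \<open>B\<close> are attached to \<open>Y\<^sup>n\<close> along \<open>\<phi> \<circ> g \<circ> \<Sigma>\<^sup>n\<beta>\<close>.  If \<open>\<beta>\<alpha> = id\<close>, the
  maps induced by \<open>\<alpha>\<close> and \<open>\<beta>\<close> on cells extend \<open>\<phi>\<close> and its left inverse strictly; if only
  \<open>\<beta>\<alpha> \<simeq> id\<close>, then \<open>\<phi>\<close> is extended by means of a collar.

  The homotopy equivalences come from one principle.  Let \<open>X\<close> and \<open>Y\<close> be \<open>CW(A)\<close>-complexes with the same
  cells, and let \<open>\<phi>\<close> be a map of skeleta which on cells is homotopic to the identity, relative to the
  skeleta.  A two-dimensional homotopy extension argument on cones yields \<open>\<psi>\<close> and \<open>\<psi>\<phi> \<simeq> id\<close>, both extending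
  strictly from skeleton to skeleton, with \<open>\<psi>\<close> of the same kind.  Hence \<open>\<psi>\<close> has a left inverse too, and \<open>\<phi>\<close>
  is a homotopy equivalence.  For \<open>\<beta>\<alpha> = id\<close> and \<open>\<alpha>\<beta> \<simeq> id\<close> this applies to \<open>\<phi>\<psi> : Y \<rightarrow> Y\<close>; since
  \<open>\<psi>\<phi> = id\<close>, the equivalence \<open>\<phi>\<psi>\<close> is idempotent and so homotopic to the identity.  If \<open>\<beta>\<close> is an equivalence
  with inverse \<open>\<alpha>\<close>, the construction is iterated to \<open>X \<rightarrow> Y \<rightarrow> Z \<rightarrow> U\<close> using \<open>\<alpha>\<close>, \<open>\<beta>\<close>, \<open>\<alpha>\<close>; the composites of
  two consecutive maps are equivalences by the principle, hence so is \<open>X \<rightarrow> Y\<close>.  No coherence between the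
  homotopies \<open>\<beta>\<alpha> \<simeq> id\<close> and \<open>\<alpha>\<beta> \<simeq> id\<close> is needed.
\<close>

section \<open>Pointed homotopies\<close>

text \<open>The obstacle is the colimit: it accepts only maps and homotopies that agree on the nose
  with those on the previous skeleton. Suppose \<open>\<psi>\<close> and a homotopy \<open>H\<close>
  from \<open>\<psi>\<phi>\<close> to the identity are given on a skeleton, and \<open>B\<close>
  deforms \<open>\<phi> g\<close> into the attaching map \<open>g'\<close> of the target. On the
  boundary of a cell, \<open>\<psi> B\<close> run backwards followed by \<open>H g\<close> is a path
  from \<open>\<psi> g'\<close> to \<open>g\<close>, parametrised over \<open>{-1..1}\<close> with
  the junction at 0. Dragging the characteristic map back along it yields \<open>\<psi>'\<close>.
  The new homotopy, however, must restrict to \<open>H\<close> alone, so the part over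
  \<open>{-1..0}\<close> has to be cancelled against \<open>\<psi>'\<close> applied to the homotopy
  on the cell; this cancellation is the second dimension of the extension property. For cones both
  extensions are explicit: a collar along the cone coordinate, of varying width, carries the path,
  and the cone over the base point stays at the base point. Only cells of one type are compared in
  this way, which is why an equivalence is recognised only after returning from B to A.\<close>

abbreviation unit_interval :: "real topology" where
  "unit_interval \<equiv> top_of_set {0..1}"

text \<open>Time is the second coordinate, as in the cylinders behind cones and suspensions, so that
  formulas on cones and homotopies have one shape.\<close>

definition htpy :: "'a pointed \<Rightarrow> 'b pointed \<Rightarrow> ('a \<times> real \<Rightarrow> 'b) \<Rightarrow> bool" where
  "htpy X Y H \<longleftrightarrow> continuous_map (prod_topology (fst X) unit_interval) (fst Y) H \<and>
     (\<forall>t\<in>{0..1}. H (base X, t) = base Y)"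

lemma continuous_map_compose':
  "continuous_map Y Z g \<Longrightarrow> continuous_map X Y f \<Longrightarrow> continuous_map X Z (\<lambda>x. g (f x))"
  using continuous_map_compose[of X Y f Z g] by (simp add: o_def)

lemma continuous_map_compose2':
  "continuous_map (prod_topology A B) Z h \<Longrightarrow> continuous_map X A f \<Longrightarrow> continuous_map X B g \<Longrightarrow>
   continuous_map X Z (\<lambda>x. h (f x, g x))"
  by (erule continuous_map_compose') (rule continuous_map_pairedI)

lemma pointed_map_in: "pointed_map X Y f \<Longrightarrow> x \<in> points X \<Longrightarrow> f x \<in> points Y"
  by (auto simp: pointed_map_def continuous_map_def Pi_iff)

lemma pointed_map_base: "pointed_map X Y f \<Longrightarrow> f (base X) = base Y"
  by (simp add: pointed_map_def)

lemma pointed_map_comp: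
  "pointed_map X Y f \<Longrightarrow> pointed_map Y Z g \<Longrightarrow> pointed_map X Z (\<lambda>x. g (f x))"
  by (auto simp: pointed_map_def intro: continuous_map_compose')

lemma pointed_map_cong:
  "pointed_space X \<Longrightarrow> pointed_map X Y f \<Longrightarrow> (\<And>x. x \<in> points X \<Longrightarrow> f x = g x) \<Longrightarrow> pointed_map X Y g"
  unfolding pointed_map_def pointed_space_def by (metis continuous_map_eq)

lemma pointed_map_id: "pointed_map X X (\<lambda>x. x)"
  by (simp add: pointed_map_def)

lemma htpy_in: "htpy X Y H \<Longrightarrow> x \<in> points X \<Longrightarrow> t \<in> {0..1} \<Longrightarrow> H (x, t) \<in> points Y"
  unfolding htpy_def continuous_map_def by (auto simp: Pi_iff)

lemma htpy_base: "htpy X Y H \<Longrightarrow> t \<in> {0..1} \<Longrightarrow> H (base X, t) = base Y"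
  by (simp add: htpy_def)

lemma continuous_map_interval_reparam:
  assumes "continuous_on {a..b} r" "\<And>t. t \<in> {a..b} \<Longrightarrow> r t \<in> {c..d}"
  shows "continuous_map (prod_topology X (top_of_set {a..b})) (top_of_set {c..d::real})
           (\<lambda>p. r (snd p))"
  by (rule continuous_map_compose'[OF _ continuous_map_snd])
     (use assms in \<open>auto simp: continuous_map_subtopology_eu\<close>)

lemma htpy_reparam:
  assumes H: "htpy X Y H" and r: "continuous_on {0..1} r" "\<And>t. t \<in> {0..1} \<Longrightarrow> r t \<in> {0..1}"
  shows "htpy X Y (\<lambda>(x, t). H (x, r t))"
proof -
  have "continuous_map (prod_topology (fst X) unit_interval) (fst Y) (\<lambda>p. H (fst p, r (snd p)))"
    by (rule continuous_map_compose2'[of _ _ _ H])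
       (use H r in \<open>auto simp: htpy_def intro: continuous_map_fst continuous_map_interval_reparam\<close>)
  then show ?thesis
    using H r(2) by (auto simp: htpy_def case_prod_unfold)
qed

lemma htpy_rev: "htpy X Y H \<Longrightarrow> htpy X Y (\<lambda>(x, t). H (x, 1 - t))"
  by (rule htpy_reparam) (auto intro!: continuous_intros)

lemma htpy_const: "pointed_map X Y f \<Longrightarrow> htpy X Y (\<lambda>(x, t). f x)"
  by (auto simp: htpy_def pointed_map_def case_prod_unfold
      intro: continuous_map_compose'[OF _ continuous_map_fst])

lemma htpy_at: "htpy X Y H \<Longrightarrow> t \<in> {0..1} \<Longrightarrow> pointed_map X Y (\<lambda>x. H (x, t))"
  unfolding htpy_def pointed_map_def
  by (auto intro: continuous_map_compose2'[of _ _ _ H])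

lemma htpy_post: "htpy X Y H \<Longrightarrow> pointed_map Y Z f \<Longrightarrow> htpy X Z (\<lambda>p. f (H p))"
  by (auto simp: htpy_def pointed_map_def intro: continuous_map_compose')

lemma htpy_pre:
  "pointed_map W X f \<Longrightarrow> htpy X Y H \<Longrightarrow> htpy W Y (\<lambda>(w, t). H (f w, t))"
  unfolding htpy_def pointed_map_def case_prod_unfold
  by (auto intro: continuous_map_compose2'[of _ _ _ H] continuous_map_snd
      continuous_map_compose'[OF _ continuous_map_fst])

lemma htpy_cong:
  assumes "pointed_space X" "htpy X Y H"
    and "\<And>x t. x \<in> points X \<Longrightarrow> t \<in> {0..1} \<Longrightarrow> H (x, t) = K (x, t)"
  shows "htpy X Y K"
  using assms unfolding htpy_def pointed_space_def
  by (auto elim!: continuous_map_eq)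

text \<open>Both branches are continuous on all of \<open>X\<close>, which keeps subspaces out of
  the later proofs. The clamps by \<open>min\<close> and \<open>max\<close> in the formulas below
  extend each branch beyond the region where it is used.\<close>

lemma continuous_map_glue:
  assumes "continuous_map X euclideanreal p" "continuous_map X Y f" "continuous_map X Y g"
    and "\<And>x. x \<in> topspace X \<Longrightarrow> p x = 0 \<Longrightarrow> f x = g x"
  shows "continuous_map X Y (\<lambda>x. if p x \<le> 0 then f x else g x)"
  by (rule continuous_map_cases_le[of X p "\<lambda>_. 0"])
     (use assms in \<open>auto intro: continuous_map_from_subtopology\<close>)

lemma continuous_map_snd_interval:
  "continuous_on {a..b::real} q \<Longrightarrow>
   continuous_map (prod_topology X (top_of_set {a..b})) euclideanreal (\<lambda>p. q (snd p))"
  by (rule continuous_map_compose'[OF _ continuous_map_snd])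
     (auto simp: continuous_map_subtopology_eu)

lemma htpy_concat:
  assumes H: "htpy X Y H" and K: "htpy X Y K"
    and HK: "\<And>x. x \<in> points X \<Longrightarrow> H (x, 1) = K (x, 0)"
  shows "htpy X Y (\<lambda>(x, t). if t \<le> 1/2 then H (x, 2 * t) else K (x, 2 * t - 1))"
proof -
  have 1: "htpy X Y (\<lambda>(x, t). H (x, min 1 (2 * t)))" "htpy X Y (\<lambda>(x, t). K (x, max 0 (2 * t - 1)))"
    by (rule htpy_reparam[OF H] htpy_reparam[OF K]; auto intro!: continuous_intros)+
  have "continuous_map (prod_topology (fst X) unit_interval) (fst Y)
     (\<lambda>p. if snd p - 1/2 \<le> 0 then (case p of (x, t) \<Rightarrow> H (x, min 1 (2 * t)))
          else (case p of (x, t) \<Rightarrow> K (x, max 0 (2 * t - 1))))"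
    by (rule continuous_map_glue)
       (use 1 HK in \<open>auto simp: htpy_def intro!: continuous_map_snd_interval continuous_intros\<close>)
  then have "continuous_map (prod_topology (fst X) unit_interval) (fst Y)
     (\<lambda>(x, t). if t \<le> 1/2 then H (x, 2 * t) else K (x, 2 * t - 1))"
    by (rule continuous_map_eq) (auto simp: min.absorb2 max.absorb2)
  then show ?thesis
    using H K by (auto simp: htpy_def)
qed

text \<open>The library's homotopies have time as first coordinate and express pointedness as a
  predicate on each stage; as the base point lies in the space, this predicate depends only on
  values on points. \<open>swap\<close> exchanges the two factors.\<close>

lemma pointed_homotopic_iff:
  assumes "pointed_space X"
  shows "pointed_homotopic X Y f g \<longleftrightarrow>
    (\<exists>H. htpy X Y H \<and> (\<forall>x\<in>points X. H (x, 0) = f x \<and> H (x, 1) = g x))" (is "_ \<longleftrightarrow> ?R")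
proof -
  have eq: "pointed_homotopic X Y f g \<longleftrightarrow>
    (\<exists>h. continuous_map (prod_topology unit_interval (fst X)) (fst Y) h \<and>
              (\<forall>x \<in> points X. h(0,x) = f x) \<and> (\<forall>x \<in> points X. h(1,x) = g x) \<and>
              (\<forall>t \<in> {0..1}. h(t, base X) = base Y))"
    unfolding pointed_homotopic_def
    using assms by (subst homotopic_with) (auto simp: pointed_space_def)
  have swap: "continuous_map (prod_topology A B) C (\<lambda>p. h (snd p, fst p))"
    if "continuous_map (prod_topology B A) C h" for A B C and h :: "'u \<times> 'v \<Rightarrow> 'w"
    by (rule continuous_map_compose'[OF that])
       (intro continuous_map_pairedI continuous_map_fst continuous_map_snd)
  show ?thesis
    unfolding eq htpy_def
  proof safe
    fix h :: "real \<times> 'a \<Rightarrow> 'b"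
    assume "continuous_map (prod_topology unit_interval (fst X)) (fst Y) h"
      "\<forall>x \<in> points X. h(0,x) = f x"
      "\<forall>x \<in> points X. h(1,x) = g x" "\<forall>t \<in> {0..1}. h(t, base X) = base Y"
    then show "\<exists>H. (continuous_map (prod_topology (fst X) unit_interval) (fst Y) H \<and>
          (\<forall>t\<in>{0..1}. H (base X, t) = base Y)) \<and> (\<forall>x\<in>points X. H (x, 0) = f x \<and> H (x, 1) = g x)"
      by (intro exI[of _ "\<lambda>p. h (snd p, fst p)"]) (simp add: swap)
  next
    fix h :: "'a \<times> real \<Rightarrow> 'b"
    assume "continuous_map (prod_topology (fst X) unit_interval) (fst Y) h"
      "\<forall>t\<in>{0..1}. h (base X, t) = base Y"
      "\<forall>x \<in> points X. h(x,0) = f x \<and> h(x,1) = g x"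
    then show "\<exists>h. continuous_map (prod_topology unit_interval (fst X)) (fst Y) h \<and>
              (\<forall>x \<in> points X. h(0,x) = f x) \<and> (\<forall>x \<in> points X. h(1,x) = g x) \<and>
              (\<forall>t \<in> {0..1}. h(t, base X) = base Y)"
      by (intro exI[of _ "\<lambda>p. h (snd p, fst p)"]) (simp add: swap)
  qed
qed

lemma pointed_homotopic_trans:
  "pointed_homotopic X Y f g \<Longrightarrow> pointed_homotopic X Y g h \<Longrightarrow> pointed_homotopic X Y f h"
  unfolding pointed_homotopic_def by (rule homotopic_with_trans)

lemma pointed_homotopic_sym: "pointed_homotopic X Y f g \<Longrightarrow> pointed_homotopic X Y g f"
  unfolding pointed_homotopic_def by (rule homotopic_with_symD)

lemma pointed_homotopic_post:
  "pointed_homotopic X Y f g \<Longrightarrow> pointed_map Y Z h \<Longrightarrow> pointed_homotopic X Z (h \<circ> f) (h \<circ> g)"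
  unfolding pointed_homotopic_def pointed_map_def
  by (erule homotopic_with_compose_continuous_map_left) auto

lemma pointed_homotopic_pre:
  "pointed_homotopic X Y f g \<Longrightarrow> pointed_map W X h \<Longrightarrow> pointed_homotopic W Y (f \<circ> h) (g \<circ> h)"
  unfolding pointed_homotopic_def pointed_map_def
  by (erule homotopic_with_compose_continuous_map_right) auto

lemma pointed_homotopic_eq:
  assumes "pointed_space X" "pointed_homotopic X Y f g"
    and "\<And>x. x \<in> points X \<Longrightarrow> f x = f' x" "\<And>x. x \<in> points X \<Longrightarrow> g x = g' x"
  shows "pointed_homotopic X Y f' g'"
  using assms(2-) unfolding pointed_homotopic_iff[OF assms(1)] by metis

subsection \<open>Homotopies out of quotients\<close>

text \<open>The interval is locally compact and Hausdorff, so the product of a quotient map with it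
  is again a quotient map. This is what allows homotopies, and not only maps, to be defined
  piecewise on pushouts, wedges and colimits.\<close>

lemma continuous_map_quotient_times:
  assumes q: "quotient_map X Q q"
    and H: "continuous_map (prod_topology X unit_interval) T (\<lambda>(x, t). H (q x, t))"
  shows "continuous_map (prod_topology Q unit_interval) T H"
proof -
  have "quotient_map (prod_topology X unit_interval) (prod_topology Q unit_interval) (\<lambda>(x, t). (q x, t))"
  proof (rule quotient_map_prod_left[OF _ _ q])
    show "locally_compact_space unit_interval"
      by (intro compact_imp_locally_compact_space) (simp add: compact_space_subtopology)
    show "Hausdorff_space unit_interval \<or> regular_space unit_interval"
      by (simp add: Hausdorff_space_subtopology)
  qed
  moreover have "H \<circ> (\<lambda>(x, t). (q x, t)) = (\<lambda>(x, t). H (q x, t))"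
    by auto
  ultimately show ?thesis
    using H by (metis continuous_compose_quotient_map)
qed

text \<open>Continuity is tested on boxes: an open box in \<open>prod_topology (X i) R\<close>
  mapped into \<open>U\<close> is carried by the open map \<open>e i\<close> to an open box in
  \<open>prod_topology D R\<close>. The application is to the summands of a disjoint sum.\<close>

lemma continuous_map_open_cover_times:
  assumes D: "topspace D = (\<Union>i\<in>I. e i ` topspace (X i))"
    and e: "\<And>i U. i \<in> I \<Longrightarrow> openin (X i) U \<Longrightarrow> openin D (e i ` U)"
    and H: "\<And>i. i \<in> I \<Longrightarrow> continuous_map (prod_topology (X i) R) T (\<lambda>(x, t). H (e i x, t))"
  shows "continuous_map (prod_topology D R) T H"
  unfolding continuous_map_def
proof (intro conjI allI impI)
  show "H \<in> topspace (prod_topology D R) \<rightarrow> topspace T"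
  proof
    fix p assume "p \<in> topspace (prod_topology D R)"
    then obtain i x t where i: "i \<in> I" "x \<in> topspace (X i)" "t \<in> topspace R" "p = (e i x, t)"
      unfolding D topspace_prod_topology by auto
    then show "H p \<in> topspace T"
      using continuous_map_image_subset_topspace[OF H[OF i(1)]] by auto
  qed
  fix U assume U: "openin T U"
  show "openin (prod_topology D R) {p \<in> topspace (prod_topology D R). H p \<in> U}"
    unfolding openin_prod_topology_alt
  proof (intro allI impI)
    fix y t assume "(y, t) \<in> {p \<in> topspace (prod_topology D R). H p \<in> U}"
    then obtain i x where i: "i \<in> I" "x \<in> topspace (X i)" "y = e i x" "t \<in> topspace R"
      "H (e i x, t) \<in> U"
      unfolding D topspace_prod_topology by auto
    have "openin (prod_topology (X i) R)
       {p \<in> topspace (prod_topology (X i) R). (case p of (x, t) \<Rightarrow> H (e i x, t)) \<in> U}"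
      using H[OF i(1)] U by (auto simp: continuous_map_def)
    moreover have "(x, t) \<in> {p \<in> topspace (prod_topology (X i) R). (case p of (x, t) \<Rightarrow> H (e i x, t)) \<in> U}"
      using i by simp
    ultimately obtain A B where AB: "openin (X i) A" "openin R B" "x \<in> A" "t \<in> B"
      "A \<times> B \<subseteq> {p \<in> topspace (prod_topology (X i) R). (case p of (x, t) \<Rightarrow> H (e i x, t)) \<in> U}"
      unfolding openin_prod_topology_alt by meson
    have "e i ` A \<times> B \<subseteq> {p \<in> topspace (prod_topology D R). H p \<in> U}"
    proof safe
      fix a b assume ab: "a \<in> A" "b \<in> B"
      show "(e i a, b) \<in> topspace (prod_topology D R)"
        using ab AB(2) openin_subset[OF e[OF i(1) AB(1)]] openin_subset[OF AB(2)] by auto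
      show "H (e i a, b) \<in> U"
        using ab AB(5) by auto
    qed
    then show "\<exists>A B. openin D A \<and> openin R B \<and> y \<in> A \<and> t \<in> B \<and>
                 A \<times> B \<subseteq> {p \<in> topspace (prod_topology D R). H p \<in> U}"
      using AB e[OF i(1) AB(1)] i(3) by blast
  qed
qed

lemma continuous_map_sum_times:
  assumes "\<And>i. i \<in> I \<Longrightarrow> continuous_map (prod_topology (X i) R) T (\<lambda>(x, t). H ((i, x), t))"
  shows "continuous_map (prod_topology (sum_topology X I) R) T H"
  by (rule continuous_map_open_cover_times[where I = I and e = Pair and X = X])
     (use assms open_map_component_injection[of _ I X] in \<open>auto simp: open_map_def Sigma_def\<close>)

text \<open>Lets a statement about maps be read off from its version for homotopies, so that gluing
  and functoriality are proved only for the latter.\<close>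

lemma pointed_map_iff_htpy: "pointed_map X Y f \<longleftrightarrow> htpy X Y (\<lambda>(x, t). f x)"
  using htpy_const[of X Y f] htpy_at[of X Y "\<lambda>(x, t). f x" 0] by auto

text \<open>\<open>Z\<close> and \<open>V\<close> have different types, so \<open>Inl\<close> and
  \<open>Inr\<close> first move them into the sum type, and \<open>bool\<close> then indexes the two
  summands. In this form the pushout is a quotient of a disjoint sum, and the product with the
  interval can be handled.\<close>

lemma pointed_pushout_quotient_map:
  assumes "pointed_pushout W g i Z V X j h"
  shows "quotient_map (sum_topology (\<lambda>b. if b then quotient_space (fst Z) Inl else quotient_space (fst V) Inr) UNIV)
     (fst X) (\<lambda>(b, s). case_sum j h s)" (is "quotient_map ?D _ ?q")
proof -
  have sur: "points X = case_sum j h ` (points Z <+> points V)"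
    and op: "\<And>U. U \<subseteq> points X \<Longrightarrow> openin (fst X) U \<longleftrightarrow>
        openin (fst Z) {z \<in> points Z. j z \<in> U} \<and> openin (fst V) {y \<in> points V. h y \<in> U}"
    using assms unfolding pointed_pushout_def by auto
  have D: "topspace ?D = {True} \<times> Inl ` points Z \<union> {False} \<times> Inr ` points V"
    by (auto split: if_splits)
  have im: "?q ` topspace ?D = points X"
    unfolding D sur Plus_def image_Un by (force simp: image_iff)
  have "openin ?D {p \<in> topspace ?D. ?q p \<in> U} \<longleftrightarrow> openin (fst X) U" if U: "U \<subseteq> points X" for U
  proof -
    have 1: "{x. (True, x) \<in> {p \<in> topspace ?D. ?q p \<in> U}} = Inl ` {z \<in> points Z. j z \<in> U}"
      "{x. (False, x) \<in> {p \<in> topspace ?D. ?q p \<in> U}} = Inr ` {y \<in> points V. h y \<in> U}"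
      unfolding D by auto
    have 2: "openin (quotient_space (fst Z) Inl) (Inl ` A) \<longleftrightarrow> openin (fst Z) A" if "A \<subseteq> points Z" for A
      using that unfolding openin_quotient_space
      by (auto simp: image_iff intro!: arg_cong[where f = "openin (fst Z)"])
         (metis (no_types, lifting) Collect_mem_eq Collect_cong subsetD)+
    have 3: "openin (quotient_space (fst V) Inr) (Inr ` A) \<longleftrightarrow> openin (fst V) A" if "A \<subseteq> points V" for A
      using that unfolding openin_quotient_space
      by (auto simp: image_iff intro!: arg_cong[where f = "openin (fst V)"])
         (metis (no_types, lifting) Collect_mem_eq Collect_cong subsetD)+
    have "openin ?D {p \<in> topspace ?D. ?q p \<in> U} \<longleftrightarrow>
       (\<forall>b. openin (if b then quotient_space (fst Z) Inl else quotient_space (fst V) Inr)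
          {x. (b, x) \<in> {p \<in> topspace ?D. ?q p \<in> U}})"
      unfolding openin_sum_topology topspace_sum_topology by blast
    also have "\<dots> \<longleftrightarrow> openin (fst Z) {z \<in> points Z. j z \<in> U} \<and> openin (fst V) {y \<in> points V. h y \<in> U}"
      unfolding all_bool_eq 1 if_True if_False by (subst 2, blast, subst 3, blast, blast)
    finally show ?thesis
      using op[OF U] by simp
  qed
  then show ?thesis
    unfolding quotient_map_def using im by simp
qed

text \<open>The factorisation at the level of points: the common target type is arbitrary, in
  particular it may be a type of paths.\<close>

lemma pushout_factor:
  assumes po: "pointed_pushout W g i Z V X j h" and uv: "\<And>w. w \<in> points W \<Longrightarrow> u (g w) = v (i w)"
  obtains r where "\<And>z. z \<in> points Z \<Longrightarrow> r (j z) = u z" "\<And>y. y \<in> points V \<Longrightarrow> r (h y) = v y"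
proof -
  let ?D = "points Z <+> points V"
  let ?R = "\<lambda>p q. \<exists>w \<in> points W. p = Inl (g w) \<and> q = Inr (i w)"
  let ?k = "case_sum j h" and ?t = "case_sum u v"
  have ker: "\<And>p q. p \<in> ?D \<Longrightarrow> q \<in> ?D \<Longrightarrow> ?k p = ?k q \<longleftrightarrow> equivclp ?R p q"
    using po unfolding pointed_pushout_def by auto
  have tt: "?t p = ?t q" if "p \<in> ?D" "q \<in> ?D" "?k p = ?k q" for p q
  proof (rule equivclp_imp_eq[where u = ?t])
    show "equivclp ?R p q" using ker that by blast
  qed (use uv in auto)
  define r where "r x = ?t (SOME p. p \<in> ?D \<and> ?k p = x)" for x
  have r: "r (?k p) = ?t p" if "p \<in> ?D" for p
    unfolding r_def
    using someI[of "\<lambda>q. q \<in> ?D \<and> ?k q = ?k p" p] that by (intro tt) blast+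
  show ?thesis
  proof
    show "r (j z) = u z" if "z \<in> points Z" for z
      using r[OF InlI[OF that]] by simp
    show "r (h y) = v y" if "y \<in> points V" for y
      using r[OF InrI[OF that]] by simp
  qed
qed

lemma pushout_htpy:
  assumes Z: "pointed_space Z"
    and po: "pointed_pushout W g i Z V X j h"
    and u: "htpy Z T u" and v: "htpy V T v"
    and uv: "\<And>w t. w \<in> points W \<Longrightarrow> t \<in> {0..1} \<Longrightarrow> u (g w, t) = v (i w, t)"
  obtains r where "htpy X T r"
    "\<And>z t. z \<in> points Z \<Longrightarrow> t \<in> {0..1} \<Longrightarrow> r (j z, t) = u (z, t)"
    "\<And>y t. y \<in> points V \<Longrightarrow> t \<in> {0..1} \<Longrightarrow> r (h y, t) = v (y, t)"
proof -
  \<comment> \<open>The value at a point is its whole path. Restricting the paths to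
    \<open>{0..1}\<close> turns agreement at those times into equality of functions.\<close>
  obtain r' where r': "\<And>z. z \<in> points Z \<Longrightarrow> r' (j z) = (\<lambda>t\<in>{0..1}. u (z, t))"
    "\<And>y. y \<in> points V \<Longrightarrow> r' (h y) = (\<lambda>t\<in>{0..1}. v (y, t))"
    by (rule pushout_factor[OF po, where u = "\<lambda>z. \<lambda>t\<in>{0..1}. u (z, t)"
      and v = "\<lambda>z. \<lambda>t\<in>{0..1}. v (z, t)"])
       (use uv in auto)
  define r where "r = (\<lambda>(x, t). r' x t)"
  have rj: "r (j z, t) = u (z, t)" if "z \<in> points Z" "t \<in> {0..1}" for z t
    using r'(1)[OF that(1)] that by (simp add: r_def)
  have rh: "r (h y, t) = v (y, t)" if "y \<in> points V" "t \<in> {0..1}" for y t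
    using r'(2)[OF that(1)] that by (simp add: r_def)
  have j0: "j (base Z) = base X"
    using po by (simp add: pointed_pushout_def pointed_map_def)
  have "continuous_map (prod_topology (fst X) unit_interval) (fst T) r"
  proof (rule continuous_map_quotient_times[OF pointed_pushout_quotient_map[OF po]], rule continuous_map_sum_times)
    fix b :: bool assume "b \<in> UNIV"
    show "continuous_map (prod_topology (if b then quotient_space (fst Z) Inl else quotient_space (fst V) Inr) unit_interval)
       (fst T) (\<lambda>(x, t). case ((b, x), t) of (x, t) \<Rightarrow> r (case x of (b, s) \<Rightarrow> case_sum j h s, t))"
    proof (cases b)
      case True
      have "continuous_map (prod_topology (fst Z) unit_interval) (fst T) (\<lambda>(z, t). r (j z, t))"
        by (rule continuous_map_eq[of _ _ u]) (use u rj in \<open>auto simp: htpy_def\<close>)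
      then show ?thesis
        using True by (auto intro!: continuous_map_quotient_times[OF quotient_map_quotient_space])
    next
      case False
      have "continuous_map (prod_topology (fst V) unit_interval) (fst T) (\<lambda>(z, t). r (h z, t))"
        by (rule continuous_map_eq[of _ _ v]) (use v rh in \<open>auto simp: htpy_def\<close>)
      then show ?thesis
        using False by (auto intro!: continuous_map_quotient_times[OF quotient_map_quotient_space])
    qed
  qed
  moreover have "r (base X, t) = base T" if "t \<in> {0..1}" for t
    using rj[of "base Z" t] that u Z unfolding j0 by (simp add: htpy_def pointed_space_def)
  ultimately show ?thesis
    using rj rh by (intro that[of r]) (auto simp: htpy_def)
qed

lemma pushout_map:
  assumes Z: "pointed_space Z"
    and po: "pointed_pushout W g i Z V X j h"
    and u: "pointed_map Z T u" and v: "pointed_map V T v"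
    and uv: "\<And>w. w \<in> points W \<Longrightarrow> u (g w) = v (i w)"
  obtains r where "pointed_map X T r"
    "\<And>z. z \<in> points Z \<Longrightarrow> r (j z) = u z" "\<And>y. y \<in> points V \<Longrightarrow> r (h y) = v y"
  using pointed_pushout_universal[OF assms] by blast

lemma pushout_cases:
  assumes "pointed_pushout W g i Z V X j h" "x \<in> points X"
  obtains z where "z \<in> points Z" "x = j z" | y where "y \<in> points V" "x = h y"
  using assms unfolding pointed_pushout_def by (auto simp: Plus_def)

lemma pushoutD:
  assumes "pointed_pushout W g i Z V X j h"
  shows "pointed_map W Z g" "pointed_map W V i" "pointed_map Z X j" "pointed_map V X h"
    and pushout_comm: "w \<in> points W \<Longrightarrow> j (g w) = h (i w)"
proof -
  show *: "pointed_map W Z g" "pointed_map W V i" "pointed_map Z X j" "pointed_map V X h"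
    using assms by (auto simp: pointed_pushout_def)
  assume w: "w \<in> points W"
  have "Inl (g w) \<in> points Z <+> points V" "Inr (i w) \<in> points Z <+> points V"
    using *[THEN pointed_map_in] w by auto
  moreover have "equivclp (\<lambda>p q. \<exists>w \<in> points W. p = Inl (g w) \<and> q = Inr (i w)) (Inl (g w)) (Inr (i w))"
    using w by (intro r_into_equivclp) auto
  ultimately have "case_sum j h (Inl (g w)) = case_sum j h (Inr (i w))"
    using assms unfolding pointed_pushout_def by blast
  then show "j (g w) = h (i w)" by simp
qed

lemma pointed_space_pushout:
  "pointed_pushout W g i Z V X j h \<Longrightarrow> pointed_space Z \<Longrightarrow> pointed_space X"
  using pushoutD(3)[of W g i Z V X j h] pointed_map_in pointed_map_base unfolding pointed_space_def
    by metis

section \<open>Wedges and sequential colimits\<close>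

lemma None_in_wedge [simp]: "None \<in> points (wedge J X)"
  by (simp add: points_wedge)

lemma base_wedge [simp]: "base (wedge J X) = None"
  by (simp add: wedge_def)

lemma pointed_space_wedge [simp]: "pointed_space (wedge J X)"
  by (simp add: pointed_space_def)

lemma wedge_incl_in: "j \<in> J \<Longrightarrow> x \<in> points X \<Longrightarrow> wedge_incl X j x \<in> points (wedge J X)"
  by (auto simp: points_wedge wedge_incl_def)

lemma wedge_cases:
  assumes "p \<in> points (wedge J X)"
  obtains "p = None" | j x where "j \<in> J" "x \<in> points X" "x \<noteq> base X" "p = wedge_incl X j x"
    "p = Some (j, x)"
  using assms by (auto simp: points_wedge wedge_incl_def)

lemma pointed_map_wedge_incl: "j \<in> J \<Longrightarrow> pointed_map X (wedge J X) (wedge_incl X j)"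
  unfolding pointed_map_def continuous_map_def
  by (auto simp: wedge_incl_in openin_wedge) (auto simp: wedge_incl_def)

text \<open>The additional index \<open>None\<close> contributes a copy of \<open>X\<close> that is
  sent to the base point; it makes the map surjective even when \<open>J\<close> is empty.\<close>

lemma wedge_quotient_map:
  assumes X: "pointed_space X"
  shows "quotient_map (sum_topology (\<lambda>_. fst X) (insert None (Some ` J))) (fst (wedge J X))
     (\<lambda>(i, x). case i of None \<Rightarrow> None | Some j \<Rightarrow> wedge_incl X j x)" (is "quotient_map ?D _ ?q")
proof -
  have im: "?q ` topspace ?D = points (wedge J X)"
  proof (rule antisym)
    show "?q ` topspace ?D \<subseteq> points (wedge J X)"
      by (auto simp: wedge_incl_in)
    have "None = ?q (None, base X)" by simp
    moreover have "(None, base X) \<in> topspace ?D"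
      using X by (auto simp: pointed_space_def)
    ultimately have "None \<in> ?q ` topspace ?D"
      by blast
    moreover have "Some (j, x) \<in> ?q ` topspace ?D" if "j \<in> J" "x \<in> points X - {base X}" for j x
      by (rule image_eqI[of _ _ "(Some j, x)"]) (use that in \<open>auto simp: wedge_incl_def\<close>)
    ultimately show "points (wedge J X) \<subseteq> ?q ` topspace ?D"
      unfolding points_wedge by blast
  qed
  have "openin ?D {p \<in> topspace ?D. ?q p \<in> U} \<longleftrightarrow> openin (fst (wedge J X)) U"
    if U: "U \<subseteq> points (wedge J X)" for U
  proof -
    have "openin ?D {p \<in> topspace ?D. ?q p \<in> U} \<longleftrightarrow>
      (\<forall>i\<in>insert None (Some ` J). openin (fst X) {x. (i, x) \<in> {p \<in> topspace ?D. ?q p \<in> U}})"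
      unfolding openin_sum_topology topspace_sum_topology by blast
    also have "\<dots> \<longleftrightarrow> openin (fst X) {x \<in> points X. None \<in> U} \<and>
        (\<forall>j\<in>J. openin (fst X) {x \<in> points X. wedge_incl X j x \<in> U})"
      by (auto cong: conj_cong)
    finally have "openin ?D {p \<in> topspace ?D. ?q p \<in> U} \<longleftrightarrow>
       openin (fst X) {x \<in> points X. None \<in> U} \<and>
        (\<forall>j\<in>J. openin (fst X) {x \<in> points X. wedge_incl X j x \<in> U})" .
    moreover have "openin (fst X) {x \<in> points X. None \<in> U}"
      by (cases "None \<in> U") auto
    ultimately show ?thesis
      using U unfolding openin_wedge points_wedge by blast
  qed
  then show ?thesis
    unfolding quotient_map_def using im by simp
qed

lemma wedge_htpy:
  assumes X: "pointed_space X" and T: "pointed_space T"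
    and H: "\<And>j. j \<in> J \<Longrightarrow> htpy X T (\<lambda>(x, t). H (wedge_incl X j x, t))"
    and H0: "\<And>t. t \<in> {0..1} \<Longrightarrow> H (None, t) = base T"
  shows "htpy (wedge J X) T H"
  unfolding htpy_def
proof (intro conjI)
  show "continuous_map (prod_topology (fst (wedge J X)) unit_interval) (fst T) H"
  proof (rule continuous_map_quotient_times[OF wedge_quotient_map[OF X]], rule continuous_map_sum_times)
    fix i assume i: "i \<in> insert None (Some ` J)"
    let ?K = "\<lambda>(x, t). case ((i, x), t) of (x, t) \<Rightarrow> H (case x of (i, x) \<Rightarrow> case i of None \<Rightarrow> None | Some j \<Rightarrow> wedge_incl X j x, t)"
    show "continuous_map (prod_topology (fst X) unit_interval) (fst T) ?K"
    proof (cases i)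
      case None
      have "continuous_map (prod_topology (fst X) unit_interval) (fst T) (\<lambda>_. base T)"
        using T by (simp add: pointed_space_def)
      then show ?thesis
        by (rule continuous_map_eq) (use None H0 in auto)
    next
      case (Some j)
      then have "j \<in> J" using i by auto
      from H[OF this] show ?thesis
        by (simp add: Some htpy_def)
    qed
  qed
qed (use H0 in auto)

lemma wedge_pointed_map:
  assumes "pointed_space X" "pointed_space T"
    and "\<And>j. j \<in> J \<Longrightarrow> pointed_map X T (\<lambda>x. f (wedge_incl X j x))" "f None = base T"
  shows "pointed_map (wedge J X) T f"
  using assms unfolding pointed_map_iff_htpy by (intro wedge_htpy) auto

lemma colimit_htpy:
  assumes S: "pointed_space (S 0)"
    and co: "sequential_colimit S f X k"
    and u: "\<And>n. htpy (S n) T (u n)"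
    and uf: "\<And>n x t. x \<in> points (S n) \<Longrightarrow> t \<in> {0..1} \<Longrightarrow> u (Suc n) (f n x, t) = u n (x, t)"
  obtains r where "htpy X T r"
    "\<And>n x t. x \<in> points (S n) \<Longrightarrow> t \<in> {0..1} \<Longrightarrow> r (k n x, t) = u n (x, t)"
proof -
  let ?D = "sum_topology (\<lambda>n. fst (S n)) UNIV"
  let ?R = "\<lambda>p q. \<exists>n. \<exists>x \<in> points (S n). p = (n, x) \<and> q = (Suc n, f n x)"
  let ?k = "\<lambda>(n, x). k n x" and ?t = "\<lambda>(n, x). \<lambda>t\<in>{0..1}. u n (x, t)"
  have qm: "quotient_map ?D (fst X) ?k"
    and ker: "\<And>m n x y. x \<in> points (S m) \<Longrightarrow> y \<in> points (S n) \<Longrightarrow>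
        k m x = k n y \<longleftrightarrow> equivclp ?R (m, x) (n, y)"
    and k0: "k 0 (base (S 0)) = base X"
    using co unfolding sequential_colimit_def pointed_map_def by auto
  have tt: "?t p = ?t q" if "p \<in> topspace ?D" "q \<in> topspace ?D" "?k p = ?k q" for p q
  proof (rule equivclp_imp_eq[where u = ?t])
    show "equivclp ?R p q" using ker that by auto
  qed (use uf in auto)
  define r where "r = (\<lambda>(x, t). ?t (SOME p. p \<in> topspace ?D \<and> ?k p = x) t)"
  have rk: "r (k n x, t) = u n (x, t)" if "x \<in> points (S n)" "t \<in> {0..1}" for n x t
  proof -
    have "?t (SOME p. p \<in> topspace ?D \<and> ?k p = k n x) = ?t (n, x)"
      using someI[of "\<lambda>q. q \<in> topspace ?D \<and> ?k q = k n x" "(n, x)"] that by (intro tt) auto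
    then have "?t (SOME p. p \<in> topspace ?D \<and> ?k p = k n x) t = ?t (n, x) t"
      by (rule fun_cong)
    then show ?thesis
      using that by (simp add: r_def)
  qed
  have "continuous_map (prod_topology (fst X) unit_interval) (fst T) r"
  proof (rule continuous_map_quotient_times[OF qm], rule continuous_map_sum_times)
    fix n :: nat
    have "continuous_map (prod_topology (fst (S n)) unit_interval) (fst T) (\<lambda>(z, t). r (k n z, t))"
      by (rule continuous_map_eq[of _ _ "u n"]) (use u rk in \<open>auto simp: htpy_def\<close>)
    then show "continuous_map (prod_topology (fst (S n)) unit_interval) (fst T)
       (\<lambda>(x, t). case ((n, x), t) of (x, t) \<Rightarrow> r (case x of (n, x) \<Rightarrow> k n x, t))"
      by simp
  qed
  moreover have "r (base X, t) = base T" if "t \<in> {0..1}" for t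
    using rk[of "base (S 0)" 0 t] k0 u[of 0] S that by (simp add: htpy_def pointed_space_def)
  ultimately show ?thesis
    using rk by (intro that[of r]) (auto simp: htpy_def)
qed

lemma colimit_map:
  assumes "pointed_space (S 0)" "sequential_colimit S f X k" "\<And>n. pointed_map (S n) T (u n)"
    and "\<And>n x. x \<in> points (S n) \<Longrightarrow> u (Suc n) (f n x) = u n x"
  obtains r where "pointed_map X T r" "\<And>n x. x \<in> points (S n) \<Longrightarrow> r (k n x) = u n x"
proof -
  obtain r where r: "htpy X T r" "\<And>n x t. x \<in> points (S n) \<Longrightarrow> t \<in> {0..1} \<Longrightarrow> r (k n x, t) = u n x"
    by (rule colimit_htpy[OF assms(1,2), of T "\<lambda>n (x, t). u n x"])
       (use assms(3,4) in \<open>auto simp: pointed_map_iff_htpy\<close>)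
  show ?thesis
    by (rule that[OF htpy_at[OF r(1), of 0]]) (use r(2) in auto)
qed

lemma colimit_cases:
  assumes "sequential_colimit S f X k" "x \<in> points X"
  obtains n y where "y \<in> points (S n)" "x = k n y"
proof -
  have "(\<lambda>(n, x). k n x) ` topspace (sum_topology (\<lambda>n. fst (S n)) UNIV) = points X"
    using assms(1) unfolding sequential_colimit_def by (blast dest: quotient_imp_surjective_map)
  then show ?thesis
    using assms(2) that by fastforce
qed

lemma colimitD:
  assumes "sequential_colimit S f X k"
  shows "pointed_map (S n) (S (Suc n)) (f n)" "pointed_map (S n) X (k n)"
    and "x \<in> points (S n) \<Longrightarrow> k (Suc n) (f n x) = k n x"
proof -
  show *: "pointed_map (S n) (S (Suc n)) (f n)" "pointed_map (S n) X (k n)"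
    using assms by (auto simp: sequential_colimit_def)
  assume x: "x \<in> points (S n)"
  have "equivclp (\<lambda>p q. \<exists>n. \<exists>x \<in> points (S n). p = (n, x) \<and> q = (Suc n, f n x)) (n, x) (Suc n, f n x)"
    using x by (intro r_into_equivclp) auto
  then have "k n x = k (Suc n) (f n x)"
    using assms x pointed_map_in[OF *(1) x] unfolding sequential_colimit_def by blast
  then show "k (Suc n) (f n x) = k n x" by simp
qed

section \<open>Filling homotopies on pairs\<close>

text \<open>
  A two-dimensional homotopy extension property of \<open>c : W \<rightarrow> V\<close>.  A homotopy of \<open>F \<circ> c\<close> that runs back
  through the path \<open>P\<close> extends to \<open>V\<close>; if the end of this extension is the end of a homotopy \<open>E\<close>
  lying over the part \<open>{-1..0}\<close> of \<open>P\<close>, then the start of \<open>E\<close> is homotopic to \<open>F\<close> over the part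
  \<open>{0..1}\<close> of \<open>P\<close>.
\<close>

definition fills ::
    "'w pointed \<Rightarrow> 'v pointed \<Rightarrow> ('w \<Rightarrow> 'v) \<Rightarrow> 't pointed \<Rightarrow> ('v \<Rightarrow> 't) \<Rightarrow> ('w \<times> real \<Rightarrow> 't) \<Rightarrow>
     ('v \<times> real \<Rightarrow> 't) \<Rightarrow> bool" where
  "fills W V c T F P U \<longleftrightarrow>
     htpy V T U \<and> (\<forall>v\<in>points V. U (v, 0) = F v) \<and>
     (\<forall>w\<in>points W. \<forall>r\<in>{0..1}. U (c w, r) = P (w, 1 - 2 * r)) \<and>
     (\<forall>E. htpy V T E \<and> (\<forall>w\<in>points W. \<forall>r\<in>{0..1}. E (c w, r) = P (w, - r)) \<and>
          (\<forall>v\<in>points V. E (v, 1) = U (v, 1)) \<longrightarrow>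
        (\<exists>G. htpy V T G \<and> (\<forall>w\<in>points W. \<forall>s\<in>{0..1}. G (c w, s) = P (w, s)) \<and>
           (\<forall>v\<in>points V. G (v, 0) = E (v, 0) \<and> G (v, 1) = F v)))"

text \<open>The path is parametrised over \<open>{-1..1}\<close> so that 0 is the place where two
  prescribed homotopies meet. In \<open>fills\<close>, the parameter \<open>1 - 2 * r\<close>
  traverses it backwards from 1, where it matches \<open>F\<close>, to -1.\<close>

definition fillable :: "'w pointed \<Rightarrow> 'v pointed \<Rightarrow> ('w \<Rightarrow> 'v) \<Rightarrow> 't pointed \<Rightarrow> bool" where
  "fillable W V c T \<longleftrightarrow> (\<forall>F P.
     pointed_map V T F \<and>
     continuous_map (prod_topology (fst W) (top_of_set {-1..1})) (fst T) P \<and>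
     (\<forall>s\<in>{-1..1}. P (base W, s) = base T) \<and> (\<forall>w\<in>points W. P (w, 1) = F (c w)) \<longrightarrow>
     (\<exists>U. fills W V c T F P U))"

text \<open>This is the case of 0-cells: the boundary is a point, all its paths are constant, the
  stationary homotopy serves as \<open>U\<close>, and then \<open>E\<close> itself ends at
  \<open>F\<close> and serves as \<open>G\<close>.\<close>

lemma fillable_trivial:
  assumes c: "\<And>w. w \<in> points W \<Longrightarrow> c w = base V" and W: "points W = {base W}"
  shows "fillable W V c T"
  unfolding fillable_def
proof (intro allI impI, elim conjE)
  fix F P
  assume F: "pointed_map V T F" and P: "\<forall>s\<in>{-1..1::real}. P (base W, s) = base T"
  let ?U = "\<lambda>(v, r::real). F v"
  have 1: "htpy V T ?U" "\<forall>v\<in>points V. ?U (v, 0) = F v"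
    using F by (auto intro: htpy_const)
  have 2: "\<forall>w\<in>points W. \<forall>r\<in>{0..1}. ?U (c w, r) = P (w, 1 - 2 * r)"
    using P c F by (auto simp: W pointed_map_base)
  have 3: "\<exists>G. htpy V T G \<and> (\<forall>w\<in>points W. \<forall>s\<in>{0..1}. G (c w, s) = P (w, s)) \<and>
      (\<forall>v\<in>points V. G (v, 0) = E (v, 0) \<and> G (v, 1) = F v)"
    if "htpy V T E \<and> (\<forall>w\<in>points W. \<forall>r\<in>{0..1}. E (c w, r) = P (w, - r)) \<and>
             (\<forall>v\<in>points V. E (v, 1) = ?U (v, 1))" for E
    using that P c by (intro exI[of _ E]) (auto simp: W htpy_base)
  show "\<exists>U. fills W V c T F P U"
    unfolding fills_def
    by (rule exI[of _ ?U]) (use 1 2 3 in blast)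
qed

subsection \<open>Cones and suspensions\<close>

text \<open>A common form of cone and suspension: \<open>D\<close> is the set of collapsed heights,
  \<open>{1}\<close> or \<open>{0, 1}\<close>, and \<open>d\<close> in \<open>D\<close> is the
  height of the point representing the collapsed set. Functoriality is then proved once for
  both.\<close>

definition cyl_collapse :: "'a pointed \<Rightarrow> real set \<Rightarrow> real \<Rightarrow> 'a \<times> real \<Rightarrow> 'a \<times> real" where
  "cyl_collapse X D d = collapse (points X \<times> D \<union> {base X} \<times> {0..1}) (base X, d)"

definition cyl_quotient :: "'a pointed \<Rightarrow> real set \<Rightarrow> real \<Rightarrow> ('a \<times> real) pointed" where
  "cyl_quotient X D d = (quotient_space (prod_topology (fst X) unit_interval) (cyl_collapse X D d), (base X, d))"

lemma cone_map_eq: "cone_map X = cyl_collapse X {1} 1"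
  and reduced_cone_eq: "reduced_cone X = cyl_quotient X {1} 1"
  and suspension_eq: "suspension X = cyl_quotient X {0, 1} 0"
  by (simp_all add: cone_map_def reduced_cone_def suspension_def cyl_collapse_def cyl_quotient_def)

lemma base_cyl_quotient [simp]: "base (cyl_quotient X D d) = (base X, d)"
  by (simp add: cyl_quotient_def)

lemma points_cyl_quotient: "points (cyl_quotient X D d) = cyl_collapse X D d ` (points X \<times> {0..1})"
  by (simp add: cyl_quotient_def)

lemma quotient_map_cyl_collapse: "quotient_map (prod_topology (fst X) unit_interval) (fst (cyl_quotient X D d)) (cyl_collapse X D d)"
  by (simp add: cyl_quotient_def quotient_map_quotient_space)

lemma continuous_map_cyl_collapse: "continuous_map (prod_topology (fst X) unit_interval) (fst (cyl_quotient X D d)) (cyl_collapse X D d)"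
  by (rule quotient_imp_continuous_map[OF quotient_map_cyl_collapse])

lemma cyl_collapse_collapsed:
  "x \<in> points X \<Longrightarrow> s \<in> {0..1} \<Longrightarrow> s \<in> D \<or> x = base X \<Longrightarrow> cyl_collapse X D d (x, s) = (base X, d)"
  by (auto simp: cyl_collapse_def collapse_def)

lemma cyl_collapse_other: "s \<notin> D \<Longrightarrow> x \<noteq> base X \<Longrightarrow> cyl_collapse X D d (x, s) = (x, s)"
  by (auto simp: cyl_collapse_def collapse_def)

text \<open>A point of the quotient is its own representative in the cylinder. For the collapsed set
  this uses \<open>d \<in> D\<close>, which makes the chosen representative a member of the
  set.\<close>

lemma cyl_quotient_cases:
  assumes "pointed_space X" "d \<in> D" "D \<subseteq> {0..1}" "v \<in> points (cyl_quotient X D d)"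
  obtains x s where "v = (x, s)" "x \<in> points X" "s \<in> {0..1}" "cyl_collapse X D d (x, s) = (x, s)"
proof -
  from assms(4) obtain x s where xs: "x \<in> points X" "s \<in> {0..1}" "v = cyl_collapse X D d (x, s)"
    unfolding points_cyl_quotient by auto
  show ?thesis
  proof (cases "s \<in> D \<or> x = base X")
    case True
    then have "v = (base X, d)"
      using xs cyl_collapse_collapsed by metis
    then show ?thesis
      using that[of "base X" d] assms(1-3) cyl_collapse_collapsed[of "base X" X d D d]
        by (auto simp: pointed_space_def)
  next
    case False
    then show ?thesis
      using that[of x s] xs cyl_collapse_other[of s D x X d] by auto
  qed
qed

text \<open>Points of the quotient are pairs of the cylinder, so one function \<open>K\<close>
  serves on both. If it is constant on the collapsed set, composing it with the collapse does not
  change it there, and off this set the collapse is the identity.\<close>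

lemma cyl_quotient_htpyI:
  assumes X: "pointed_space X" and D: "d \<in> D" "D \<subseteq> {0..1}"
    and K: "continuous_map (prod_topology (prod_topology (fst X) unit_interval) unit_interval) (fst T) K"
    and K1: "\<And>x s t. x \<in> points X \<Longrightarrow> s \<in> {0..1} \<Longrightarrow> t \<in> {0..1} \<Longrightarrow> s \<in> D \<or> x = base X
      \<Longrightarrow> K ((x, s), t) = base T"
  shows "htpy (cyl_quotient X D d) T K"
  unfolding htpy_def
proof
  have X': "base X \<in> points X" "d \<in> {0..1}"
    using X D by (auto simp: pointed_space_def)
  show "continuous_map (prod_topology (fst (cyl_quotient X D d)) unit_interval) (fst T) K"
  proof (rule continuous_map_quotient_times[OF quotient_map_cyl_collapse], rule continuous_map_eq[OF K])
    fix p assume "p \<in> topspace (prod_topology (prod_topology (fst X) unit_interval) unit_interval)"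
    then obtain x s t where p: "p = ((x, s), t)" "x \<in> points X" "s \<in> {0..1}" "t \<in> {0..1}"
      by auto
    show "K p = (case p of (x, t) \<Rightarrow> K (cyl_collapse X D d x, t))"
    proof (cases "s \<in> D \<or> x = base X")
      case True
      show ?thesis
        using p K1[OF p(2-4) True] K1[OF X' p(4)] D cyl_collapse_collapsed[OF p(2,3) True, of d] by simp
    qed (use p in \<open>simp add: cyl_collapse_other\<close>)
  qed
  show "\<forall>t\<in>{0..1}. K (base (cyl_quotient X D d), t) = base T"
    using K1[OF X'] by simp
qed

lemma continuous_map_fst_fst: "continuous_map (prod_topology (prod_topology A B) C) A (\<lambda>p. fst (fst p))"
  and continuous_map_snd_fst: "continuous_map (prod_topology (prod_topology A B) C) B (\<lambda>p. snd (fst p))"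
  by (rule continuous_map_compose'[OF _ continuous_map_fst], rule continuous_map_fst continuous_map_snd)+

definition cyl_fun :: "real set \<Rightarrow> real \<Rightarrow> 'b pointed \<Rightarrow> ('a \<Rightarrow> 'b) \<Rightarrow> 'a \<times> real \<Rightarrow> 'b \<times> real" where
  "cyl_fun D d Y f = (\<lambda>(x, s). cyl_collapse Y D d (f x, s))"

lemma cyl_fun_htpy:
  assumes X: "pointed_space X" and D: "d \<in> D" "D \<subseteq> {0..1}" and K: "htpy X Y K"
  shows "htpy (cyl_quotient X D d) (cyl_quotient Y D d) (\<lambda>(v, t). cyl_fun D d Y (\<lambda>x. K (x, t)) v)"
proof (rule cyl_quotient_htpyI[OF X D])
  let ?S = "prod_topology (prod_topology (fst X) unit_interval) unit_interval"
  have "continuous_map ?S (fst (cyl_quotient Y D d)) (\<lambda>p. cyl_collapse Y D d (K (fst (fst p), snd p), snd (fst p)))"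
    by (rule continuous_map_compose2'[OF continuous_map_cyl_collapse continuous_map_compose2'[of _ _ _ K,
        OF _ continuous_map_fst_fst continuous_map_snd] continuous_map_snd_fst])
       (use K in \<open>simp add: htpy_def\<close>)
  then show "continuous_map ?S (fst (cyl_quotient Y D d)) (\<lambda>(v, t). cyl_fun D d Y (\<lambda>x. K (x, t)) v)"
    by (simp add: cyl_fun_def case_prod_unfold)
  fix x s t assume *: "x \<in> points X" "s \<in> {0..1::real}" "t \<in> {0..1::real}" "s \<in> D \<or> x = base X"
  show "(case ((x, s), t) of (v, t) \<Rightarrow> cyl_fun D d Y (\<lambda>x. K (x, t)) v) = base (cyl_quotient Y D d)"
    using cyl_collapse_collapsed[of "K (x, t)" Y s D d] htpy_in[OF K *(1,3)] * htpy_base[OF K *(3)]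
    by (auto simp: cyl_fun_def)
qed

lemma cyl_fun_comp:
  assumes X: "pointed_space X" and Y: "pointed_space Y" and D: "d \<in> D" "D \<subseteq> {0..1}"
    and v: "v \<in> points (cyl_quotient X D d)"
    and f: "\<And>x. x \<in> points X \<Longrightarrow> f x \<in> points Y" and g: "\<And>y. y \<in> points Y \<Longrightarrow> g y \<in> points Z"
      "g (base Y) = base Z"
  shows "cyl_fun D d Z g (cyl_fun D d Y f v) = cyl_fun D d Z (\<lambda>x. g (f x)) v"
proof -
  obtain x s where xs: "v = (x, s)" "x \<in> points X" "s \<in> {0..1}"
    using cyl_quotient_cases[OF X D v] by blast
  show ?thesis
  \<comment> \<open>If \<open>f x\<close> is the base point, the inner collapse may change the
    height from \<open>s\<close> to \<open>d\<close>. Both sides are then the collapsed point,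
    because \<open>g\<close> preserves base points.\<close>
  proof (cases "s \<in> D \<or> f x = base Y")
    case True
    have b: "base Z \<in> points Z" "d \<in> {0..1}" using Y D g by (force simp: pointed_space_def)+
    have "cyl_fun D d Z g (cyl_fun D d Y f v) = cyl_collapse Z D d (base Z, d)"
      using cyl_collapse_collapsed[OF f[OF xs(2)] xs(3) True, of d] g by (simp add: cyl_fun_def xs)
    also have "\<dots> = (base Z, d)"
      using b by (intro cyl_collapse_collapsed) auto
    also have "\<dots> = cyl_fun D d Z (\<lambda>x. g (f x)) v"
      using True cyl_collapse_collapsed[of "g (f x)" Z s D d] xs g f[OF xs(2)]
        by (auto simp: cyl_fun_def)
    finally show ?thesis .
  qed (simp add: cyl_fun_def xs cyl_collapse_other)
qed

lemma cyl_fun_id: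
  assumes X: "pointed_space X" and D: "d \<in> D" "D \<subseteq> {0..1}"
    and v: "v \<in> points (cyl_quotient X D d)" and f: "\<And>x. x \<in> points X \<Longrightarrow> f x = x"
  shows "cyl_fun D d X f v = v"
  by (rule cyl_quotient_cases[OF X D v]) (simp add: cyl_fun_def f)

lemma cyl_fun_cong:
  assumes X: "pointed_space X" and D: "d \<in> D" "D \<subseteq> {0..1}"
    and v: "v \<in> points (cyl_quotient X D d)" and f: "\<And>x. x \<in> points X \<Longrightarrow> f x = g x"
  shows "cyl_fun D d Y f v = cyl_fun D d Y g v"
  by (rule cyl_quotient_cases[OF X D v]) (simp add: cyl_fun_def f)

lemma cone_base_pointed_map:
  assumes "pointed_space X"
  shows "pointed_map X (reduced_cone X) (cone_base X)"
proof -
  have "continuous_map (fst X) (fst (reduced_cone X)) (\<lambda>x. cone_map X (x, 0))"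
    unfolding cone_map_eq reduced_cone_eq
    by (rule continuous_map_compose2'[OF continuous_map_cyl_collapse]) auto
  then show ?thesis
    using assms by (auto simp: pointed_map_def cone_base_def[abs_def] cone_map_eq reduced_cone_eq
        pointed_space_def intro!: cyl_collapse_collapsed)
qed

lemma cone_base_inj:
  assumes "pointed_space X" "x \<in> points X" "y \<in> points X" "cone_base X x = cone_base X y"
  shows "x = y"
  using assms unfolding cone_base_def cone_map_eq
  by (cases "x = base X"; cases "y = base X") (auto simp: cyl_collapse_collapsed cyl_collapse_other)

lemma continuous_map_square:
  assumes "continuous_on ({0..1} \<times> {0..1}) (\<lambda>(t, r). q t r)"
    and "\<And>t r. t \<in> {0..1} \<Longrightarrow> r \<in> {0..1} \<Longrightarrow> q t r \<in> S"
  shows "continuous_map (prod_topology (prod_topology X unit_interval) unit_interval) (top_of_set S)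
           (\<lambda>p. q (snd (fst p)) (snd p) :: real)"
proof -
  have 1: "continuous_map (prod_topology (prod_topology X unit_interval) unit_interval) (prod_topology unit_interval unit_interval) (\<lambda>p. (snd (fst p), snd p))"
    by (rule continuous_map_pairedI[OF continuous_map_snd_fst continuous_map_snd])
  have "continuous_map (prod_topology unit_interval unit_interval) (top_of_set S) (\<lambda>(t, r). q t r)"
    using assms by (auto simp: continuous_map_in_subtopology)
  then show ?thesis
    using continuous_map_compose'[OF _ 1, of "top_of_set S" "\<lambda>(t, r). q t r"] by (simp only: prod.case)
qed

lemma continuous_map_square_real:
  assumes "continuous_on ({0..1} \<times> {0..1}) (\<lambda>(t, r). q t r)"
  shows "continuous_map (prod_topology (prod_topology X unit_interval) unit_interval) euclideanreal
           (\<lambda>p. q (snd (fst p)) (snd p))"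
  using continuous_map_square[of q UNIV X] assms by simp

lemma fillable_cone:
  assumes S: "pointed_space S"
  shows "fillable S (reduced_cone S) (cone_base S) T"
  unfolding fillable_def
proof (intro allI impI, elim conjE)
  let ?V = "reduced_cone S" and ?q = "cyl_collapse S {1} 1"
  let ?SII = "prod_topology (prod_topology (fst S) unit_interval) unit_interval"
  fix F P
  assume F: "pointed_map ?V T F"
    and P: "continuous_map (prod_topology (fst S) (top_of_set {-1..1})) (fst T) P"
    and P0: "\<forall>s\<in>{-1..1::real}. P (base S, s) = base T"
    and PF: "\<forall>w\<in>points S. P (w, 1) = F (cone_base S w)"
  have V: "?V = cyl_quotient S {1} 1"
    by (simp add: reduced_cone_eq)
  have S0: "base S \<in> points S" using S by (simp add: pointed_space_def)
  have cF: "continuous_map (fst ?V) (fst T) F"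
    and F0: "F (base S, 1) = base T"
    using F by (auto simp: pointed_map_def V)
  have q0: "?q (base S, s) = (base S, 1)" if "s \<in> {0..1}" for s
    using S0 that by (intro cyl_collapse_collapsed) auto
  have q1: "?q (x, 1) = (base S, 1)" if "x \<in> points S" for x
    using that by (intro cyl_collapse_collapsed) auto
  have P_cont: "continuous_map ?SII (fst T) (\<lambda>p. P (fst (fst p), q (snd (fst p)) (snd p)))"
    if "continuous_on ({0..1} \<times> {0..1}) (\<lambda>(t, r). q t r)"
      "\<And>t r. t \<in> {0..1} \<Longrightarrow> r \<in> {0..1} \<Longrightarrow> q t r \<in> {-1..1}" for q
    by (rule continuous_map_compose2'[OF P continuous_map_fst_fst continuous_map_square[OF that]])
  have q_cont: "continuous_map ?SII (fst ?V) (\<lambda>p. ?q (fst (fst p), q (snd (fst p)) (snd p)))"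
    if "continuous_on ({0..1} \<times> {0..1}) (\<lambda>(t, r). q t r)"
      "\<And>t r. t \<in> {0..1} \<Longrightarrow> r \<in> {0..1} \<Longrightarrow> q t r \<in> {0..1}" for q
    unfolding V
    by (rule continuous_map_compose2'[OF continuous_map_cyl_collapse continuous_map_fst_fst continuous_map_square[OF that]])
  have ifc: "cone_base S w = ?q (w, 0)" for w
    by (simp add: cone_base_def cone_map_eq)
  \<comment> \<open>The base of the cone consists of the pairs \<open>(w, 0)\<close>, except that
    the base point is represented by \<open>(base S, 1)\<close>. There pointedness of
    \<open>H\<close> replaces the computation at height 0.\<close>
  have reduce: "\<forall>w\<in>points S. \<forall>r\<in>{0..1}. H (cone_base S w, r) = Q w r"
    if H: "htpy ?V T H" and "\<And>w r. w \<in> points S \<Longrightarrow> w \<noteq> base S \<Longrightarrow> r \<in> {0..1} \<Longrightarrow> H ((w, 0), r) = Q w r"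
      "\<And>r. r \<in> {0..1} \<Longrightarrow> Q (base S) r = base T" for H Q
  proof (intro ballI)
    fix w r assume w: "w \<in> points S" "r \<in> {0..1::real}"
    show "H (cone_base S w, r) = Q w r"
    proof (cases "w = base S")
      case True
      then show ?thesis
        using that(3)[OF w(2)] htpy_base[OF H w(2)] q0[of 0] by (simp add: ifc V)
    next
      case False
      then show ?thesis
        using that(2)[OF w(1) _ w(2)] by (simp add: ifc cyl_collapse_other)
    qed
  qed
  \<comment> \<open>At time \<open>r\<close> the collar is \<open>2 * t \<le> r\<close>, and
    \<open>?u\<close> stretches the remaining heights, from \<open>r/2\<close> to 1, affinely onto
    \<open>{0..1}\<close>. The coefficient 4 in \<open>U\<close> below makes the path parameter rise
    from \<open>1 - 2 * r\<close> at the base to 1 at the edge of the collar, where \<open>P\<close>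
    meets \<open>F\<close>.\<close>
  let ?u = "\<lambda>t r. max 0 ((2 * t - r) / (2 - r)) :: real"
  have u_cont: "continuous_on ({0..1} \<times> {0..1}) (\<lambda>(t, r). ?u t r)"
    by (auto simp: case_prod_unfold intro!: continuous_intros)
  have u_in: "?u t r \<in> {0..1}" if "t \<in> {0..1}" "r \<in> {0..1}" for t r
    using that by (auto simp: divide_simps)
  \<comment> \<open>The collar \<open>2t \<le> r\<close> carries the path \<open>P\<close>, the rest of the cone a rescaled \<open>F\<close>.\<close>
  define U where "U = (\<lambda>p. if 2 * snd (fst p) - snd p \<le> 0
      then P (fst (fst p), min 1 (1 - 2 * snd p + 4 * snd (fst p)))
      else F (?q (fst (fst p), ?u (snd (fst p)) (snd p))))"
  have "htpy (cyl_quotient S {1} 1) T U"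
  proof (rule cyl_quotient_htpyI[OF S])
    show "continuous_map ?SII (fst T) U"
      unfolding U_def
    proof (rule continuous_map_glue)
      show "continuous_map ?SII euclideanreal (\<lambda>x. 2 * snd (fst x) - snd x)"
        by (rule continuous_map_square_real) (auto simp: case_prod_unfold intro!: continuous_intros)
      show "continuous_map ?SII (fst T) (\<lambda>x. P (fst (fst x), min 1 (1 - 2 * snd x + 4 * snd (fst x))))"
        by (rule P_cont) (auto simp: case_prod_unfold intro!: continuous_intros)
      show "continuous_map ?SII (fst T) (\<lambda>x. F (?q (fst (fst x), ?u (snd (fst x)) (snd x))))"
        by (rule continuous_map_compose'[OF cF q_cont[OF u_cont u_in]])
      show "P (fst (fst x), min 1 (1 - 2 * snd x + 4 * snd (fst x))) = F (?q (fst (fst x), ?u (snd (fst x)) (snd x)))"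
        if "x \<in> topspace ?SII" "2 * snd (fst x) - snd x = 0" for x
      proof -
        have "min 1 (1 - 2 * snd x + 4 * snd (fst x)) = 1" "?u (snd (fst x)) (snd x) = 0"
          using that(2) by (auto simp: min_def)
        then show ?thesis
          using that PF by (auto simp: ifc)
      qed
    qed
    fix x s t assume *: "x \<in> points S" "s \<in> {0..1::real}" "t \<in> {0..1::real}" "s \<in> {1} \<or> x = base S"
    have "?u s t = 1" if "s = 1"
      using that * by (auto simp: max_def)
    then show "U ((x, s), t) = base T"
      using * P0 F0 q0[OF u_in[OF *(2,3)]] q1 by (auto simp: U_def)
  qed auto
  then have U: "htpy ?V T U" by (simp add: V)
  have U0: "\<forall>v\<in>points ?V. U (v, 0) = F v"
  proof
    fix v assume "v \<in> points ?V"
    then obtain x s where xs: "v = (x, s)" "x \<in> points S" "s \<in> {0..1}" "?q (x, s) = (x, s)"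
      using cyl_quotient_cases[OF S _ _ , of 1 "{1}" v] by (auto simp: V)
    show "U (v, 0) = F v"
      using xs PF by (auto simp: U_def ifc)
  qed
  have Uc: "\<forall>w\<in>points S. \<forall>r\<in>{0..1}. U (cone_base S w, r) = P (w, 1 - 2 * r)"
    by (rule reduce[OF U]) (use P0 in \<open>auto simp: U_def\<close>)
  \<comment> \<open>At time \<open>s\<close> the collar of \<open>G\<close> is
    \<open>2 * t \<le> m s\<close>; it vanishes at \<open>s = 0\<close> and \<open>s = 1\<close>,
    where \<open>G\<close> has to be \<open>E\<close> at its start and \<open>F\<close> on the
    entire cone, and \<open>g\<close> stretches the rest of the cone. The slope 6 in
    \<open>s - 6 * t\<close> fits both halves: at the edge the parameter is
    \<open>s - 3 * m s\<close>, which is \<open>- 2 * s\<close> before \<open>1/2\<close> and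
    \<open>1 - 2 * (2 - 2 * s)\<close> after it, the boundary parameters of \<open>E\<close> at time
    \<open>2 * s\<close> and of \<open>U\<close> at time \<open>2 - 2 * s\<close>.\<close>
  define m where "m s = min s (1 - s)" for s :: real
  define g where "g t s = max 0 ((2 * t - m s) / (2 - m s))" for t s
  have m: "0 \<le> m s" "m s \<le> 1/2" if "s \<in> {0..1}" for s
    using that by (auto simp: m_def min_def)
  have g_cont: "continuous_on ({0..1} \<times> {0..1}) (\<lambda>(t, r). g t r)"
  proof -
    have "2 - min s (1 - s) \<noteq> 0" for s :: real by auto
    then show ?thesis
      by (auto simp: case_prod_unfold g_def m_def intro!: continuous_intros)
  qed
  have g_in: "g t s \<in> {0..1}" if "t \<in> {0..1}" "s \<in> {0..1}" for t s
    using that m[of s] by (auto simp: g_def divide_simps)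
  have fill: "\<exists>G. htpy ?V T G \<and> (\<forall>w\<in>points S. \<forall>s\<in>{0..1}. G (cone_base S w, s) = P (w, s)) \<and>
              (\<forall>v\<in>points ?V. G (v, 0) = E (v, 0) \<and> G (v, 1) = F v)"
    if E: "htpy ?V T E" and EP: "\<forall>w\<in>points S. \<forall>r\<in>{0..1}. E (cone_base S w, r) = P (w, - r)"
      and EU: "\<forall>v\<in>points ?V. E (v, 1) = U (v, 1)" for E
  proof -
    have cE: "continuous_map (prod_topology (fst ?V) unit_interval) (fst T) E"
      and cU: "continuous_map (prod_topology (fst ?V) unit_interval) (fst T) U"
      using E U by (auto simp: htpy_def)
    have qV: "?q (x, s) \<in> points ?V" if "x \<in> points S" "s \<in> {0..1}" for x s
      using that by (auto simp: V points_cyl_quotient)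
    \<comment> \<open>On the collar \<open>2t \<le> m s\<close> the path runs from \<open>P s\<close> to \<open>P (- 2s)\<close> for \<open>s \<le> 1/2\<close> and to
      \<open>P (4s - 3)\<close> for \<open>s \<ge> 1/2\<close>; there \<open>E\<close>, respectively \<open>U\<close> run backwards, takes over.\<close>
    define K where "K = (\<lambda>p. if snd p - 1/2 \<le> 0
        then E (?q (fst (fst p), g (snd (fst p)) (snd p)), min 1 (2 * snd p))
        else U (?q (fst (fst p), g (snd (fst p)) (snd p)), min 1 (2 - 2 * snd p)))"
    define G where "G = (\<lambda>p. if 2 * snd (fst p) - m (snd p) \<le> 0
        then P (fst (fst p), max (-1) (snd p - 6 * snd (fst p))) else K p)"
    have half: "continuous_map ?SII unit_interval (\<lambda>p. min 1 (2 * snd p))"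
      "continuous_map ?SII unit_interval (\<lambda>p. min 1 (2 - 2 * snd p))"
      using continuous_map_square[of "\<lambda>t r. min 1 (2 * r)" "{0..1}" "fst S"]
        continuous_map_square[of "\<lambda>t r. min 1 (2 - 2 * r)" "{0..1}" "fst S"]
      by (simp_all add: case_prod_unfold continuous_intros)
    have cK: "continuous_map ?SII (fst T) K"
      unfolding K_def
    proof (rule continuous_map_glue)
      show "continuous_map ?SII euclideanreal (\<lambda>x. snd x - 1/2)"
        by (rule continuous_map_square_real[of "\<lambda>t s. s - 1/2"]) (auto simp: case_prod_unfold intro!: continuous_intros)
      show "continuous_map ?SII (fst T) (\<lambda>p. E (?q (fst (fst p), g (snd (fst p)) (snd p)), min 1 (2 * snd p)))"
        by (rule continuous_map_compose2'[OF cE q_cont[OF g_cont g_in] half(1)])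
      show "continuous_map ?SII (fst T) (\<lambda>p. U (?q (fst (fst p), g (snd (fst p)) (snd p)), min 1 (2 - 2 * snd p)))"
        by (rule continuous_map_compose2'[OF cU q_cont[OF g_cont g_in] half(2)])
      fix x assume x: "x \<in> topspace ?SII" "snd x - 1/2 = 0"
      then have "snd x = 1/2" by simp
      then have "min 1 (2 * snd x) = 1" "min 1 (2 - 2 * snd x) = 1" by simp_all
      moreover have "?q (fst (fst x), g (snd (fst x)) (snd x)) \<in> points ?V"
        by (rule qV[OF _ g_in]) (use x in auto)
      ultimately show "E (?q (fst (fst x), g (snd (fst x)) (snd x)), min 1 (2 * snd x)) =
         U (?q (fst (fst x), g (snd (fst x)) (snd x)), min 1 (2 - 2 * snd x))"
        using EU by simp
    qed
    have "htpy (cyl_quotient S {1} 1) T G"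
    proof (rule cyl_quotient_htpyI[OF S])
      show "continuous_map ?SII (fst T) G"
        unfolding G_def
      proof (rule continuous_map_glue[OF _ _ cK])
        show "continuous_map ?SII euclideanreal (\<lambda>x. 2 * snd (fst x) - m (snd x))"
          unfolding m_def
          by (rule continuous_map_square_real) (auto simp: case_prod_unfold intro!: continuous_intros)
        show "continuous_map ?SII (fst T) (\<lambda>p. P (fst (fst p), max (-1) (snd p - 6 * snd (fst p))))"
          by (rule P_cont) (auto simp: case_prod_unfold intro!: continuous_intros)
        fix p assume p: "p \<in> topspace ?SII" "2 * snd (fst p) - m (snd p) = 0"
        obtain x t s where xts: "p = ((x, t), s)" by (metis prod.exhaust)
        have x: "x \<in> points S" "t \<in> {0..1}" "s \<in> {0..1}" and t: "2 * t = m s"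
          using p by (auto simp: xts)
        have g0: "g t s = 0" using t by (simp add: g_def)
        show "P (fst (fst p), max (-1) (snd p - 6 * snd (fst p))) = K p"
        proof (cases "s \<le> 1/2")
          case True
          then have "m s = s" by (simp add: m_def)
          then have "max (-1) (s - 6 * t) = - (2 * s)" using t True by simp
          moreover have "K p = P (x, - (2 * s))"
            using True EP x unfolding K_def xts by (simp add: g0 ifc[symmetric])
          ultimately show ?thesis by (simp add: xts)
        next
          case False
          then have "m s = 1 - s" by (simp add: m_def)
          then have "max (-1) (s - 6 * t) = 1 - 2 * (2 - 2 * s)" using t False by simp
          moreover have "K p = P (x, 1 - 2 * (2 - 2 * s))"
            using False Uc x unfolding K_def xts by (simp add: g0 ifc[symmetric])
          ultimately show ?thesis by (simp add: xts)
        qed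
      qed
      fix x s t assume *: "x \<in> points S" "s \<in> {0..1::real}" "t \<in> {0..1::real}" "s \<in> {1} \<or> x = base S"
      have g: "g s t = 1" if "s = 1"
        using that m[OF *(3)] by (auto simp: g_def max_def)
      have "K ((x, s), t) = base T"
      proof -
        have "?q (x, g s t) = (base S, 1)"
          using *(4) q0[OF g_in[OF *(2,3)]] q1[OF *(1)] g by auto
        moreover have "E ((base S, 1), 2 * t) = base T" if "t \<le> 1/2"
          using htpy_base[OF E, of "2 * t"] *(3) that by (simp add: V)
        moreover have "U ((base S, 1), 2 - 2 * t) = base T" if "t > 1/2"
          using htpy_base[OF U, of "2 - 2 * t"] *(3) that by (simp add: V)
        ultimately show ?thesis
          by (simp add: K_def)
      qed
      \<comment> \<open>The tip \<open>s = 1\<close> is outside the collar since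
        \<open>m t \<le> 1/2\<close>. Hence the collar meets the collapsed set only over the base
        point, where \<open>P\<close> is constant.\<close>
      moreover have "x = base S" if "2 * s - m t \<le> 0"
        using that m[OF *(3)] *(4) by auto
      moreover have "P (base S, max (-1) (t - 6 * s)) = base T"
        using P0 * by auto
      ultimately show "G ((x, s), t) = base T"
        by (auto simp: G_def)
    qed auto
    then have G: "htpy ?V T G" by (simp add: V)
    have "\<forall>w\<in>points S. \<forall>s\<in>{0..1}. G (cone_base S w, s) = P (w, s)"
      by (rule reduce[OF G]) (use P0 in \<open>auto simp: G_def m_def min_def\<close>)
    moreover have "G (v, 0) = E (v, 0) \<and> G (v, 1) = F v" if "v \<in> points ?V" for v
    proof -
      obtain x t where xt: "v = (x, t)" "x \<in> points S" "t \<in> {0..1}" "?q (x, t) = (x, t)"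
        using cyl_quotient_cases[OF S _ _ , of 1 "{1}" v] \<open>v \<in> points ?V\<close> by (auto simp: V)
      have "U ((x, t), 0) = F (x, t)"
        using U0 that xt by auto
      moreover have "E ((x, 0), 0) = P (x, 0)" "F (x, 0) = P (x, 1)" if "t = 0"
        using EP PF xt that by (auto simp: ifc)
      ultimately show ?thesis
        using xt(2-) by (auto simp: xt(1) G_def K_def m_def g_def)
    qed
    ultimately show ?thesis
      using G by blast
  qed
  show "\<exists>U. fills S ?V (cone_base S) T F P U"
    unfolding fills_def
    by (rule exI[of _ U]) (use U U0 Uc fill in blast)
qed

subsection \<open>Wedges of pairs\<close>

lemma wedge_map_incl:
  "f (base X) = base Y \<Longrightarrow> wedge_map Y f (wedge_incl X j x) = wedge_incl Y j (f x)"
  by (simp add: wedge_map_def wedge_incl_def)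

lemma wedge_map_None [simp]: "wedge_map Y f None = None"
  by (simp add: wedge_map_def)

lemma wedge_map_comp:
  "g (base Y) = base Z \<Longrightarrow> wedge_map Z g (wedge_map Y f p) = wedge_map Z (\<lambda>x. g (f x)) p"
  by (auto simp: wedge_map_def wedge_incl_def split: option.split)

lemma wedge_map_cong:
  "p \<in> points (wedge J X) \<Longrightarrow> (\<And>x. x \<in> points X \<Longrightarrow> f x = g x) \<Longrightarrow> wedge_map Y f p = wedge_map Y g p"
  by (auto simp: wedge_map_def points_wedge)

lemma wedge_map_id:
  "p \<in> points (wedge J X) \<Longrightarrow> (\<And>x. x \<in> points X \<Longrightarrow> f x = x) \<Longrightarrow> wedge_map X f p = p"
  by (auto simp: wedge_map_def wedge_incl_def points_wedge split: if_splits)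

lemma wedge_map_htpy:
  assumes X: "pointed_space X" and K: "htpy X Y K"
  shows "htpy (wedge J X) (wedge J Y) (\<lambda>(p, t). wedge_map Y (\<lambda>x. K (x, t)) p)"
proof (rule wedge_htpy[OF X])
  fix j assume j: "j \<in> J"
  show "htpy X (wedge J Y) (\<lambda>(x, t). case (wedge_incl X j x, t) of (p, t) \<Rightarrow> wedge_map Y (\<lambda>x. K (x, t)) p)"
    by (rule htpy_cong[OF X htpy_post[OF K pointed_map_wedge_incl[OF j]]])
       (use htpy_base[OF K] in \<open>simp add: wedge_map_incl\<close>)
qed simp_all

lemma wedge_map_pointed_map:
  "pointed_space X \<Longrightarrow> pointed_map X Y f \<Longrightarrow> pointed_map (wedge J X) (wedge J Y) (wedge_map Y f)"
  using wedge_map_htpy[of X Y "\<lambda>(x, t). f x" J] by (simp add: pointed_map_iff_htpy)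

text \<open>Each summand is filled separately and the fillings are chosen simultaneously. The pieces
  fit together because all of them are pointed, and a homotopy \<open>E\<close> on the wedge is
  handled by restricting it to the summands.\<close>

lemma fillable_wedge:
  fixes S :: "'s pointed" and V :: "'v pointed" and T :: "'t pointed" and J :: "'j set"
  assumes S: "pointed_space S" and V: "pointed_space V" and T: "pointed_space T"
    and c: "pointed_map S V c" and fill: "fillable S V c T"
  shows "fillable (wedge J S) (wedge J V) (wedge_map V c) T"
  unfolding fillable_def
proof (intro allI impI, elim conjE)
  fix F P
  assume F: "pointed_map (wedge J V) T F"
    and P: "continuous_map (prod_topology (fst (wedge J S)) (top_of_set {-1..1})) (fst T) P"
    and P0: "\<forall>s\<in>{-1..1::real}. P (base (wedge J S), s) = base T"
    and PF: "\<forall>w\<in>points (wedge J S). P (w, 1) = F (wedge_map V c w)"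
  have cS: "wedge_map V c (wedge_incl S j x) = wedge_incl V j (c x)" for j :: 'j and x
    by (rule wedge_map_incl[where f = c and X = S, OF pointed_map_base[OF c]])
  have "\<exists>U. fills S V c T (\<lambda>v. F (wedge_incl V j v)) (\<lambda>(w, s). P (wedge_incl S j w, s)) U"
    if j: "j \<in> J" for j
  proof -
    have 1: "pointed_map V T (\<lambda>v. F (wedge_incl V j v))"
      by (rule pointed_map_comp[OF pointed_map_wedge_incl[OF j] F])
    have 2: "continuous_map (prod_topology (fst S) (top_of_set {-1..1})) (fst T) (\<lambda>(w, s). P (wedge_incl S j w, s))"
      unfolding case_prod_unfold
      by (rule continuous_map_compose2'[OF P continuous_map_compose'[OF _ continuous_map_fst]
        continuous_map_snd])
         (use pointed_map_wedge_incl[OF j, of S] in \<open>simp add: pointed_map_def\<close>)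
    have 3: "wedge_incl S j (base S) = base (wedge J S)" by (simp add: wedge_incl_def)
    show ?thesis
      using fill[unfolded fillable_def, rule_format,
          of "\<lambda>v. F (wedge_incl V j v)" "\<lambda>(w, s). P (wedge_incl S j w, s)"]
            1 2 P0 PF wedge_incl_in[OF j, of _ S]
      by (simp add: 3 cS)
  qed
  then obtain U where U': "\<And>j. j \<in> J \<Longrightarrow>
      fills S V c T (\<lambda>v. F (wedge_incl V j v)) (\<lambda>(w, s). P (wedge_incl S j w, s)) (U j)"
    by metis
  have U: "\<And>j. j \<in> J \<Longrightarrow> htpy V T (U j)"
    "\<And>j v. j \<in> J \<Longrightarrow> v \<in> points V \<Longrightarrow> U j (v, 0) = F (wedge_incl V j v)"
    "\<And>j w r. j \<in> J \<Longrightarrow> w \<in> points S \<Longrightarrow> r \<in> {0..1} \<Longrightarrow> U j (c w, r) = P (wedge_incl S j w, 1 - 2 * r)"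
    using U' by (simp_all add: fills_def)
  have fillj: "\<exists>G. htpy V T G \<and> (\<forall>w\<in>points S. \<forall>s\<in>{0..1}. G (c w, s) = P (wedge_incl S j w, s)) \<and>
              (\<forall>v\<in>points V. G (v, 0) = E (v, 0) \<and> G (v, 1) = F (wedge_incl V j v))"
    if "j \<in> J" "htpy V T E" "\<And>w r. w \<in> points S \<Longrightarrow> r \<in> {0..1} \<Longrightarrow> E (c w, r) = P (wedge_incl S j w, - r)"
      "\<And>v. v \<in> points V \<Longrightarrow> E (v, 1) = U j (v, 1)" for j E
    using U'[OF that(1), unfolded fills_def prod.case, THEN conjunct2, THEN conjunct2, THEN conjunct2, rule_format, of E] that
    by simp
  \<comment> \<open>A family of pointed homotopies on the summands, glued at the common base point.
    The value at \<open>None\<close> is forced, and \<open>lift_incl\<close> also covers the case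
    where the inclusion of a point is \<open>None\<close>.\<close>
  define lift :: "('j \<Rightarrow> 'v \<times> real \<Rightarrow> 't) \<Rightarrow> ('j \<times> 'v) option \<times> real \<Rightarrow> 't"
    where "lift h = (\<lambda>(p, r). case p of None \<Rightarrow> base T | Some (j, x) \<Rightarrow> h j (x, r))" for h
  have lift_incl: "lift h (wedge_incl V j x, r) = h j (x, r)"
    if "htpy V T (h j)" "r \<in> {0..1}" for h j x r
    using htpy_base[OF that] by (auto simp: lift_def wedge_incl_def)
  have lift_htpy: "htpy (wedge J V) T (lift h)" if h: "\<And>j. j \<in> J \<Longrightarrow> htpy V T (h j)" for h
  proof (rule wedge_htpy[OF V T])
    fix j assume "j \<in> J"
    from h[OF this] show "htpy V T (\<lambda>(x, t). lift h (wedge_incl V j x, t))"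
      by (rule htpy_cong[OF V]) (simp add: lift_incl h \<open>j \<in> J\<close>)
  qed (simp add: lift_def)
  have lift_c: "lift h (wedge_map V c w, r) = P (w, q)"
    if h: "\<And>j. j \<in> J \<Longrightarrow> htpy V T (h j)" "\<And>j x. j \<in> J \<Longrightarrow> x \<in> points S
      \<Longrightarrow> h j (c x, r) = P (wedge_incl S j x, q)"
      and w: "w \<in> points (wedge J S)" and "r \<in> {0..1}" "q \<in> {-1..1}" for h w r q
    using w
  proof (cases rule: wedge_cases)
    case 1
    then show ?thesis using P0 that by (simp add: lift_def)
  next
    case (2 j x)
    then show ?thesis using that by (simp add: cS lift_incl)
  qed
  have lift_F: "lift h (v, r) = F v"
    if h: "\<And>j. j \<in> J \<Longrightarrow> htpy V T (h j)" "\<And>j x. j \<in> J \<Longrightarrow> x \<in> points V \<Longrightarrow> h j (x, r) = F (wedge_incl V j x)"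
      and v: "v \<in> points (wedge J V)" and "r \<in> {0..1}" for h v r
    using v
  proof (cases rule: wedge_cases)
    case 1
    then show ?thesis using pointed_map_base[OF F] that by (simp add: lift_def)
  next
    case (2 j x)
    then show ?thesis using that by (simp add: lift_incl)
  qed
  have fillw: "\<exists>G. htpy (wedge J V) T G
    \<and> (\<forall>w\<in>points (wedge J S). \<forall>s\<in>{0..1}. G (wedge_map V c w, s) = P (w, s)) \<and>
              (\<forall>v\<in>points (wedge J V). G (v, 0) = E (v, 0) \<and> G (v, 1) = F v)"
    if E: "htpy (wedge J V) T E" and EP: "\<And>w r. w\<in>points (wedge J S) \<Longrightarrow> r\<in>{0..1}
      \<Longrightarrow> E (wedge_map V c w, r) = P (w, - r)"
      and EU: "\<And>v. v\<in>points (wedge J V) \<Longrightarrow> E (v, 1) = lift U (v, 1)" for E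
  proof -
    have "\<exists>G. htpy V T G \<and> (\<forall>w\<in>points S. \<forall>s\<in>{0..1}. G (c w, s) = P (wedge_incl S j w, s)) \<and>
              (\<forall>v\<in>points V. G (v, 0) = E (wedge_incl V j v, 0) \<and> G (v, 1) = F (wedge_incl V j v))"
      if j: "j \<in> J" for j
      using fillj[OF j htpy_pre[OF pointed_map_wedge_incl[OF j] E]] EP[OF wedge_incl_in[OF j]]
        EU[OF wedge_incl_in[OF j]]
      by (simp add: cS lift_incl U(1)[OF j])
    then have "\<exists>G. \<forall>j\<in>J. htpy V T (G j)
      \<and> (\<forall>w\<in>points S. \<forall>s\<in>{0..1}. G j (c w, s) = P (wedge_incl S j w, s)) \<and>
              (\<forall>v\<in>points V. G j (v, 0) = E (wedge_incl V j v, 0) \<and> G j (v, 1) = F (wedge_incl V j v))"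
      by (intro bchoice) blast
    then obtain G where G: "\<And>j. j \<in> J \<Longrightarrow> htpy V T (G j)"
      "\<And>j w s. j \<in> J \<Longrightarrow> w\<in>points S \<Longrightarrow> s\<in>{0..1} \<Longrightarrow> G j (c w, s) = P (wedge_incl S j w, s)"
      "\<And>j v. j \<in> J \<Longrightarrow> v\<in>points V \<Longrightarrow> G j (v, 0) = E (wedge_incl V j v, 0)"
      "\<And>j v. j \<in> J \<Longrightarrow> v\<in>points V \<Longrightarrow> G j (v, 1) = F (wedge_incl V j v)"
      by blast
    have "lift G (v, 0) = E (v, 0)" if "v \<in> points (wedge J V)" for v
      using that
    proof (cases rule: wedge_cases)
      case 1
      then show ?thesis using htpy_base[OF E, of 0] by (simp add: lift_def)
    next
      case (2 j x)
      then show ?thesis using G by (simp add: lift_incl)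
    qed
    then show ?thesis
      using lift_htpy[of G] lift_c[of G] lift_F[of G] G by (intro exI[of _ "lift G"]) simp
  qed
  show "\<exists>U. fills (wedge J S) (wedge J V) (wedge_map V c) T F P U"
    unfolding fills_def
  proof (rule exI[of _ "lift U"], safe)
    show "htpy (wedge J V) T (lift U)"
      by (rule lift_htpy) (rule U)
    show "lift U (v, 0) = F v" if "v \<in> points (wedge J V)" for v
      by (rule lift_F) (use that U in auto)
    show "lift U (wedge_map V c w, r) = P (w, 1 - 2 * r)" if "w \<in> points (wedge J S)" "r \<in> {0..1}"
      for w r
      by (rule lift_c) (use that U in auto)
  qed (use fillw in blast)
qed

section \<open>Cells as functors\<close>

lemma rename_htpy:
  assumes K: "htpy X T (\<lambda>(x, t). H (e x, t))"
  shows "htpy (rename e X) T H"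
  using K by (auto simp: htpy_def rename_def intro!: continuous_map_quotient_times[OF quotient_map_quotient_space])

lemma rename_pointed_map: "pointed_map X (rename e X) e"
  by (simp add: pointed_map_def rename_def quotient_imp_continuous_map[OF quotient_map_quotient_space])

lemma points_rename: "points (rename e X) = e ` points X"
  and base_rename: "base (rename e X) = e (base X)"
  by (simp_all add: rename_def)

text \<open>The renaming inside \<open>iterated_suspension\<close>, named in order to pair it with
  the left inverse \<open>susp_split\<close>. On points of a suspension the list is nonempty, so
  \<open>hd\<close> and \<open>tl\<close> recover the last suspension coordinate added and the
  others.\<close>

definition susp_join :: "('a \<times> real list) \<times> real \<Rightarrow> 'a \<times> real list" where
  "susp_join = (\<lambda>((a, ts), t). (a, t # ts))"

definition susp_split :: "'a \<times> real list \<Rightarrow> ('a \<times> real list) \<times> real" where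
  "susp_split = (\<lambda>(a, ts). ((a, tl ts), hd ts))"

lemma susp_split_join [simp]: "susp_split (susp_join v) = v"
  by (simp add: susp_join_def susp_split_def case_prod_unfold)

primrec iter_fun :: "nat \<Rightarrow> 'b pointed \<Rightarrow> ('a \<Rightarrow> 'b) \<Rightarrow> 'a \<times> real list \<Rightarrow> 'b \<times> real list" where
  "iter_fun 0 B f = (\<lambda>(a, ts). (f a, []))"
| "iter_fun (Suc n) B f =
     (\<lambda>v. susp_join (cyl_fun {0, 1} 0 (iterated_suspension n B) (iter_fun n B f) (susp_split v)))"

lemma iterated_suspension_Suc:
  "iterated_suspension (Suc n) A = rename susp_join (cyl_quotient (iterated_suspension n A) {0, 1} 0)"
  by (simp add: susp_join_def suspension_eq)

declare iterated_suspension.simps(2) [simp del]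

text \<open>The length of the list records the dimension; this will keep new cells disjoint from old
  ones when skeleta are realised in one type.\<close>

lemma iterated_suspension_length:
  "pointed_space A \<Longrightarrow> v \<in> points (iterated_suspension n A) \<Longrightarrow> length (snd v) = n"
proof (induction n arbitrary: v)
  case (Suc n)
  then obtain u where u: "u \<in> points (cyl_quotient (iterated_suspension n A) {0, 1} 0)"
    "v = susp_join u"
    by (auto simp: iterated_suspension_Suc points_rename)
  obtain x s where "u = (x, s)" "x \<in> points (iterated_suspension n A)"
    by (rule cyl_quotient_cases[OF pointed_space_iterated_suspension[OF Suc.prems(1)] _ _ u(1)]) auto
  then show ?case
    using Suc.IH[of x] Suc.prems u by (auto simp: susp_join_def case_prod_unfold)
qed (auto simp: points_rename)

text \<open>Suspension acts on homotopies because the suspension coordinate is left alone at every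
  time. In this way a homotopy from \<open>\<beta>\<alpha>\<close> to the identity is transported to
  cells of every dimension.\<close>

lemma iter_fun_htpy:
  assumes A: "pointed_space A" and K: "htpy A B K"
  shows "htpy (iterated_suspension n A) (iterated_suspension n B) (\<lambda>(v, t). iter_fun n B (\<lambda>a. K (a, t)) v)"
proof (induction n)
  case 0
  show ?case
    unfolding iterated_suspension.simps
    by (rule rename_htpy) (use htpy_post[OF K rename_pointed_map[of B "\<lambda>a. (a, [])"]]
      in \<open>simp add: case_prod_unfold\<close>)
next
  case (Suc n)
  have "htpy (cyl_quotient (iterated_suspension n A) {0, 1} 0) (cyl_quotient (iterated_suspension n B) {0, 1} 0)
     (\<lambda>(v, t). cyl_fun {0, 1} 0 (iterated_suspension n B) (\<lambda>x. iter_fun n B (\<lambda>a. K (a, t)) x) v)"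
    using cyl_fun_htpy[OF pointed_space_iterated_suspension[OF A] _ _ Suc.IH, of 0 "{0, 1}"] by simp
  from htpy_post[OF this rename_pointed_map[of _ susp_join]]
  show ?case
    unfolding iterated_suspension_Suc by (intro rename_htpy) (simp add: case_prod_unfold)
qed

lemma iter_fun_pointed_map:
  "pointed_space A \<Longrightarrow> pointed_map A B f \<Longrightarrow>
   pointed_map (iterated_suspension n A) (iterated_suspension n B) (iter_fun n B f)"
  using iter_fun_htpy[of A B "\<lambda>(x, t). f x" n] by (simp add: pointed_map_iff_htpy)

lemma iter_fun_cong:
  assumes "pointed_space A" "\<And>a. a \<in> points A \<Longrightarrow> f a = g a"
  shows "v \<in> points (iterated_suspension n A) \<Longrightarrow> iter_fun n B f v = iter_fun n B g v"
proof (induction n arbitrary: v)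
  case (Suc n)
  then obtain u where u: "u \<in> points (cyl_quotient (iterated_suspension n A) {0, 1} 0)"
    "v = susp_join u"
    by (auto simp: iterated_suspension_Suc points_rename)
  then show ?case
    using cyl_fun_cong[OF pointed_space_iterated_suspension[OF assms(1)] _ _ u(1) Suc.IH] by simp
qed (use assms in \<open>auto simp: points_rename\<close>)

lemma iter_fun_id:
  assumes "pointed_space A" "\<And>a. a \<in> points A \<Longrightarrow> f a = a"
  shows "v \<in> points (iterated_suspension n A) \<Longrightarrow> iter_fun n A f v = v"
proof (induction n arbitrary: v)
  case (Suc n)
  then obtain u where u: "u \<in> points (cyl_quotient (iterated_suspension n A) {0, 1} 0)"
    "v = susp_join u"
    by (auto simp: iterated_suspension_Suc points_rename)
  then show ?case
    using cyl_fun_id[OF pointed_space_iterated_suspension[OF assms(1)] _ _ u(1) Suc.IH] by simp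
qed (use assms in \<open>auto simp: points_rename\<close>)

lemma iter_fun_comp:
  assumes A: "pointed_space A" and B: "pointed_space B" and f: "pointed_map A B f"
    and g: "pointed_map B C g"
  shows "v \<in> points (iterated_suspension n A)
    \<Longrightarrow> iter_fun n C g (iter_fun n B f v) = iter_fun n C (\<lambda>a. g (f a)) v"
proof (induction n arbitrary: v)
  case (Suc n)
  let ?A = "iterated_suspension n A" and ?B = "iterated_suspension n B"
    and ?C = "iterated_suspension n C"
  obtain u where u: "u \<in> points (cyl_quotient ?A {0, 1} 0)" "v = susp_join u"
    using Suc.prems by (auto simp: iterated_suspension_Suc points_rename)
  note F = iter_fun_pointed_map[OF A f, of n] and G = iter_fun_pointed_map[OF B g, of n]
  have "cyl_fun {0, 1} 0 ?C (iter_fun n C g) (cyl_fun {0, 1} 0 ?B (iter_fun n B f) u)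
      = cyl_fun {0, 1} 0 ?C (\<lambda>x. iter_fun n C g (iter_fun n B f x)) u"
    by (rule cyl_fun_comp[OF pointed_space_iterated_suspension[OF A]
      pointed_space_iterated_suspension[OF B] _ _ u(1)])
       (use pointed_map_in[OF F] pointed_map_in[OF G] pointed_map_base[OF G] in auto)
  also have "\<dots> = cyl_fun {0, 1} 0 ?C (iter_fun n C (\<lambda>a. g (f a))) u"
    by (rule cyl_fun_cong[OF pointed_space_iterated_suspension[OF A] _ _ u(1) Suc.IH]) auto
  finally show ?case
    using u by simp
qed (auto simp: points_rename)

text \<open>
  The pair \<open>bdry_incl n A : bdry n A \<rightarrow> cell n A\<close> is, for \<open>n > 0\<close>, the inclusion of
  \<open>\<Sigma>\<^sup>n\<^sup>-\<^sup>1A\<close> into its cone and, for \<open>n = 0\<close>, the inclusion of the base point into \<open>A\<close>.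
\<close>

primrec bdry :: "nat \<Rightarrow> 'a pointed \<Rightarrow> ('a \<times> real list) pointed" where
  "bdry 0 A = (discrete_topology {(base A, [])}, (base A, []))"
| "bdry (Suc n) A = iterated_suspension n A"

primrec cell :: "nat \<Rightarrow> 'a pointed \<Rightarrow> (('a \<times> real list) \<times> real) pointed" where
  "cell 0 A = rename (\<lambda>a. ((a, []), 0)) A"
| "cell (Suc n) A = reduced_cone (iterated_suspension n A)"

primrec bdry_incl :: "nat \<Rightarrow> 'a pointed \<Rightarrow> 'a \<times> real list \<Rightarrow> ('a \<times> real list) \<times> real" where
  "bdry_incl 0 A = (\<lambda>_. ((base A, []), 0))"
| "bdry_incl (Suc n) A = cone_base (iterated_suspension n A)"

primrec bdry_fun :: "nat \<Rightarrow> 'b pointed \<Rightarrow> ('a \<Rightarrow> 'b) \<Rightarrow> 'a \<times> real list \<Rightarrow> 'b \<times> real list" where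
  "bdry_fun 0 B f = (\<lambda>_. (base B, []))"
| "bdry_fun (Suc n) B f = iter_fun n B f"

primrec cell_fun :: "nat \<Rightarrow> 'b pointed \<Rightarrow> ('a \<Rightarrow> 'b) \<Rightarrow> ('a \<times> real list) \<times> real \<Rightarrow> ('b \<times> real list) \<times> real" where
  "cell_fun 0 B f = (\<lambda>((a, _), _). ((f a, []), 0))"
| "cell_fun (Suc n) B f = cyl_fun {1} 1 (iterated_suspension n B) (iter_fun n B f)"

lemma pointed_space_bdry: "pointed_space A \<Longrightarrow> pointed_space (bdry n A)"
  by (cases n) (simp_all add: pointed_space_iterated_suspension, simp add: pointed_space_def)

lemma pointed_space_cell: "pointed_space A \<Longrightarrow> pointed_space (cell n A)"
  by (cases n) (simp_all add: pointed_space_iterated_suspension pointed_space_reduced_cone,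
      simp add: pointed_space_def rename_def)

lemma bdry_incl_pointed_map: "pointed_space A \<Longrightarrow> pointed_map (bdry n A) (cell n A) (bdry_incl n A)"
proof (cases n)
  case 0
  assume "pointed_space A"
  then show ?thesis
    using pointed_space_cell[of A 0] 0 by (simp add: pointed_map_def pointed_space_def base_rename)
qed (simp add: cone_base_pointed_map pointed_space_iterated_suspension)

lemma bdry_incl_inj:
  "pointed_space A \<Longrightarrow> x \<in> points (bdry n A) \<Longrightarrow> y \<in> points (bdry n A)
    \<Longrightarrow> bdry_incl n A x = bdry_incl n A y \<Longrightarrow> x = y"
  using cone_base_inj[OF pointed_space_iterated_suspension[of A]] by (cases n) auto

lemma fillable_bdry_incl: "pointed_space A \<Longrightarrow> fillable (bdry n A) (cell n A) (bdry_incl n A) T"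
proof (cases n)
  case 0
  then show ?thesis by (auto intro!: fillable_trivial simp: base_rename)
qed (simp add: fillable_cone pointed_space_iterated_suspension)

lemma bdry_fun_htpy:
  assumes "pointed_space A" "htpy A B K"
  shows "htpy (bdry n A) (bdry n B) (\<lambda>(v, t). bdry_fun n B (\<lambda>a. K (a, t)) v)"
proof (cases n)
  case 0
  have "pointed_map (bdry 0 A) (bdry 0 B) (\<lambda>_. (base B, []))"
    by (simp add: pointed_map_def)
  then show ?thesis
    using 0 htpy_const[of "bdry 0 A" "bdry 0 B" "\<lambda>_. (base B, [])"] by simp
qed (simp add: iter_fun_htpy[OF assms])

lemma cell_fun_htpy:
  assumes "pointed_space A" "htpy A B K"
  shows "htpy (cell n A) (cell n B) (\<lambda>(v, t). cell_fun n B (\<lambda>a. K (a, t)) v)"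
proof (cases n)
  case 0
  then show ?thesis
    using htpy_post[OF assms(2) rename_pointed_map[of B "\<lambda>a. ((a, []), 0)"]]
    by (simp, intro rename_htpy) (simp add: case_prod_unfold)
next
  case (Suc m)
  then show ?thesis
    using cyl_fun_htpy[OF pointed_space_iterated_suspension[OF assms(1)]
      _ _ iter_fun_htpy[OF assms], of 1 "{1}" m]
    by (simp add: reduced_cone_eq)
qed

lemma bdry_fun_pointed_map:
  "pointed_space A \<Longrightarrow> pointed_map A B f \<Longrightarrow> pointed_map (bdry n A) (bdry n B) (bdry_fun n B f)"
  using bdry_fun_htpy[of A B "\<lambda>(x, t). f x" n] by (simp add: pointed_map_iff_htpy)

lemma cell_fun_pointed_map:
  "pointed_space A \<Longrightarrow> pointed_map A B f \<Longrightarrow> pointed_map (cell n A) (cell n B) (cell_fun n B f)"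
  using cell_fun_htpy[of A B "\<lambda>(x, t). f x" n] by (simp add: pointed_map_iff_htpy)

lemma cell_fun_cong:
  assumes "pointed_space A" "\<And>a. a \<in> points A \<Longrightarrow> f a = g a" "v \<in> points (cell n A)"
  shows "cell_fun n B f v = cell_fun n B g v"
proof (cases n)
  case (Suc m)
  show ?thesis
    using cyl_fun_cong[OF pointed_space_iterated_suspension[OF assms(1), of m], of 1 "{1}"
      v "iter_fun m B f" "iter_fun m B g"]
      iter_fun_cong[OF assms(1,2)] assms(3)
    by (simp add: Suc reduced_cone_eq)
qed (use assms in \<open>auto simp: points_rename\<close>)

lemma bdry_fun_cong:
  assumes "pointed_space A" "\<And>a. a \<in> points A \<Longrightarrow> f a = g a" "v \<in> points (bdry n A)"
  shows "bdry_fun n B f v = bdry_fun n B g v"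
  using iter_fun_cong[OF assms(1,2)] assms(3) by (cases n) auto

lemma cell_fun_id:
  assumes "pointed_space A" "\<And>a. a \<in> points A \<Longrightarrow> f a = a" "v \<in> points (cell n A)"
  shows "cell_fun n A f v = v"
proof (cases n)
  case (Suc m)
  show ?thesis
    using cyl_fun_id[OF pointed_space_iterated_suspension[OF assms(1), of m], of 1 "{1}"
      v "iter_fun m A f"]
      iter_fun_id[OF assms(1,2)] assms(3)
    by (simp add: Suc reduced_cone_eq)
qed (use assms in \<open>auto simp: points_rename\<close>)

lemma bdry_fun_id:
  assumes "pointed_space A" "\<And>a. a \<in> points A \<Longrightarrow> f a = a" "v \<in> points (bdry n A)"
  shows "bdry_fun n A f v = v"
  using iter_fun_id[OF assms(1,2)] assms(3) by (cases n) auto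

lemma bdry_fun_comp:
  assumes "pointed_space A" "pointed_space B" "pointed_map A B f" "pointed_map B C g"
    "v \<in> points (bdry n A)"
  shows "bdry_fun n C g (bdry_fun n B f v) = bdry_fun n C (\<lambda>a. g (f a)) v"
  using iter_fun_comp[OF assms(1-4)] assms(5) by (cases n) auto

lemma cell_fun_comp:
  assumes "pointed_space A" "pointed_space B" "pointed_map A B f" "pointed_map B C g"
    "v \<in> points (cell n A)"
  shows "cell_fun n C g (cell_fun n B f v) = cell_fun n C (\<lambda>a. g (f a)) v"
proof (cases n)
  case 0
  then show ?thesis using assms by (auto simp: points_rename)
next
  case (Suc m)
  let ?A = "iterated_suspension m A" and ?B = "iterated_suspension m B"
    and ?C = "iterated_suspension m C"
  have v: "v \<in> points (cyl_quotient ?A {1} 1)" using assms(5) by (simp add: Suc reduced_cone_eq)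
  note F = iter_fun_pointed_map[OF assms(1,3), of m] and G = iter_fun_pointed_map[OF assms(2,4), of m]
  have "cyl_fun {1} 1 ?C (iter_fun m C g) (cyl_fun {1} 1 ?B (iter_fun m B f) v)
      = cyl_fun {1} 1 ?C (\<lambda>x. iter_fun m C g (iter_fun m B f x)) v"
    by (rule cyl_fun_comp[OF pointed_space_iterated_suspension[OF assms(1)]
      pointed_space_iterated_suspension[OF assms(2)] _ _ v])
       (use pointed_map_in[OF F] pointed_map_in[OF G] pointed_map_base[OF G] in auto)
  also have "\<dots> = cyl_fun {1} 1 ?C (iter_fun m C (\<lambda>a. g (f a))) v"
    by (rule cyl_fun_cong[OF pointed_space_iterated_suspension[OF assms(1)]
      _ _ v]) (auto intro: iter_fun_comp[OF assms(1-4)])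
  finally show ?thesis
    by (simp add: Suc)
qed

lemma cell_fun_bdry_incl:
  assumes "pointed_space A" "pointed_map A B f" "w \<in> points (bdry n A)"
  shows "cell_fun n B f (bdry_incl n A w) = bdry_incl n B (bdry_fun n B f w)"
proof (cases n)
  case 0
  then show ?thesis using assms by (simp add: pointed_map_base)
next
  case (Suc m)
  let ?A = "iterated_suspension m A" and ?B = "iterated_suspension m B"
  have w: "w \<in> points ?A" using assms Suc by simp
  note F = iter_fun_pointed_map[OF assms(1,2), of m]
  have A: "pointed_space ?A" using assms(1) by (rule pointed_space_iterated_suspension)
  have "base ?B \<in> points ?B"
    using pointed_map_in[OF F, of "base ?A"] A pointed_map_base[OF F] by (simp add: pointed_space_def)
  then have "cyl_fun {1} 1 ?B (iter_fun m B f) (cyl_collapse ?A {1} 1 (w, 0)) = cyl_collapse ?B {1} 1 (iter_fun m B f w, 0)"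
    using w pointed_map_base[OF F]
    by (cases "w = base ?A") (simp_all add: cyl_fun_def cyl_collapse_collapsed cyl_collapse_other)
  then show ?thesis
    by (simp add: Suc cone_base_def cone_map_eq)
qed

section \<open>Wedges of cells and of their boundaries, as functors of the cell type\<close>

definition bdries :: "nat \<Rightarrow> 'j set \<Rightarrow> 'a pointed \<Rightarrow> ('j \<times> 'a \<times> real list) option pointed" where
  "bdries n J A = wedge J (bdry n A)"
definition cells :: "nat \<Rightarrow> 'j set \<Rightarrow> 'a pointed \<Rightarrow> ('j \<times> ('a \<times> real list) \<times> real) option pointed" where
  "cells n J A = wedge J (cell n A)"
definition bdries_incl :: "nat \<Rightarrow> 'a pointed \<Rightarrow> ('j \<times> 'a \<times> real list) option \<Rightarrow> ('j \<times> ('a \<times> real list) \<times> real) option" where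
  "bdries_incl n A = wedge_map (cell n A) (bdry_incl n A)"
definition bdries_fun :: "nat \<Rightarrow> 'b pointed \<Rightarrow> ('a \<Rightarrow> 'b) \<Rightarrow> ('j \<times> 'a \<times> real list) option \<Rightarrow> ('j \<times> 'b \<times> real list) option" where
  "bdries_fun n B f = wedge_map (bdry n B) (bdry_fun n B f)"
definition cells_fun :: "nat \<Rightarrow> 'b pointed \<Rightarrow> ('a \<Rightarrow> 'b) \<Rightarrow> ('j \<times> ('a \<times> real list) \<times> real) option
    \<Rightarrow> ('j \<times> ('b \<times> real list) \<times> real) option" where
  "cells_fun n B f = wedge_map (cell n B) (cell_fun n B f)"

abbreviation cell_pushout where
  "cell_pushout n J A g Z \<equiv> pointed_pushout (bdries n J A) g (bdries_incl n A) Z (cells n J A)"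

lemma pointed_space_bdries: "pointed_space (bdries n J A)"
  by (simp add: bdries_def)

lemma fillable_bdries_incl:
  "pointed_space A \<Longrightarrow> pointed_space T \<Longrightarrow> fillable (bdries n J A) (cells n J A) (bdries_incl n A) T"
  unfolding bdries_def cells_def bdries_incl_def
  by (intro fillable_wedge pointed_space_bdry pointed_space_cell bdry_incl_pointed_map fillable_bdry_incl)

lemma bdries_incl_pointed_map: "pointed_space A
  \<Longrightarrow> pointed_map (bdries n J A) (cells n J A) (bdries_incl n A)"
  unfolding bdries_def cells_def bdries_incl_def
    by (intro wedge_map_pointed_map pointed_space_bdry bdry_incl_pointed_map)

lemma bdries_incl_inj:
  assumes "pointed_space A"
  shows "inj_on (bdries_incl n A) (points (bdries n J A))"
proof (rule inj_onI)
  \<comment> \<open>The inclusion of the boundary reflects the base point, so the induced map of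
    wedges sends no point other than \<open>None\<close> to \<open>None\<close>.\<close>
  have b: "bdry_incl n A x = base (cell n A) \<longleftrightarrow> x = base (bdry n A)" if "x \<in> points (bdry n A)" for x
    using bdry_incl_inj[OF assms that, of "base (bdry n A)"]
      pointed_map_base[OF bdry_incl_pointed_map[OF assms]]
      pointed_space_bdry[OF assms, of n] by (auto simp: pointed_space_def)
  fix x y :: "('b \<times> 'a \<times> real list) option"
  assume "x \<in> points (bdries n J A)" "y \<in> points (bdries n J A)" "bdries_incl n A x = bdries_incl n A y"
  then show "x = y"
    using bdry_incl_inj[OF assms] b
    by (auto simp: bdries_def bdries_incl_def points_wedge wedge_map_def wedge_incl_def split: if_splits)
qed

lemma bdries_fun_htpy:
  "pointed_space A \<Longrightarrow> htpy A B K
    \<Longrightarrow> htpy (bdries n J A) (bdries n J B) (\<lambda>(w, t). bdries_fun n B (\<lambda>a. K (a, t)) w)"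
  unfolding bdries_def bdries_fun_def
  using wedge_map_htpy[OF pointed_space_bdry bdry_fun_htpy] by fastforce

lemma cells_fun_htpy:
  "pointed_space A \<Longrightarrow> htpy A B K
    \<Longrightarrow> htpy (cells n J A) (cells n J B) (\<lambda>(w, t). cells_fun n B (\<lambda>a. K (a, t)) w)"
  unfolding cells_def cells_fun_def
  using wedge_map_htpy[OF pointed_space_cell cell_fun_htpy] by fastforce

lemma bdries_fun_pointed_map: "pointed_space A \<Longrightarrow> pointed_map A B f
  \<Longrightarrow> pointed_map (bdries n J A) (bdries n J B) (bdries_fun n B f)"
  using bdries_fun_htpy[of A B "\<lambda>(x, t). f x" n J] by (simp add: pointed_map_iff_htpy)

lemma cells_fun_pointed_map: "pointed_space A \<Longrightarrow> pointed_map A B f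
  \<Longrightarrow> pointed_map (cells n J A) (cells n J B) (cells_fun n B f)"
  using cells_fun_htpy[of A B "\<lambda>(x, t). f x" n J] by (simp add: pointed_map_iff_htpy)

lemma bdries_fun_cong:
  "pointed_space A \<Longrightarrow> (\<And>a. a \<in> points A \<Longrightarrow> f a = g a) \<Longrightarrow> w \<in> points (bdries n J A)
    \<Longrightarrow> bdries_fun n B f w = bdries_fun n B g w"
  unfolding bdries_def bdries_fun_def by (rule wedge_map_cong) (auto intro: bdry_fun_cong)

lemma cells_fun_cong:
  "pointed_space A \<Longrightarrow> (\<And>a. a \<in> points A \<Longrightarrow> f a = g a) \<Longrightarrow> w \<in> points (cells n J A)
    \<Longrightarrow> cells_fun n B f w = cells_fun n B g w"
  unfolding cells_def cells_fun_def by (rule wedge_map_cong) (auto intro: cell_fun_cong)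

lemma bdries_fun_id: "pointed_space A \<Longrightarrow> (\<And>a. a \<in> points A \<Longrightarrow> f a = a) \<Longrightarrow> w \<in> points (bdries n J A)
  \<Longrightarrow> bdries_fun n A f w = w"
  unfolding bdries_def bdries_fun_def by (rule wedge_map_id) (auto intro: bdry_fun_id)

lemma cells_fun_id: "pointed_space A \<Longrightarrow> (\<And>a. a \<in> points A \<Longrightarrow> f a = a) \<Longrightarrow> w \<in> points (cells n J A)
  \<Longrightarrow> cells_fun n A f w = w"
  unfolding cells_def cells_fun_def by (rule wedge_map_id) (auto intro: cell_fun_id)

lemma bdries_fun_comp:
  assumes "pointed_space A" "pointed_space B" "pointed_map A B f" "pointed_map B C g"
    "w \<in> points (bdries n J A)"
  shows "bdries_fun n C g (bdries_fun n B f w) = bdries_fun n C (\<lambda>a. g (f a)) w"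
proof -
  have "bdry_fun n C g (base (bdry n B)) = base (bdry n C)"
    by (rule pointed_map_base[OF bdry_fun_pointed_map[OF assms(2,4)]])
  then show ?thesis
    using assms(5) unfolding bdries_fun_def bdries_def
    by (simp add: wedge_map_comp) (rule wedge_map_cong, auto intro: bdry_fun_comp[OF assms(1-4)])
qed

lemma cells_fun_comp:
  assumes "pointed_space A" "pointed_space B" "pointed_map A B f" "pointed_map B C g"
    "w \<in> points (cells n J A)"
  shows "cells_fun n C g (cells_fun n B f w) = cells_fun n C (\<lambda>a. g (f a)) w"
proof -
  have "cell_fun n C g (base (cell n B)) = base (cell n C)"
    by (rule pointed_map_base[OF cell_fun_pointed_map[OF assms(2,4)]])
  then show ?thesis
    using assms(5) unfolding cells_fun_def cells_def
    by (simp add: wedge_map_comp) (rule wedge_map_cong, auto intro: cell_fun_comp[OF assms(1-4)])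
qed

lemma cells_fun_bdry_incl:
  assumes "pointed_space A" "pointed_space B" "pointed_map A B f" "w \<in> points (bdries n J A)"
  shows "cells_fun n B f (bdries_incl n A w) = bdries_incl n B (bdries_fun n B f w)"
proof -
  have "cell_fun n B f (base (cell n A)) = base (cell n B)"
    by (rule pointed_map_base[OF cell_fun_pointed_map[OF assms(1,3)]])
  moreover have "bdry_incl n B (base (bdry n B)) = base (cell n B)"
    using pointed_map_base[OF bdry_incl_pointed_map[OF assms(2)]] .
  ultimately show ?thesis
    using assms(4) unfolding cells_fun_def bdries_incl_def bdries_fun_def bdries_def
    by (simp add: wedge_map_comp) (rule wedge_map_cong, auto intro: cell_fun_bdry_incl[OF assms(1,3)])
qed

section \<open>Ladders of skeleta\<close>

text \<open>Homotopy of two maps of pairs \<open>(a, b), (a', b') : (V, W) \<rightarrow> (Z', Z)\<close>, where \<open>c : W \<rightarrow> V\<close> and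
  \<open>j : Z \<rightarrow> Z'\<close> play the role of the inclusions.\<close>

definition pair_htpy_via ::
    "'w pointed \<Rightarrow> 'v pointed \<Rightarrow> ('w \<Rightarrow> 'v) \<Rightarrow> 'z pointed \<Rightarrow> 'y pointed \<Rightarrow> ('z \<Rightarrow> 'y) \<Rightarrow>
     ('v \<Rightarrow> 'y) \<Rightarrow> ('w \<Rightarrow> 'z) \<Rightarrow> ('v \<Rightarrow> 'y) \<Rightarrow> ('w \<Rightarrow> 'z) \<Rightarrow>
     ('v \<times> real \<Rightarrow> 'y) \<Rightarrow> ('w \<times> real \<Rightarrow> 'z) \<Rightarrow> bool" where
  "pair_htpy_via W V c Z Z' j a b a' b' H K \<longleftrightarrow> htpy V Z' H \<and> htpy W Z K \<and>
     (\<forall>v\<in>points V. H (v, 0) = a v \<and> H (v, 1) = a' v) \<and> (\<forall>w\<in>points W. K (w, 0) = b w \<and> K (w, 1) = b' w) \<and>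
     (\<forall>w\<in>points W. \<forall>t\<in>{0..1}. H (c w, t) = j (K (w, t)))"

definition pair_htpy where
  "pair_htpy W V c Z Z' j a b a' b' \<longleftrightarrow> (\<exists>H K. pair_htpy_via W V c Z Z' j a b a' b' H K)"

abbreviation cell_htpy where
  "cell_htpy n J A \<equiv> pair_htpy (bdries n J A) (cells n J A) (bdries_incl n A)"

lemma pair_htpyI:
  assumes "htpy V Z' H" "htpy W Z K" "\<And>v. v \<in> points V \<Longrightarrow> H (v, 0) = a v"
    "\<And>v. v \<in> points V \<Longrightarrow> H (v, 1) = a' v"
    "\<And>w. w \<in> points W \<Longrightarrow> K (w, 0) = b w" "\<And>w. w \<in> points W \<Longrightarrow> K (w, 1) = b' w"
    "\<And>w t. w \<in> points W \<Longrightarrow> t \<in> {0..1} \<Longrightarrow> H (c w, t) = j (K (w, t))"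
  shows "pair_htpy W V c Z Z' j a b a' b'"
  unfolding pair_htpy_def pair_htpy_via_def using assms by blast

lemma pair_htpy_viaD:
  assumes "pair_htpy_via W V c Z Z' j a b a' b' H K"
  shows "htpy V Z' H" "htpy W Z K" "\<And>v. v \<in> points V \<Longrightarrow> H (v, 0) = a v"
    "\<And>v. v \<in> points V \<Longrightarrow> H (v, 1) = a' v"
    "\<And>w. w \<in> points W \<Longrightarrow> K (w, 0) = b w" "\<And>w. w \<in> points W \<Longrightarrow> K (w, 1) = b' w"
    "\<And>w t. w \<in> points W \<Longrightarrow> t \<in> {0..1} \<Longrightarrow> H (c w, t) = j (K (w, t))"
  using assms unfolding pair_htpy_via_def by blast+

lemma pair_htpy_trans:
  assumes "pair_htpy W V c Z Z' j a b a' b'" "pair_htpy W V c Z Z' j a' b' a'' b''"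
    and c: "pointed_map W V c"
  shows "pair_htpy W V c Z Z' j a b a'' b''"
proof -
  obtain H K where HK1: "pair_htpy_via W V c Z Z' j a b a' b' H K"
    using assms(1) unfolding pair_htpy_def by blast
  note 1 = pair_htpy_viaD[OF HK1]
  obtain H' K' where HK2: "pair_htpy_via W V c Z Z' j a' b' a'' b'' H' K'"
    using assms(2) unfolding pair_htpy_def by blast
  note 2 = pair_htpy_viaD[OF HK2]
  show ?thesis
    by (rule pair_htpyI[OF htpy_concat[OF 1(1) 2(1)] htpy_concat[OF 1(2) 2(2)]])
       (use 1(3-) 2(3-) in auto)
qed

lemma pair_htpy_cong:
  assumes "pair_htpy W V c Z Z' j a b a' b'"
    and "\<And>v. v \<in> points V \<Longrightarrow> a v = e v" "\<And>v. v \<in> points V \<Longrightarrow> a' v = e' v"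
    and "\<And>w. w \<in> points W \<Longrightarrow> b w = d w" "\<And>w. w \<in> points W \<Longrightarrow> b' w = d' w"
  shows "pair_htpy W V c Z Z' j e d e' d'"
  using assms unfolding pair_htpy_def pair_htpy_via_def by metis

lemma pair_htpy_post:
  assumes "pair_htpy W V c Z Z' j a b a' b'" "pointed_map Z Y F" "pointed_map Z' Y' F'"
    and "\<And>z. z \<in> points Z \<Longrightarrow> F' (j z) = i (F z)"
  shows "pair_htpy W V c Y Y' i (\<lambda>v. F' (a v)) (\<lambda>w. F (b w)) (\<lambda>v. F' (a' v)) (\<lambda>w. F (b' w))"
proof -
  obtain H K where HK1: "pair_htpy_via W V c Z Z' j a b a' b' H K"
    using assms(1) unfolding pair_htpy_def by blast
  note 1 = pair_htpy_viaD[OF HK1]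
  show ?thesis
    by (rule pair_htpyI[OF htpy_post[OF 1(1) assms(3)] htpy_post[OF 1(2) assms(2)]])
       (use 1(3-) assms(4) htpy_in[OF 1(2)] in auto)
qed

lemma pair_htpy_pre:
  assumes "pair_htpy W V c Z Z' j a b a' b'" "pointed_map W1 W F" "pointed_map V1 V F'"
    and "\<And>w. w \<in> points W1 \<Longrightarrow> F' (c1 w) = c (F w)"
  shows "pair_htpy W1 V1 c1 Z Z' j (\<lambda>v. a (F' v)) (\<lambda>w. b (F w)) (\<lambda>v. a' (F' v)) (\<lambda>w. b' (F w))"
proof -
  obtain H K where HK1: "pair_htpy_via W V c Z Z' j a b a' b' H K"
    using assms(1) unfolding pair_htpy_def by blast
  note 1 = pair_htpy_viaD[OF HK1]
  show ?thesis
    by (rule pair_htpyI[OF htpy_pre[OF assms(3) 1(1)] htpy_pre[OF assms(2) 1(2)]])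
       (use 1(3-) assms(4) pointed_map_in[OF assms(2)] pointed_map_in[OF assms(3)] in auto)
qed

text \<open>
  The inductive step.  The new inverse \<open>\<psi>'\<close> and the new homotopy \<open>H'\<close> extend the old ones strictly, so
  that both pass to the colimit.
\<close>

lemma ladder_step:
  assumes X: "pointed_space X" and Y: "pointed_space Y"
    and po: "pointed_pushout W g c X V X' i h" and po': "pointed_pushout W g' c Y V Y' j h'"
    and fill: "fillable W V c X'" and W: "pointed_space W"
    and f: "pointed_map X Y f" and f': "pointed_map X' Y' f'"
      and ff: "\<And>x. x \<in> points X \<Longrightarrow> f' (i x) = j (f x)"
    and ph: "pair_htpy W V c Y Y' j (\<lambda>v. f' (h v)) (\<lambda>w. f (g w)) h' g'"
    and \<psi>: "pointed_map Y X \<psi>" and H: "htpy X X H"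
    and H0: "\<And>x. x \<in> points X \<Longrightarrow> H (x, 0) = \<psi> (f x)" and H1: "\<And>x. x \<in> points X \<Longrightarrow> H (x, 1) = x"
  shows "\<exists>\<psi>' H'. pointed_map Y' X' \<psi>' \<and> (\<forall>y\<in>points Y. \<psi>' (j y) = i (\<psi> y)) \<and>
     htpy X' X' H' \<and> (\<forall>x\<in>points X'. H' (x, 0) = \<psi>' (f' x) \<and> H' (x, 1) = x) \<and>
     (\<forall>x\<in>points X. \<forall>t\<in>{0..1}. H' (i x, t) = i (H (x, t))) \<and>
     pair_htpy W V c X X' i (\<lambda>v. \<psi>' (h' v)) (\<lambda>w. \<psi> (g' w)) h g"
proof -
  note g = pushoutD(1)[OF po] and c = pushoutD(2)[OF po] and i = pushoutD(3)[OF po]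
    and h = pushoutD(4)[OF po]
  note g' = pushoutD(1)[OF po'] and j = pushoutD(3)[OF po'] and h' = pushoutD(4)[OF po']
  note comm = pushout_comm[OF po] and comm' = pushout_comm[OF po']
  obtain A B where "pair_htpy_via W V c Y Y' j (\<lambda>v. f' (h v)) (\<lambda>w. f (g w)) h' g' A B"
    using ph unfolding pair_htpy_def by blast
  note AB_facts = pair_htpy_viaD[OF this]
  note A = AB_facts(1,3,4) and B = AB_facts(2,5,6) and AB = AB_facts(7)
  \<comment> \<open>On \<open>{0..1}\<close> this is \<open>H\<close> along the attaching map; on
    \<open>{-1..0}\<close> it is \<open>\<psi> B\<close> traversed backwards. The two agree at 0
    since \<open>H (g w, 0)\<close> and \<open>\<psi> (B (w, 0))\<close> are both
    \<open>\<psi> (f (g w))\<close>. At -1 the value is \<open>\<psi> (g' w)\<close>.\<close>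
  define P where "P = (\<lambda>p. if - snd p \<le> (0::real) then H (g (fst p), max 0 (snd p)) else \<psi> (B (fst p, max 0 (- snd p))))"
  let ?J = "top_of_set {-1..1::real}"
  have PX: "continuous_map (prod_topology (fst W) ?J) (fst X) P"
    unfolding P_def
  proof (rule continuous_map_glue)
    show "continuous_map (prod_topology (fst W) ?J) euclideanreal (\<lambda>x. - snd x)"
      by (rule continuous_map_snd_interval) (auto intro!: continuous_intros)
    show "continuous_map (prod_topology (fst W) ?J) (fst X) (\<lambda>x. H (g (fst x), max 0 (snd x)))"
      by (rule continuous_map_compose2'[of _ _ _ H, OF _ continuous_map_compose'[OF _ continuous_map_fst]
          continuous_map_interval_reparam])
         (use H g in \<open>auto simp: htpy_def pointed_map_def intro!: continuous_intros\<close>)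
    have "continuous_map (prod_topology (fst W) ?J) (fst Y) (\<lambda>x. B (fst x, max 0 (- snd x)))"
      by (rule continuous_map_compose2'[of _ _ _ B, OF _ continuous_map_fst continuous_map_interval_reparam])
         (use B in \<open>auto simp: htpy_def intro!: continuous_intros\<close>)
    then show "continuous_map (prod_topology (fst W) ?J) (fst X) (\<lambda>x. \<psi> (B (fst x, max 0 (- snd x))))"
      using \<psi> by (auto simp: pointed_map_def intro: continuous_map_compose')
    show "H (g (fst x), max 0 (snd x)) = \<psi> (B (fst x, max 0 (- snd x)))"
      if "x \<in> topspace (prod_topology (fst W) ?J)" "- snd x = 0" for x
      using that H0[OF pointed_map_in[OF g]] B by auto
  qed
  have P0: "P (base W, s) = base X" if "s \<in> {-1..1}" for s
    using that htpy_base[OF H, of s] htpy_base[OF B(1), of "-s"] pointed_map_base[OF g]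
      pointed_map_base[OF \<psi>]
    by (auto simp: P_def max_def)
  have Pin: "P (w, s) \<in> points X" if "w \<in> points W" "s \<in> {-1..1}" for w s
    using continuous_map_image_subset_topspace[OF PX] that by auto
  have P1: "P (w, t) = H (g w, t)" if "t \<in> {0..1}" for w t
    using that by (auto simp: P_def)
  have P2: "P (w, - t) = \<psi> (B (w, t))" if "w \<in> points W" "t \<in> {0..1}" for w t
    using that H0[OF pointed_map_in[OF g that(1)]] B(2)[OF that(1)] by (auto simp: P_def)
  have "continuous_map (prod_topology (fst W) ?J) (fst X') (\<lambda>p. i (P p))"
    by (rule continuous_map_compose'[OF _ PX]) (use i in \<open>simp add: pointed_map_def\<close>)
  moreover have "i (P (w, 1)) = h (c w)" if "w \<in> points W" for w
    using P1[of 1 w] H1[OF pointed_map_in[OF g that]] comm[OF that] by simp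
  \<comment> \<open>\<open>U\<close> drags \<open>h\<close> back along the path. On the boundary its
    final map is \<open>i (\<psi> (g' w))\<close>, so it glues with \<open>i\<close> after
    \<open>\<psi>\<close> to a map on \<open>Y'\<close>.\<close>
  ultimately obtain U where fU: "fills W V c X' h (\<lambda>p. i (P p)) U"
    using fill[unfolded fillable_def, rule_format, of h "\<lambda>p. i (P p)"] h P0 pointed_map_base[OF i]
    by auto
  have U: "htpy V X' U" "\<And>v. v \<in> points V \<Longrightarrow> U (v, 0) = h v"
      "\<And>w r. w \<in> points W \<Longrightarrow> r \<in> {0..1} \<Longrightarrow> U (c w, r) = i (P (w, 1 - 2 * r))"
    and fillE: "\<And>E. htpy V X' E \<Longrightarrow> (\<forall>w\<in>points W. \<forall>r\<in>{0..1}. E (c w, r) = i (P (w, - r))) \<Longrightarrow>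
             (\<forall>v\<in>points V. E (v, 1) = U (v, 1)) \<Longrightarrow>
           (\<exists>G. htpy V X' G \<and> (\<forall>w\<in>points W. \<forall>s\<in>{0..1}. G (c w, s) = i (P (w, s))) \<and>
              (\<forall>v\<in>points V. G (v, 0) = E (v, 0) \<and> G (v, 1) = h v))"
    using fU unfolding fills_def by simp_all
  have U1: "pointed_map V X' (\<lambda>v. U (v, 1))"
    by (rule htpy_at[OF U(1)]) simp
  obtain \<psi>' where \<psi>': "pointed_map Y' X' \<psi>'" "\<And>y. y \<in> points Y \<Longrightarrow> \<psi>' (j y) = i (\<psi> y)"
      "\<And>v. v \<in> points V \<Longrightarrow> \<psi>' (h' v) = U (v, 1)"
  proof (rule pushout_map[OF Y po' pointed_map_comp[OF \<psi> i] U1])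
    show "i (\<psi> (g' w)) = U (c w, 1)" if "w \<in> points W" for w
      using U(3)[OF that, of 1] P2[OF that, of 1] B(3)[OF that] by simp
  qed blast
  \<comment> \<open>Here \<open>\<psi>'\<close> after \<open>A\<close> plays the role of
    \<open>E\<close>: on the boundary it is \<open>i (\<psi> (B (w, r)))\<close>, the path over
    \<open>{-1..0}\<close>, and it ends at \<open>\<psi>'\<close> after \<open>h'\<close>, which is
    the end of \<open>U\<close>. The resulting \<open>G\<close> lies over \<open>H\<close> alone and
    so glues with it.\<close>
  have "\<exists>G. htpy V X' G \<and> (\<forall>w\<in>points W. \<forall>s\<in>{0..1}. G (c w, s) = i (P (w, s))) \<and>
              (\<forall>v\<in>points V. G (v, 0) = \<psi>' (A (v, 0)) \<and> G (v, 1) = h v)"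
    by (rule fillE[OF htpy_post[OF A(1) \<psi>'(1)]])
       (use AB P2 \<psi>'(2)[OF htpy_in[OF B(1)]] \<psi>'(3) A(3) in auto)
  then obtain G where G: "htpy V X' G" "\<And>w s. w \<in> points W \<Longrightarrow> s \<in> {0..1} \<Longrightarrow> G (c w, s) = i (P (w, s))"
      "\<And>v. v \<in> points V \<Longrightarrow> G (v, 0) = \<psi>' (f' (h v))" "\<And>v. v \<in> points V \<Longrightarrow> G (v, 1) = h v"
    using A(2) by auto
  obtain H' where H': "htpy X' X' H'" "\<And>x t. x \<in> points X \<Longrightarrow> t \<in> {0..1} \<Longrightarrow> H' (i x, t) = i (H (x, t))"
     "\<And>v t. v \<in> points V \<Longrightarrow> t \<in> {0..1} \<Longrightarrow> H' (h v, t) = G (v, t)"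
    by (rule pushout_htpy[OF X po htpy_post[OF H i] G(1)]) (use G(2) P1 in auto)
  have ends: "H' (x, 0) = \<psi>' (f' x) \<and> H' (x, 1) = x" if "x \<in> points X'" for x
    using po that
  proof (cases rule: pushout_cases)
    case (1 z)
    then show ?thesis
      using H'(2)[of z 0] H'(2)[of z 1] H0 H1 ff \<psi>'(2)[OF pointed_map_in[OF f]] by simp
  next
    case (2 v)
    then show ?thesis using H'(3)[of v 0] H'(3)[of v 1] G(3,4) by simp
  qed
  \<comment> \<open>The reverse of \<open>U\<close> runs from \<open>\<psi>'\<close> after
    \<open>h'\<close> to \<open>h\<close>. Its boundary parameter is
    \<open>1 - 2 * (1 - r) = 2 * r - 1\<close>, so the whole path from -1 to 1 is used and the
    inverse again satisfies the cell condition.\<close>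
  have "pair_htpy W V c X X' i (\<lambda>v. \<psi>' (h' v)) (\<lambda>w. \<psi> (g' w)) h g"
  proof (rule pair_htpyI[OF htpy_rev[OF U(1)]])
    have "continuous_map (prod_topology (fst W) unit_interval) (fst X) (\<lambda>p. P (fst p, 2 * snd p - 1))"
      by (rule continuous_map_compose2'[OF PX continuous_map_fst continuous_map_interval_reparam])
         (auto intro!: continuous_intros)
    then show "htpy W X (\<lambda>(w, r). P (w, 2 * r - 1))"
      by (auto simp: htpy_def case_prod_unfold P0)
    show "(case (w, 0) of (w, r) \<Rightarrow> P (w, 2 * r - 1)) = \<psi> (g' w)" if "w \<in> points W" for w
      using P2[OF that, of 1] B(3)[OF that] by simp
    show "(case (w, 1) of (w, r) \<Rightarrow> P (w, 2 * r - 1)) = g w" if "w \<in> points W" for w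
      using P1[of 1 w] H1[OF pointed_map_in[OF g that]] by simp
  qed (use U \<psi>' in auto)
  then show ?thesis
    using \<psi>' H' ends by blast
qed

section \<open>Skeletal data, ladders and the comparison of complexes with the same cells\<close>

definition cw_data ::
    "'a pointed \<Rightarrow> (nat \<Rightarrow> 'j set) \<Rightarrow> (nat \<Rightarrow> 'x pointed) \<Rightarrow> (nat \<Rightarrow> ('j \<times> 'a \<times> real list) option \<Rightarrow> 'x) \<Rightarrow>
     (nat \<Rightarrow> 'x \<Rightarrow> 'x) \<Rightarrow> (nat \<Rightarrow> ('j \<times> ('a \<times> real list) \<times> real) option \<Rightarrow> 'x) \<Rightarrow> bool" where
  "cw_data A J S g f h \<longleftrightarrow> points (S 0) = {base (S 0)} \<and>
     (\<forall>n. cell_pushout n (J n) A (g n) (S n) (S (Suc n)) (f n) (h n))"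

text \<open>Both complexes use the index sets \<open>J\<close>, whose type is independent of the
  spaces, so the cells correspond one to one. The maps commute strictly with the skeleton maps; over
  cells they agree with those induced by \<open>\<alpha>\<close> up to a homotopy of pairs, whose
  boundary part stays in \<open>S' n\<close>. Only its existence is recorded, as the inductive step
  works with any choice.\<close>

definition ladder ::
    "'a pointed \<Rightarrow> 'b pointed \<Rightarrow> ('a \<Rightarrow> 'b) \<Rightarrow> (nat \<Rightarrow> 'j set) \<Rightarrow>
     (nat \<Rightarrow> 'x pointed) \<Rightarrow> (nat \<Rightarrow> ('j \<times> 'a \<times> real list) option \<Rightarrow> 'x) \<Rightarrow>
     (nat \<Rightarrow> 'x \<Rightarrow> 'x) \<Rightarrow> (nat \<Rightarrow> ('j \<times> ('a \<times> real list) \<times> real) option \<Rightarrow> 'x) \<Rightarrow>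
     (nat \<Rightarrow> 'y pointed) \<Rightarrow> (nat \<Rightarrow> ('j \<times> 'b \<times> real list) option \<Rightarrow> 'y) \<Rightarrow>
     (nat \<Rightarrow> 'y \<Rightarrow> 'y) \<Rightarrow> (nat \<Rightarrow> ('j \<times> ('b \<times> real list) \<times> real) option \<Rightarrow> 'y) \<Rightarrow> (nat \<Rightarrow> 'x \<Rightarrow> 'y) \<Rightarrow> bool" where
  "ladder A B \<alpha> J S g f h S' g' f' h' \<phi> \<longleftrightarrow> (\<forall>n.
     pointed_map (S n) (S' n) (\<phi> n) \<and> (\<forall>x\<in>points (S n). \<phi> (Suc n) (f n x) = f' n (\<phi> n x)) \<and>
     cell_htpy n (J n) A (S' n) (S' (Suc n)) (f' n)
       (\<lambda>v. \<phi> (Suc n) (h n v)) (\<lambda>w. \<phi> n (g n w)) (\<lambda>v. h' n (cells_fun n B \<alpha> v)) (\<lambda>w. g' n (bdries_fun n B \<alpha> w)))"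

lemma cw_data_pointed_space:
  assumes "cw_data A J S g f h"
  shows "pointed_space (S n)"
proof (induction n)
  case 0
  then show ?case using assms by (simp add: cw_data_def pointed_space_def)
next
  case (Suc n)
  then show ?case
    using assms unfolding cw_data_def by (blast intro: pointed_space_pushout)
qed

lemma colimit_pointed_space:
  assumes "cw_data A J S g f h" "sequential_colimit S f X k"
  shows "pointed_space X"
  using pointed_map_in[OF colimitD(2)[OF assms(2), of 0], of "base (S 0)"]
    pointed_map_base[OF colimitD(2)[OF assms(2), of 0]]
      cw_data_pointed_space[OF assms(1), of 0] by (simp add: pointed_space_def)

text \<open>Dependent choice on the pairs of \<open>\<psi> n\<close> and \<open>H n\<close>: each
  step is an existence statement whose witnesses must extend the previous ones. On points of cells
  and boundaries, the maps induced by the identity are identities, which brings the ladder condition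
  into the form used by \<open>ladder_step\<close> and back.\<close>

lemma ladder_left_inverse:
  assumes A: "pointed_space A" and S: "cw_data A J S g f h" and S': "cw_data A J S' g' f' h'"
    and \<phi>: "ladder A A (\<lambda>a. a) J S g f h S' g' f' h' \<phi>"
  obtains \<psi> H where "ladder A A (\<lambda>a. a) J S' g' f' h' S g f h \<psi>"
    "\<And>n. htpy (S n) (S n) (H n)"
    "\<And>n x. x \<in> points (S n) \<Longrightarrow> H n (x, 0) = \<psi> n (\<phi> n x)" "\<And>n x. x \<in> points (S n) \<Longrightarrow> H n (x, 1) = x"
    "\<And>n x t. x \<in> points (S n) \<Longrightarrow> t \<in> {0..1} \<Longrightarrow> H (Suc n) (f n x, t) = f n (H n (x, t))"
proof -
  define P where "P n s \<longleftrightarrow> pointed_map (S' n) (S n) (fst s) \<and> htpy (S n) (S n) (snd s) \<and>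
     (\<forall>x\<in>points (S n). snd s (x, 0) = fst s (\<phi> n x) \<and> snd s (x, 1) = x)" for n and s :: "('d \<Rightarrow> 'c) \<times> ('c \<times> real \<Rightarrow> 'c)"
  define Q where "Q n s s' \<longleftrightarrow> (\<forall>y\<in>points (S' n). fst s' (f' n y) = f n (fst s y)) \<and>
     (\<forall>x\<in>points (S n). \<forall>t\<in>{0..1}. snd s' (f n x, t) = f n (snd s (x, t))) \<and>
     cell_htpy n (J n) A (S n) (S (Suc n)) (f n)
       (\<lambda>v. fst s' (h' n v)) (\<lambda>w. fst s (g' n w)) (h n) (g n)" for n and s s' :: "('d \<Rightarrow> 'c) \<times> ('c \<times> real \<Rightarrow> 'c)"
  have "\<exists>s. P 0 s"
  proof (intro exI)
    have "pointed_map (S' 0) (S 0) (\<lambda>_. base (S 0))" "pointed_map (S 0) (S 0) (\<lambda>_. base (S 0))"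
      using S by (auto simp: cw_data_def pointed_map_def)
    then show "P 0 (\<lambda>_. base (S 0), \<lambda>(x, t). base (S 0))"
      using S htpy_const[of "S 0" "S 0" "\<lambda>_. base (S 0)"] by (auto simp: P_def cw_data_def)
  qed
  moreover have "\<exists>s'. P (Suc n) s' \<and> Q n s s'" if "P n s" for n s
  proof -
    have \<phi>n: "pointed_map (S n) (S' n) (\<phi> n)" "pointed_map (S (Suc n)) (S' (Suc n)) (\<phi> (Suc n))"
      "\<And>x. x \<in> points (S n) \<Longrightarrow> \<phi> (Suc n) (f n x) = f' n (\<phi> n x)"
      and ph: "cell_htpy n (J n) A (S' n) (S' (Suc n)) (f' n)
       (\<lambda>v. \<phi> (Suc n) (h n v)) (\<lambda>w. \<phi> n (g n w)) (\<lambda>v. h' n (cells_fun n A (\<lambda>a. a) v)) (\<lambda>w. g' n (bdries_fun n A (\<lambda>a. a) w))"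
      using \<phi> by (simp_all add: ladder_def)
    have ph': "cell_htpy n (J n) A (S' n) (S' (Suc n)) (f' n)
       (\<lambda>v. \<phi> (Suc n) (h n v)) (\<lambda>w. \<phi> n (g n w)) (h' n) (g' n)"
      by (rule pair_htpy_cong[OF ph]) (simp_all add: cells_fun_id[OF A] bdries_fun_id[OF A])
    have "cell_pushout n (J n) A (g n) (S n) (S (Suc n)) (f n) (h n)"
      "cell_pushout n (J n) A (g' n) (S' n) (S' (Suc n)) (f' n) (h' n)"
      using S S' by (auto simp: cw_data_def)
    note step = ladder_step[OF cw_data_pointed_space[OF S] cw_data_pointed_space[OF S'] this
      fillable_bdries_incl[OF A cw_data_pointed_space[OF S]] pointed_space_bdries \<phi>n ph', of "fst s"
        "snd s"]
    have "\<exists>\<psi>' H'. P (Suc n) (\<psi>', H') \<and> Q n s (\<psi>', H')"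
      using step \<open>P n s\<close> unfolding P_def Q_def by simp metis
    then show ?thesis by blast
  qed
  ultimately obtain s where s: "\<And>n. P n (s n)" "\<And>n. Q n (s n) (s (Suc n))"
    using dependent_nat_choice[of P Q] by metis
  show ?thesis
  proof (rule that[of "\<lambda>n. fst (s n)" "\<lambda>n. snd (s n)"])
    have "cell_htpy n (J n) A (S n) (S (Suc n)) (f n)
       (\<lambda>v. fst (s (Suc n)) (h' n v)) (\<lambda>w. fst (s n) (g' n w)) (\<lambda>v. h n (cells_fun n A (\<lambda>a. a) v)) (\<lambda>w. g n (bdries_fun n A (\<lambda>a. a) w))" for n
      by (rule pair_htpy_cong[of _ _ _ _ _ _ "\<lambda>v. fst (s (Suc n)) (h' n v)" "\<lambda>w. fst (s n) (g' n w)"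
        "h n" "g n"])
         (use s(2)[of n] in \<open>simp_all add: Q_def cells_fun_id[OF A] bdries_fun_id[OF A]\<close>)
    then show "ladder A A (\<lambda>a. a) J S' g' f' h' S g f h (\<lambda>n. fst (s n))"
      using s by (simp add: ladder_def P_def Q_def)
  qed (use s in \<open>auto simp: P_def Q_def\<close>)
qed

lemma ladder_colimit_left_inverse:
  assumes A: "pointed_space A" and S: "cw_data A J S g f h" and S': "cw_data A J S' g' f' h'"
    and \<phi>: "ladder A A (\<lambda>a. a) J S g f h S' g' f' h' \<phi>"
    and X: "sequential_colimit S f X k" and X': "sequential_colimit S' f' X' k'"
    and r: "\<And>n x. x \<in> points (S n) \<Longrightarrow> r (k n x) = k' n (\<phi> n x)"
  obtains \<psi> s where "ladder A A (\<lambda>a. a) J S' g' f' h' S g f h \<psi>" "pointed_map X' X s"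
    "\<And>n x. x \<in> points (S' n) \<Longrightarrow> s (k' n x) = k n (\<psi> n x)" "pointed_homotopic X X (s \<circ> r) id"
proof -
  obtain \<psi> H where \<psi>: "ladder A A (\<lambda>a. a) J S' g' f' h' S g f h \<psi>"
    and H: "\<And>n. htpy (S n) (S n) (H n)"
    "\<And>n x. x \<in> points (S n) \<Longrightarrow> H n (x, 0) = \<psi> n (\<phi> n x)" "\<And>n x. x \<in> points (S n) \<Longrightarrow> H n (x, 1) = x"
    "\<And>n x t. x \<in> points (S n) \<Longrightarrow> t \<in> {0..1} \<Longrightarrow> H (Suc n) (f n x, t) = f n (H n (x, t))"
    using ladder_left_inverse[OF A S S' \<phi>] by metis
  have \<psi>n: "pointed_map (S' n) (S n) (\<psi> n)" "\<And>y. y \<in> points (S' n) \<Longrightarrow> \<psi> (Suc n) (f' n y) = f n (\<psi> n y)"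
    and \<phi>n: "pointed_map (S n) (S' n) (\<phi> n)" for n
    using \<psi> \<phi> by (auto simp: ladder_def)
  obtain s where s: "pointed_map X' X s" "\<And>n x. x \<in> points (S' n) \<Longrightarrow> s (k' n x) = k n (\<psi> n x)"
    by (rule colimit_map[OF cw_data_pointed_space[OF S'] X', where u = "\<lambda>n x. k n (\<psi> n x)" and T = X])
       (auto intro!: pointed_map_comp[OF \<psi>n(1) colimitD(2)[OF X]]
         simp: \<psi>n(2) colimitD(3)[OF X] pointed_map_in[OF \<psi>n(1)])
  obtain K where K: "htpy X X K" "\<And>n x t. x \<in> points (S n) \<Longrightarrow> t \<in> {0..1}
    \<Longrightarrow> K (k n x, t) = k n (H n (x, t))"
    by (rule colimit_htpy[OF cw_data_pointed_space[OF S] X, where u = "\<lambda>n p. k n (H n p)" and T = X])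
       (auto intro!: htpy_post[OF H(1) colimitD(2)[OF X]]
         simp: H(4) colimitD(3)[OF X] htpy_in[OF H(1)])
  have "pointed_space X"
    by (rule colimit_pointed_space[OF S X])
  moreover have "K (x, 0) = (s \<circ> r) x \<and> K (x, 1) = id x" if "x \<in> points X" for x
    using X that
  proof (cases rule: colimit_cases)
    case (1 n y)
    then show ?thesis
      using K(2)[OF 1(1), of 0] K(2)[OF 1(1), of 1] H(2,3) r s(2) pointed_map_in[OF \<phi>n] by simp
  qed
  ultimately have "pointed_homotopic X X (s \<circ> r) id"
    using K(1) by (subst pointed_homotopic_iff) blast+
  then show ?thesis
    using that \<psi> s by blast
qed

text \<open>From \<open>us \<simeq> id\<close> and \<open>sr \<simeq> id\<close> follows
  \<open>r \<simeq> usr \<simeq> u\<close>; hence \<open>rs \<simeq> us \<simeq> id\<close>.\<close>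

lemma equivalence_of_left_inverses:
  assumes X: "pointed_space X" and r: "pointed_map X Y r" and s: "pointed_map Y X s"
    and u: "pointed_map X Y u"
    and sr: "pointed_homotopic X X (s \<circ> r) id" and us: "pointed_homotopic Y Y (u \<circ> s) id"
  shows "pointed_homotopy_equivalence X Y r"
proof -
  have "pointed_homotopic X Y (u \<circ> s \<circ> r) (u \<circ> id)"
    using pointed_homotopic_post[OF sr u] by (simp add: o_assoc)
  from pointed_homotopic_sym[OF pointed_homotopic_pre[OF us r]] this have "pointed_homotopic X Y r u"
    by (auto dest: pointed_homotopic_trans)
  from pointed_homotopic_pre[OF this s] have "pointed_homotopic Y Y (r \<circ> s) id"
    using pointed_homotopic_trans us by blast
  then show ?thesis
    unfolding pointed_homotopy_equivalence_def using r s sr by blast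
qed

proposition ladder_equivalence:
  assumes A: "pointed_space A" and S: "cw_data A J S g f h" and S': "cw_data A J S' g' f' h'"
    and \<phi>: "ladder A A (\<lambda>a. a) J S g f h S' g' f' h' \<phi>"
    and X: "sequential_colimit S f X k" and X': "sequential_colimit S' f' X' k'"
    and r: "pointed_map X X' r" "\<And>n x. x \<in> points (S n) \<Longrightarrow> r (k n x) = k' n (\<phi> n x)"
  shows "pointed_homotopy_equivalence X X' r"
proof -
  obtain \<psi> s where \<psi>: "ladder A A (\<lambda>a. a) J S' g' f' h' S g f h \<psi>" "pointed_map X' X s"
    "\<And>n x. x \<in> points (S' n) \<Longrightarrow> s (k' n x) = k n (\<psi> n x)" and sr: "pointed_homotopic X X (s \<circ> r) id"
    using ladder_colimit_left_inverse[OF A S S' \<phi> X X' r(2)] by metis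
  obtain u where "pointed_map X X' u" "pointed_homotopic X' X' (u \<circ> s) id"
    using ladder_colimit_left_inverse[OF A S' S \<psi>(1) X' X \<psi>(3)] by metis
  then show ?thesis
    using equivalence_of_left_inverses[OF colimit_pointed_space[OF S X] r(1) \<psi>(2)] sr by blast
qed

section \<open>Changing and realising pushouts\<close>

lemma equivclp_map:
  assumes "equivclp r p q" "\<And>x y. r x y \<Longrightarrow> s (m x) (m y)"
  shows "equivclp s (m p) (m q)"
  using assms(1)
proof (induction rule: equivclp_induct)
  case (step y z)
  then show ?case
    using assms(2) by (meson equivclp_into_equivclp)
qed simp

text \<open>\<open>V'\<close> supplies points and open sets, hence \<open>b\<close> is a
  homeomorphism. \<open>W'\<close> enters through the generated relation, for which it suffices that
  each \<open>w\<close> is reached, namely from \<open>a' w\<close>. This serves both to change the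
  representation of 0-cells and to change index sets.\<close>

lemma pushout_iso:
  fixes Z :: "'z pointed" and V :: "'v pointed" and V' :: "'u pointed"
  assumes po: "pointed_pushout W g i Z V X j h"
    and a: "pointed_map W' W a" and a': "pointed_map W W' a'" and aa': "\<And>w. w \<in> points W \<Longrightarrow> a (a' w) = w"
    and b: "pointed_map V' V b" and b': "pointed_map V V' b'" and bb': "\<And>v. v \<in> points V \<Longrightarrow> b (b' v) = v"
    and b'b: "\<And>v. v \<in> points V' \<Longrightarrow> b' (b v) = v"
    and i': "pointed_map W' V' i'" and comm: "\<And>w. w \<in> points W' \<Longrightarrow> b (i' w) = i (a w)"
    and g': "\<And>w. w \<in> points W' \<Longrightarrow> g' w = g (a w)" and W': "pointed_space W'"
  shows "pointed_pushout W' g' i' Z V' X j (\<lambda>v. h (b v))"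
  unfolding pointed_pushout_def
proof (intro conjI ballI allI impI)
  let ?R = "\<lambda>(p :: 'z + 'v) (q :: 'z + 'v). \<exists>w \<in> points W. p = Inl (g w) \<and> q = Inr (i w)"
  let ?R' = "\<lambda>(p :: 'z + 'u) (q :: 'z + 'u). \<exists>w \<in> points W'. p = Inl (g' w) \<and> q = Inr (i' w)"
  note bin = pointed_map_in[OF b] and b'in = pointed_map_in[OF b']
  have ker: "case_sum j h x = case_sum j h y \<longleftrightarrow> equivclp ?R x y"
    if "x \<in> points Z <+> points V" "y \<in> points Z <+> points V" for x y
    using po that by (simp add: pointed_pushout_def)
  show "pointed_map W' Z g'"
    by (rule pointed_map_cong[OF W' pointed_map_comp[OF a pushoutD(1)[OF po]]]) (simp add: g')
  show "pointed_map W' V' i'" "pointed_map Z X j" "pointed_map V' X (\<lambda>v. h (b v))"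
    using i' pushoutD(3)[OF po] pointed_map_comp[OF b pushoutD(4)[OF po]] by auto
  have "h ` points V = (\<lambda>v. h (b v)) ` points V'"
    using bin b'in bb' by (auto simp: image_iff) metis
  then show "points X = case_sum j (\<lambda>v. h (b v)) ` (points Z <+> points V')"
    using po unfolding pointed_pushout_def Plus_def image_Un image_image by simp
  fix p q assume p: "p \<in> points Z <+> points V'" and q: "q \<in> points Z <+> points V'"
  let ?m = "map_sum (\<lambda>z. z) b" and ?m' = "map_sum (\<lambda>z. z) b'"
  have m: "?m x \<in> points Z <+> points V" "case_sum j (\<lambda>v. h (b v)) x = case_sum j h (?m x)"
    "?m' (?m x) = x"
    if "x \<in> points Z <+> points V'" for x
    using that bin b'b by auto
  have "case_sum j (\<lambda>v. h (b v)) p = case_sum j (\<lambda>v. h (b v)) q \<longleftrightarrow> equivclp ?R (?m p) (?m q)"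
    unfolding m(2)[OF p] m(2)[OF q] by (rule ker[OF m(1)[OF p] m(1)[OF q]])
  also have "\<dots> \<longleftrightarrow> equivclp ?R' p q"
  proof
    assume "equivclp ?R' p q"
    then show "equivclp ?R (?m p) (?m q)"
      by (rule equivclp_map) (use comm g' pointed_map_in[OF a] in auto)
  next
    assume R: "equivclp ?R (?m p) (?m q)"
    have "equivclp ?R' (?m' (?m p)) (?m' (?m q))"
      using R
    proof (rule equivclp_map)
      fix x y assume "?R x y"
      then obtain w where w: "w \<in> points W" "x = Inl (g w)" "y = Inr (i w)" by blast
      then have w': "a' w \<in> points W'" "a (a' w) = w"
        using pointed_map_in[OF a'] aa' by auto
      have "b' (i w) = i' (a' w)"
        using comm[OF w'(1)] b'b[OF pointed_map_in[OF i' w'(1)]] w'(2) by simp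
      then show "?R' (?m' x) (?m' y)"
        using w w' g'[OF w'(1)] by (intro bexI[of _ "a' w"]) auto
    qed
    then show "equivclp ?R' p q"
      using m(3) p q by simp
  qed
  finally show "case_sum j (\<lambda>v. h (b v)) p = case_sum j (\<lambda>v. h (b v)) q \<longleftrightarrow> equivclp ?R' p q" .
next
  note bin = pointed_map_in[OF b] and b'in = pointed_map_in[OF b']
  fix U assume U: "U \<subseteq> points X"
  have "openin (fst V) {v \<in> points V. h v \<in> U} \<longleftrightarrow> openin (fst V') {v \<in> points V'. h (b v) \<in> U}"
  proof
    assume "openin (fst V) {v \<in> points V. h v \<in> U}"
    with b have "openin (fst V') {v \<in> points V'. b v \<in> {v \<in> points V. h v \<in> U}}"
      unfolding pointed_map_def continuous_map_def by blast
    also have "{v \<in> points V'. b v \<in> {v \<in> points V. h v \<in> U}} = {v \<in> points V'. h (b v) \<in> U}"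
      using bin by auto
    finally show "openin (fst V') {v \<in> points V'. h (b v) \<in> U}" .
  next
    assume "openin (fst V') {v \<in> points V'. h (b v) \<in> U}"
    with b' have "openin (fst V) {v \<in> points V. b' v \<in> {v \<in> points V'. h (b v) \<in> U}}"
      unfolding pointed_map_def continuous_map_def by blast
    also have "{v \<in> points V. b' v \<in> {v \<in> points V'. h (b v) \<in> U}} = {v \<in> points V. h v \<in> U}"
      using b'in bb' by auto
    finally show "openin (fst V) {v \<in> points V. h v \<in> U}" .
  qed
  then show "openin (fst X) U \<longleftrightarrow>
      openin (fst Z) {z \<in> points Z. j z \<in> U} \<and> openin (fst V') {v \<in> points V'. h (b v) \<in> U}"
    using po U unfolding pointed_pushout_def by blast
qed

definition wedge_reindex :: "('i \<Rightarrow> 'j) \<Rightarrow> ('i \<times> 'a) option \<Rightarrow> ('j \<times> 'a) option" where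
  "wedge_reindex \<iota> = map_option (\<lambda>(j, x). (\<iota> j, x))"

lemma wedge_reindex_pointed_map:
  assumes "pointed_space X" "\<iota> ` J \<subseteq> J'"
  shows "pointed_map (wedge J X) (wedge J' X) (wedge_reindex \<iota>)"
proof (rule wedge_pointed_map[OF assms(1)])
  fix j assume "j \<in> J"
  then have "pointed_map X (wedge J' X) (wedge_incl X (\<iota> j))"
    using assms(2) by (intro pointed_map_wedge_incl) auto
  moreover have "wedge_incl X (\<iota> j) = (\<lambda>x. wedge_reindex \<iota> (wedge_incl X j x))"
    by (auto simp: wedge_incl_def wedge_reindex_def)
  ultimately show "pointed_map X (wedge J' X) (\<lambda>x. wedge_reindex \<iota> (wedge_incl X j x))"
    by simp
qed (simp_all add: wedge_reindex_def)

lemma wedge_map_reindex: "wedge_map Y f (wedge_reindex \<iota> p) = wedge_reindex \<iota> (wedge_map Y f p)"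
  by (auto simp: wedge_map_def wedge_reindex_def wedge_incl_def split: option.split)

lemma wedge_reindex_inv:
  "p \<in> points (wedge J X) \<Longrightarrow> (\<And>j. j \<in> J \<Longrightarrow> \<kappa> (\<iota> j) = j) \<Longrightarrow> wedge_reindex \<kappa> (wedge_reindex \<iota> p) = p"
  by (auto simp: wedge_reindex_def points_wedge)

section \<open>Passage between attached cells and pushouts uniform in the dimension\<close>

lemma points_bdries_0: "points (bdries 0 J A) = {None}"
  by (simp add: bdries_def points_wedge)

lemma base_bdries [simp]: "base (bdries n J A) = None"
  and base_cells [simp]: "base (cells n J A) = None"
  by (simp_all add: bdries_def cells_def)

lemma bdries_incl_None: "pointed_space A \<Longrightarrow> bdries_incl n A None = None"
  by (simp add: bdries_incl_def)

text \<open>\<open>cell 0 A\<close> pads the points of \<open>A\<close> with an empty list and a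
  zero so that cells of all dimensions have one type. These mutually inverse maps of wedges add and
  remove the padding.\<close>

lemma
  fixes A :: "'a pointed"
  defines "e \<equiv> \<lambda>a. ((a, []), 0) :: ('a \<times> real list) \<times> real" and "d \<equiv> \<lambda>((a, _), _). a"
  assumes A: "pointed_space A"
  shows cell_0_to: "pointed_map (wedge J A) (wedge J (rename e A)) (wedge_map (rename e A) e)"
    and cell_0_from: "pointed_map (wedge J (rename e A)) (wedge J A) (wedge_map A d)"
    and cell_0_to_from: "p \<in> points (wedge J (rename e A))
      \<Longrightarrow> wedge_map (rename e A) e (wedge_map A d p) = p"
    and cell_0_from_to: "q \<in> points (wedge J A) \<Longrightarrow> wedge_map A d (wedge_map (rename e A) e q) = q"
proof -
  have R: "pointed_space (rename e A)"
    using A by (simp add: pointed_space_def rename_def)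
  show "pointed_map (wedge J A) (wedge J (rename e A)) (wedge_map (rename e A) e)"
    by (rule wedge_map_pointed_map[OF A rename_pointed_map])
  have "htpy (rename e A) A (\<lambda>(x, t). d x)"
    by (rule rename_htpy) (simp add: d_def e_def pointed_map_iff_htpy[symmetric] pointed_map_id)
  then show "pointed_map (wedge J (rename e A)) (wedge J A) (wedge_map A d)"
    by (intro wedge_map_pointed_map[OF R]) (simp add: pointed_map_iff_htpy)
  show "wedge_map (rename e A) e (wedge_map A d p) = p" if "p \<in> points (wedge J (rename e A))"
    by (rule trans[OF wedge_map_comp wedge_map_id[OF that]])
       (auto simp: base_rename points_rename e_def d_def)
  show "wedge_map A d (wedge_map (rename e A) e q) = q" if "q \<in> points (wedge J A)"
    by (rule trans[OF wedge_map_comp wedge_map_id[OF that]])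
       (auto simp: base_rename e_def d_def)
qed

lemma pointed_map_from_one_point: "x = base Y \<Longrightarrow> pointed_space Y \<Longrightarrow> pointed_map one_point Y (\<lambda>_. x)"
  by (simp add: pointed_map_def pointed_space_def one_point_def)

lemma pointed_map_to_one_point: "pointed_map X one_point (\<lambda>_. ())"
  by (simp add: pointed_map_def one_point_def)

text \<open>In positive dimension this is a matter of unfolding. In dimension zero the one-point
  space and the wedge of copies of \<open>A\<close> are exchanged for the padded versions, after
  which no argument has to distinguish dimensions.\<close>

lemma attach_cells_imp_pushout:
  fixes X :: "'x pointed"
  assumes A: "pointed_space A" and at: "attach_cells A n Z X f"
  obtains J :: "'x set" and g h where "cell_pushout n J A g Z X f h"
proof (cases n)
  case 0
  with at obtain J :: "'x set"
    and h where po: "pointed_pushout one_point (\<lambda>_. base Z) (\<lambda>_. None) Z (wedge J A) X f h"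
    unfolding attach_cells_def by auto
  have "pointed_pushout (bdries 0 J A) (\<lambda>_. base Z) (bdries_incl 0 A) Z (cells 0 J A) X f
     (\<lambda>v. h (wedge_map A (\<lambda>((a, _), _). a) v))"
    by (rule pushout_iso[OF po, of _ "\<lambda>_. ()" "\<lambda>_. None" _ _ "wedge_map (cell 0 A) (\<lambda>a. ((a, []), 0))"])
       (use cell_0_to[OF A, of J] cell_0_from[OF A, of J] cell_0_to_from[OF A, of _ J]
         cell_0_from_to[OF A, of _ J] bdries_incl_pointed_map[OF A, of 0 J]
        in \<open>auto simp: cells_def pointed_map_to_one_point pointed_space_bdries points_bdries_0 bdries_incl_None[OF A] one_point_def[THEN arg_cong[of _ _ fst]]
          intro: pointed_map_from_one_point\<close>)
  then show ?thesis using that 0 by blast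
next
  case (Suc m)
  with at obtain J :: "'x set" and g h where "pointed_pushout (wedge J (iterated_suspension m A)) g
     (wedge_map (reduced_cone (iterated_suspension m A)) (cone_base (iterated_suspension m A)))
     Z (wedge J (reduced_cone (iterated_suspension m A))) X f h"
    unfolding attach_cells_def by (auto simp: Let_def)
  then show ?thesis
    using that[of J g h] Suc by (simp add: bdries_def cells_def bdries_incl_def)
qed

text \<open>\<open>attach_cells\<close> takes its indices from the type of \<open>X\<close>, whereas
  the construction keeps an index type of its own. The indices are transported along
  \<open>\<iota>\<close> before the padding of 0-cells is removed.\<close>

lemma pushout_imp_attach_cells:
  fixes X :: "'x pointed" and \<iota> :: "'j \<Rightarrow> 'x"
  assumes A: "pointed_space A" and po: "cell_pushout n J A g Z X f h"
    and \<iota>: "inj_on \<iota> J"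
  shows "attach_cells A n Z X f"
proof -
  let ?J = "\<iota> ` J" and ?\<kappa> = "inv_into J \<iota>"
  have \<kappa>: "?\<kappa> ` ?J \<subseteq> J" "\<And>j. j \<in> J \<Longrightarrow> ?\<kappa> (\<iota> j) = j" "\<And>j. j \<in> ?J \<Longrightarrow> \<iota> (?\<kappa> j) = j"
    using \<iota> by (auto simp: inv_into_into f_inv_into_f)
  have re: "pointed_pushout (bdries n ?J A) (\<lambda>w. g (wedge_reindex ?\<kappa> w)) (bdries_incl n A) Z (cells n ?J A) X f (\<lambda>v. h (wedge_reindex ?\<kappa> v))"
    unfolding bdries_def cells_def
    by (rule pushout_iso[OF po[unfolded bdries_def cells_def], of _ _ "wedge_reindex \<iota>"
      _ _ "wedge_reindex \<iota>"])
       (use \<kappa> in \<open>auto simp: bdries_incl_def wedge_map_reindex pointed_space_bdry[OF A]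
         pointed_space_cell[OF A]
          intro!: wedge_reindex_pointed_map wedge_reindex_inv bdries_incl_pointed_map[OF A, unfolded bdries_def cells_def bdries_incl_def]\<close>)
  show ?thesis
  proof (cases n)
    case 0
    have Z: "g (wedge_reindex ?\<kappa> None) = base Z"
      using pointed_map_base[OF pushoutD(1)[OF re]] by (simp add: bdries_def)
    have "pointed_pushout one_point (\<lambda>_. base Z) (\<lambda>_. None) Z (wedge ?J A) X f
        (\<lambda>v. h (wedge_reindex ?\<kappa> (wedge_map (cell 0 A) (\<lambda>a. ((a, []), 0)) v)))"
      by (rule pushout_iso[OF re[unfolded 0], of _ "\<lambda>_. None" "\<lambda>_. ()"
        _ _ "wedge_map A (\<lambda>((a, _), _). a)"])
         (use cell_0_to[OF A, of ?J] cell_0_from[OF A, of ?J] cell_0_to_from[OF A, of _ ?J]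
           cell_0_from_to[OF A, of _ ?J] Z
          in \<open>auto simp: cells_def pointed_map_to_one_point[unfolded one_point_def]
            points_bdries_0 bdries_incl_None[OF A] pointed_space_bdries
            pointed_space_def one_point_def points_wedge intro: pointed_map_from_one_point[unfolded one_point_def]\<close>)
    then show ?thesis
      unfolding attach_cells_def 0 by auto
  next
    case (Suc m)
    then show ?thesis
      using re unfolding attach_cells_def by (auto simp: Let_def bdries_def cells_def bdries_incl_def)
  qed
qed

lemma CW_complex_imp_cw_data:
  fixes X :: "'x pointed"
  assumes A: "pointed_space A" and X: "CW_complex A X"
  obtains J :: "nat \<Rightarrow> 'x set" and S :: "nat \<Rightarrow> 'x pointed" and g f h k
  where "cw_data A J S g f h" "sequential_colimit S f X k"
proof -
  obtain S :: "nat \<Rightarrow> 'x pointed" and f k where S: "points (S 0) = {base (S 0)}"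
    "\<And>n. attach_cells A n (S n) (S (Suc n)) (f n)" "sequential_colimit S f X k"
    using X unfolding CW_complex_def by blast
  have "\<exists>J g h. pointed_pushout (bdries n J A) g (bdries_incl n A) (S n) (cells n (J :: 'x set) A) (S (Suc n)) (f n) h" for n
    using attach_cells_imp_pushout[OF A S(2)[of n]] by blast
  then obtain J g h where "\<And>n. pointed_pushout (bdries n (J n) A) (g n) (bdries_incl n A) (S n) (cells n (J n :: 'x set) A) (S (Suc n)) (f n) (h n)"
    by metis
  then show ?thesis
    using that[of J S g f h k] S by (simp add: cw_data_def)
qed

lemma cw_data_imp_CW_complex:
  fixes X :: "'x pointed" and S :: "nat \<Rightarrow> 'x pointed" and \<iota> :: "'j \<Rightarrow> 'x" and J :: "nat \<Rightarrow> 'j set"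
  assumes A: "pointed_space A" and S: "cw_data A J S g f h" and X: "sequential_colimit S f X k"
    and \<iota>: "inj \<iota>"
  shows "CW_complex A X"
  unfolding CW_complex_def
proof (rule exI[of _ S], rule exI[of _ f], rule exI[of _ k], intro conjI allI)
  show "points (S 0) = {base (S 0)}"
    using S by (simp add: cw_data_def)
  show "attach_cells A n (S n) (S (Suc n)) (f n)" for n
    by (rule pushout_imp_attach_cells[OF A, of n "J n" "g n" "S n" "S (Suc n)" "f n" "h n" \<iota>])
       (use S \<iota> in \<open>auto simp: cw_data_def intro: inj_on_subset\<close>)
qed (rule X)

text \<open>As \<open>c\<close> is injective, the underlying set of the pushout is \<open>Z\<close>
  together with the points of \<open>V\<close> outside the image of \<open>c\<close>. The map
  \<open>e\<close> names the latter inside the type of \<open>Z\<close>, so all skeleta share a type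
  and the structure map from \<open>Z\<close> is an inclusion.\<close>

lemma pushout_realize:
  fixes Z :: "'y pointed" and V :: "'v pointed" and e :: "'v \<Rightarrow> 'y"
  assumes Z: "pointed_space Z" and W: "pointed_space W" and g: "pointed_map W Z g"
    and c: "pointed_map W V c"
    and inj: "inj_on c (points W)"
    and e: "inj_on e (points V - c ` points W)" "e ` (points V - c ` points W) \<inter> points Z = {}"
  obtains Z' h where "pointed_pushout W g c Z V Z' (\<lambda>z. z) h" "base Z' = base Z"
    "points Z' = points Z \<union> e ` (points V - c ` points W)"
proof -
  let ?N = "points V - c ` points W"
  define h where "h v = (if v \<in> c ` points W then g (inv_into (points W) c v) else e v)" for v
  define T where "T = topology (\<lambda>U. U \<subseteq> points Z \<union> e ` ?N \<and> openin (fst Z) {z \<in> points Z. z \<in> U} \<and>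
     openin (fst V) {v \<in> points V. h v \<in> U})"
  have hc: "h (c w) = g w" if "w \<in> points W" for w
    using that inj by (simp add: h_def)
  have he: "h v = e v" if "v \<in> ?N" for v
    using that by (simp add: h_def)
  have hin: "h v \<in> points Z \<union> e ` ?N" if "v \<in> points V" for v
    using that hc he pointed_map_in[OF g] by (cases "v \<in> c ` points W") auto
  have openT: "openin T U \<longleftrightarrow> U \<subseteq> points Z \<union> e ` ?N \<and> openin (fst Z) {z \<in> points Z. z \<in> U} \<and>
     openin (fst V) {v \<in> points V. h v \<in> U}" for U
  proof -
    have *: "{x \<in> A. f x \<in> S \<inter> T} = {x \<in> A. f x \<in> S} \<inter> {x \<in> A. f x \<in> T}"
      for S T :: "'y set" and A :: "'k set" and f by auto
    have **: "{x \<in> A. f x \<in> \<Union>K} = (\<Union>S\<in>K. {x \<in> A. f x \<in> S})" for K :: "'y set set" and A :: "'k set"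
      and f by auto
    have "istopology (\<lambda>U. U \<subseteq> points Z \<union> e ` ?N \<and> openin (fst Z) {z \<in> points Z. id z \<in> U} \<and>
      openin (fst V) {v \<in> points V. h v \<in> U})"
      unfolding istopology_def * **
        by (simp add: openin_Int Union_least le_infI1) (blast intro: openin_Union)
    then show ?thesis
      by (simp add: T_def topology_inverse')
  qed
  have ZV: "{v \<in> points V. h v \<in> points Z \<union> e ` ?N} = points V"
    using hin by auto
  have pT: "topspace T = points Z \<union> e ` ?N"
  proof (rule antisym)
    show "topspace T \<subseteq> points Z \<union> e ` ?N"
      using openin_topspace[of T] unfolding openT by blast
    have "{z \<in> points Z. z \<in> points Z \<union> e ` ?N} = points Z" by auto
    then show "points Z \<union> e ` ?N \<subseteq> topspace T"
      by (intro openin_subset) (simp only: openT ZV, simp)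
  qed
  let ?X = "(T, base Z)"
  let ?R = "\<lambda>p q. \<exists>w \<in> points W. p = Inl (g w) \<and> q = Inr (c w)" and ?k = "case_sum (\<lambda>z. z) h"
  have "pointed_pushout W g c Z V ?X (\<lambda>z. z) h"
    unfolding pointed_pushout_def
  proof (intro conjI ballI allI impI)
    show "pointed_map Z ?X (\<lambda>z. z)"
      by (auto simp: pointed_map_def continuous_map_def pT openT)
    have "h (base V) = base Z"
      using hc[of "base W"] W pointed_map_base[OF c] pointed_map_base[OF g]
        by (simp add: pointed_space_def)
    then show "pointed_map V ?X h"
      using hin by (auto simp: pointed_map_def continuous_map_def pT openT)
    show "points ?X = ?k ` (points Z <+> points V)"
    proof (rule antisym)
      show "?k ` (points Z <+> points V) \<subseteq> points ?X"
      proof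
        fix y assume "y \<in> ?k ` (points Z <+> points V)"
        then consider "y \<in> points Z" | v where "v \<in> points V" "y = h v" by auto
        then show "y \<in> points ?X"
          using hin by cases (simp_all add: pT del: Un_iff, simp)
      qed
      have "e v \<in> ?k ` (points Z <+> points V)" if "v \<in> ?N" for v
        by (rule image_eqI[of _ _ "Inr v"]) (use he[OF that] that in auto)
      moreover have "z \<in> ?k ` (points Z <+> points V)" if "z \<in> points Z" for z
        by (rule image_eqI[of _ _ "Inl z"]) (use that in auto)
      ultimately show "points ?X \<subseteq> ?k ` (points Z <+> points V)"
        by (auto simp: pT)
    qed
    fix p q assume p: "p \<in> points Z <+> points V" and q: "q \<in> points Z <+> points V"
    \<comment> \<open>A normal form in the disjoint sum: boundary points are moved to
      \<open>Z\<close>, everything else stays. Each element is related to its normal form, and its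
      image in the pushout determines the normal form, so equal images give related
      elements.\<close>
    define nf :: "'y + 'v \<Rightarrow> 'y + 'v"
      where "nf = case_sum Inl (\<lambda>v. if v \<in> c ` points W then Inl (h v) else Inr v)"
    have nf: "equivclp ?R x (nf x)" for x
    proof (cases x)
      case (Inr v)
      show ?thesis
      proof (cases "v \<in> c ` points W")
        case True
        then obtain w where w: "w \<in> points W" "v = c w" by blast
        have "equivclp ?R (Inl (g w)) (Inr (c w))"
          using w by (intro r_into_equivclp) auto
        then show ?thesis
          using w hc Inr by (simp add: nf_def equivclp_sym)
      qed (simp add: nf_def Inr)
    qed (simp add: nf_def)
    show "?k p = ?k q \<longleftrightarrow> equivclp ?R p q"
    proof
      assume "equivclp ?R p q"
      then show "?k p = ?k q"
        by (rule equivclp_imp_eq) (use hc in auto)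
    next
      assume eq: "?k p = ?k q"
      have new: "e v \<notin> points Z" if "v \<in> ?N" for v
        using e(2) that by blast
      have old: "h v \<in> points Z" if "v \<in> c ` points W" for v
        using that hc pointed_map_in[OF g] by auto
      have ei: "v = v'" if "e v = e v'" "v \<in> ?N" "v' \<in> ?N" for v v'
        using e(1) that by (blast dest: inj_onD)
      have "nf p = nf q"
        using p q
      proof (elim PlusE)
        fix z z' assume "p = Inl z" "q = Inl z'"
        then show ?thesis using eq by (simp add: nf_def)
      next
        fix z v assume *: "z \<in> points Z" "p = Inl z" "v \<in> points V" "q = Inr v"
        then show ?thesis using eq new[of v] he[of v] by (cases "v \<in> c ` points W") (auto simp: nf_def)
      next
        fix z v assume *: "z \<in> points Z" "q = Inl z" "v \<in> points V" "p = Inr v"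
        then show ?thesis using eq new[of v] he[of v] by (cases "v \<in> c ` points W") (auto simp: nf_def)
      next
        fix v v' assume *: "v \<in> points V" "p = Inr v" "v' \<in> points V" "q = Inr v'"
        then have hh: "h v = h v'" using eq by simp
        show ?thesis
        proof (cases "v \<in> c ` points W"; cases "v' \<in> c ` points W")
          assume "v \<notin> c ` points W" "v' \<notin> c ` points W"
          then show ?thesis using * hh he[of v] he[of v'] ei[of v v'] by (simp add: nf_def)
        next
          assume "v \<notin> c ` points W" "v' \<in> c ` points W"
          then show ?thesis using * hh he[of v] old[of v'] new[of v] by simp
        next
          assume "v \<in> c ` points W" "v' \<notin> c ` points W"
          then show ?thesis using * hh he[of v'] old[of v] new[of v'] by simp
        qed (use * hh in \<open>simp add: nf_def\<close>)
      qed
      then show "equivclp ?R p q"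
        using equivclp_trans[OF nf[of p]] equivclp_sym[OF nf[of q]] by simp
    qed
  next
    show "openin (fst ?X) U \<longleftrightarrow> openin (fst Z) {z \<in> points Z. z \<in> U}
      \<and> openin (fst V) {v \<in> points V. h v \<in> U}"
      if "U \<subseteq> points ?X" for U
      using that by (simp add: openT pT)
  qed (rule g c)+
  then show ?thesis
    using that[of ?X h] by (simp add: pT)
qed

text \<open>Skeleta are realised on triples (index of the cell, point of \<open>B\<close>, cube coordinates); the length of
  the list is the dimension of the open cell.\<close>

definition cw_stage :: "'b pointed \<Rightarrow> nat \<Rightarrow> ('j \<times> 'b \<times> real list) pointed \<Rightarrow> bool" where
  "cw_stage B n Z \<longleftrightarrow> base Z = (undefined, base B, []) \<and> pointed_space Z \<and>
     (\<forall>p\<in>points Z. p = base Z \<or> length (snd (snd p)) < n)"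

text \<open>New points carry lists of length exactly \<open>n\<close>, old points other than the
  base point have shorter ones; thus the two are disjoint. A 0-cell also has the empty list, but its
  point of \<open>B\<close> differs from \<open>base B\<close>, which separates it from the base
  point.\<close>

lemma cw_stage_step:
  fixes Z :: "('j \<times> 'b \<times> real list) pointed" and J :: "'j set"
  assumes B: "pointed_space B" and Z: "cw_stage B n Z" and g: "pointed_map (bdries n J B) Z g"
  obtains Z' h where "cell_pushout n J B g Z Z' (\<lambda>z. z) h" "cw_stage B (Suc n) Z'"
proof -
  \<comment> \<open>The value at \<open>None\<close> is a dummy, since \<open>None\<close> lies in
    the image of the boundary. For a 0-cell the padding is dropped; otherwise the cone coordinate is
    put in front of the \<open>n - 1\<close> suspension coordinates.\<close>
  define e :: "('j \<times> ('b \<times> real list) \<times> real) option \<Rightarrow> 'j \<times> 'b \<times> real list" where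
    "e v = (case v of None \<Rightarrow> undefined | Some (j, ((b, ts), t)) \<Rightarrow> (j, b, if n = 0 then [] else t # ts))" for v
  let ?N = "points (cells n J B) - bdries_incl n B ` points (bdries n J B)"
  have new: "\<exists>j b ts t. v = Some (j, ((b, ts), t)) \<and> (n = 0 \<longrightarrow> ts = [] \<and> t = 0 \<and> b \<noteq> base B)
    \<and> (0 < n \<longrightarrow> length ts + 1 = n)"
    if v: "v \<in> ?N" for v
  proof -
    have "None \<in> bdries_incl n B ` points (bdries n J B)"
      by (rule image_eqI[of _ _ None]) (simp_all add: bdries_incl_None[OF B] bdries_def)
    then have "v \<noteq> None"
      using DiffD2[OF v] by metis
    then obtain j x where x: "v = Some (j, x)" "x \<in> points (cell n B)" "x \<noteq> base (cell n B)"
      using v by (auto simp: cells_def points_wedge)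
    show ?thesis
    proof (cases n)
      case 0
      then show ?thesis using x by (auto simp: points_rename base_rename)
    next
      case (Suc m)
      then have xq: "x \<in> points (cyl_quotient (iterated_suspension m B) {1} 1)"
        using x by (simp add: reduced_cone_eq)
      obtain y s where "x = (y, s)" "y \<in> points (iterated_suspension m B)"
        by (rule cyl_quotient_cases[OF pointed_space_iterated_suspension[OF B] _ _ xq]) auto
      then show ?thesis
        using iterated_suspension_length[OF B, of y m] x Suc by (cases y) auto
    qed
  qed
  have inj: "inj_on e ?N"
  proof (rule inj_onI)
    fix v v' assume v: "v \<in> ?N" and v': "v' \<in> ?N" and eq: "e v = e v'"
    obtain j b ts t where 1: "v = Some (j, ((b, ts), t))" "n = 0 \<longrightarrow> ts = [] \<and> t = 0 \<and> b \<noteq> base B"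
      using new[OF v] by (elim exE conjE) (rule that)
    obtain j' b' ts' t' where 2: "v' = Some (j', ((b', ts'), t'))"
      "n = 0 \<longrightarrow> ts' = [] \<and> t' = 0 \<and> b' \<noteq> base B"
      using new[OF v'] by (elim exE conjE) (rule that)
    show "v = v'"
      using eq 1(2) 2(2) unfolding 1(1) 2(1) by (cases "n = 0") (simp_all add: e_def)
  qed
  have bZ: "base Z = (undefined, base B, [])" and lZ: "\<And>p. p \<in> points Z
    \<Longrightarrow> p = base Z \<or> length (snd (snd p)) < n"
    using Z unfolding cw_stage_def by blast+
  have len: "e v \<noteq> base Z \<and> length (snd (snd (e v))) = n" if v: "v \<in> ?N" for v
  proof -
    obtain j b ts t where "v = Some (j, ((b, ts), t))" "n = 0 \<longrightarrow> ts = [] \<and> t = 0 \<and> b \<noteq> base B"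
      "0 < n \<longrightarrow> length ts + 1 = n"
      using new[OF v] by (elim exE conjE) (rule that)
    then show ?thesis
      unfolding bZ by (cases "n = 0") (simp_all add: e_def)
  qed
  have disj: "e ` ?N \<inter> points Z = {}"
  proof -
    have "e v \<notin> points Z" if "v \<in> ?N" for v
      using lZ[of "e v"] len[OF that] by auto
    then show ?thesis by blast
  qed
  have Zp: "pointed_space Z" using Z by (simp add: cw_stage_def)
  obtain Z' h where Z': "cell_pushout n J B g Z Z' (\<lambda>z. z) h" "base Z' = base Z"
      "points Z' = points Z \<union> e ` ?N"
    by (rule pushout_realize[OF Zp pointed_space_bdries g bdries_incl_pointed_map[OF B]
      bdries_incl_inj[OF B] inj disj])
  have "p = base Z' \<or> length (snd (snd p)) < Suc n" if p: "p \<in> points Z'" for p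
  proof -
    consider "p \<in> points Z" | v where "v \<in> ?N" "p = e v"
      using p unfolding Z'(3) by blast
    then show ?thesis
    proof cases
      case 1
      then show ?thesis using lZ[OF 1] by (auto simp: Z'(2))
    next
      case 2
      then show ?thesis using len[OF 2(1)] by simp
    qed
  qed
  then have "cw_stage B (Suc n) Z'"
    using Z pointed_space_pushout[OF Z'(1) Zp] by (simp add: cw_stage_def Z'(2))
  then show ?thesis
    using that Z' by blast
qed

definition cw_start :: "'b pointed \<Rightarrow> ('j \<times> 'b \<times> real list) pointed" where
  "cw_start B = (discrete_topology {(undefined, base B, [])}, (undefined, base B, []))"

lemma cw_stage_start: "cw_stage B 0 (cw_start B)"
  and points_start: "points (cw_start B) = {base (cw_start B)}"
  by (simp_all add: cw_stage_def cw_start_def pointed_space_def)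

text \<open>Copies of one point in stages \<open>m \<le> n\<close> are linked through the stages
  between them. The generated relation is therefore equality of points, and the union of the stages
  carries the colimit.\<close>

lemma inclusions_colimit:
  assumes Y: "\<And>n. pointed_map (Y n) (Y (Suc n)) (\<lambda>z. z)"
  obtains X where "sequential_colimit Y (\<lambda>_ z. z) X (\<lambda>_ z. z)"
proof -
  let ?X = "(quotient_space (sum_topology (\<lambda>n. fst (Y n)) UNIV) (\<lambda>(n, x). x), base (Y 0))"
  let ?R = "\<lambda>p q. \<exists>n. \<exists>x \<in> points (Y n). p = (n, x) \<and> q = (Suc n, x)"
  have base: "base (Y n) = base (Y 0)" for n
  proof (induction n)
    case (Suc n)
    then show ?case using pointed_map_base[OF Y, of n] by simp
  qed simp
  have chain: "equivclp ?R (m, x) (n, x)" if "m \<le> n" "x \<in> points (Y m)" for m n x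
  proof -
    have "equivclp ?R (m, x) (n, x) \<and> x \<in> points (Y n)"
      using that(1)
    proof (induction rule: dec_induct)
      case (step n)
      then have R: "?R (n, x) (Suc n, x)" and IH: "equivclp ?R (m, x) (n, x)" by auto
      have "equivclp ?R (m, x) (Suc n, x)"
        by (rule equivclp_into_equivclp[OF IH disjI1[OF R]])
      then show ?case
        using step pointed_map_in[OF Y] by blast
    qed (use that in auto)
    then show ?thesis ..
  qed
  have "sequential_colimit Y (\<lambda>_ z. z) ?X (\<lambda>_ z. z)"
    unfolding sequential_colimit_def
  proof (intro conjI allI ballI)
    show "quotient_map (sum_topology (\<lambda>n. fst (Y n)) UNIV) (fst ?X) (\<lambda>(n, x). x)"
      by (simp add: quotient_map_quotient_space)
    show "pointed_map (Y n) ?X (\<lambda>z. z)" for n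
      using continuous_map_compose'[OF quotient_imp_continuous_map[OF quotient_map_quotient_space[of _ "\<lambda>(n, x). x"]]
          continuous_map_component_injection[of n UNIV "\<lambda>n. fst (Y n)"]] base[of n]
      by (simp add: pointed_map_def)
    fix m n x y assume xy: "x \<in> points (Y m)" "y \<in> points (Y n)"
    show "x = y \<longleftrightarrow> equivclp ?R (m, x) (n, y)"
    proof
      assume "equivclp ?R (m, x) (n, y)"
      from equivclp_imp_eq[OF this, of snd] show "x = y" by auto
    next
      assume "x = y"
      then show "equivclp ?R (m, x) (n, y)"
        using chain[of m n x] chain[of n m x] xy equivclp_sym[of ?R "(n, x)" "(m, x)"]
          by (cases "m \<le> n") simp_all
    qed
  qed (rule Y)
  then show ?thesis by (rule that)
qed

section \<open>Replacing the cells\<close>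

lemma bdries_fun_retract:
  assumes "pointed_space A" "pointed_space B" "pointed_map A B \<alpha>" "pointed_map B A \<beta>"
    "\<And>a. a \<in> points A \<Longrightarrow> \<beta> (\<alpha> a) = a" "w \<in> points (bdries n J A)"
  shows "bdries_fun n A \<beta> (bdries_fun n B \<alpha> w) = w"
  using bdries_fun_comp[OF assms(1-4,6)] bdries_fun_id[OF assms(1) _ assms(6), of "\<lambda>a. \<beta> (\<alpha> a)"]
    assms(5) by simp

lemma cells_fun_retract:
  assumes "pointed_space A" "pointed_space B" "pointed_map A B \<alpha>" "pointed_map B A \<beta>"
    "\<And>a. a \<in> points A \<Longrightarrow> \<beta> (\<alpha> a) = a" "v \<in> points (cells n J A)"
  shows "cells_fun n A \<beta> (cells_fun n B \<alpha> v) = v"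
  using cells_fun_comp[OF assms(1-4,6)] cells_fun_id[OF assms(1) _ assms(6), of "\<lambda>a. \<beta> (\<alpha> a)"]
    assms(5) by simp

text \<open>New cells are attached along \<open>\<phi>\<close> after \<open>g\<close> after the
  boundary map of \<open>\<beta>\<close>. The cell map of \<open>\<alpha>\<close> then fits with
  \<open>\<phi>\<close> because \<open>\<beta>\<alpha>\<close> is the identity, and that of
  \<open>\<beta>\<close> fits with \<open>\<psi>\<close> because \<open>\<psi>\<phi>\<close> is the
  identity. Both extensions are strict, and the new composite is the identity on old points and on
  cells alike.\<close>

lemma retract_step:
  fixes Y :: "('j \<times> 'b \<times> real list) pointed" and J :: "'j set"
  assumes A: "pointed_space A" and B: "pointed_space B" and \<alpha>: "pointed_map A B \<alpha>"
    and \<beta>: "pointed_map B A \<beta>"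
    and \<beta>\<alpha>: "\<And>a. a \<in> points A \<Longrightarrow> \<beta> (\<alpha> a) = a"
    and po: "cell_pushout n J A g Z Z' f h" and Z: "pointed_space Z"
    and \<phi>: "pointed_map Z Y \<phi>" and \<psi>: "pointed_map Y Z \<psi>" and \<psi>\<phi>: "\<And>z. z \<in> points Z \<Longrightarrow> \<psi> (\<phi> z) = z"
    and Y: "cw_stage B n Y"
  obtains Y' hY \<phi>' \<psi>' where
    "cell_pushout n J B (\<lambda>w. \<phi> (g (bdries_fun n A \<beta> w))) Y Y' (\<lambda>y. y) hY"
    "cw_stage B (Suc n) Y'" "pointed_map Z' Y' \<phi>'" "pointed_map Y' Z' \<psi>'"
    "\<And>z. z \<in> points Z' \<Longrightarrow> \<psi>' (\<phi>' z) = z"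
    "\<And>z. z \<in> points Z \<Longrightarrow> \<phi>' (f z) = \<phi> z" "\<And>y. y \<in> points Y \<Longrightarrow> \<psi>' y = f (\<psi> y)"
    "\<And>v. v \<in> points (cells n J A) \<Longrightarrow> \<phi>' (h v) = hY (cells_fun n B \<alpha> v)"
    "\<And>v. v \<in> points (cells n J B) \<Longrightarrow> \<psi>' (hY v) = h (cells_fun n A \<beta> v)"
proof -
  note W\<alpha> = bdries_fun_pointed_map[OF A \<alpha>, of n J] and W\<beta> = bdries_fun_pointed_map[OF B \<beta>, of n J]
    and V\<alpha> = cells_fun_pointed_map[OF A \<alpha>, of n J] and V\<beta> = cells_fun_pointed_map[OF B \<beta>, of n J]
  note g = pushoutD(1)[OF po] and f = pushoutD(3)[OF po] and h = pushoutD(4)[OF po]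
    and comm = pushout_comm[OF po]
  have Yp: "pointed_space Y" using Y by (simp add: cw_stage_def)
  obtain Y' hY where poY: "cell_pushout n J B (\<lambda>w. \<phi> (g (bdries_fun n A \<beta> w))) Y Y' (\<lambda>y. y) hY"
    and Y': "cw_stage B (Suc n) Y'"
    by (rule cw_stage_step[OF B Y pointed_map_comp[OF pointed_map_comp[OF W\<beta> g] \<phi>]])
  note jY = pushoutD(3)[OF poY] and hY = pushoutD(4)[OF poY] and commY = pushout_comm[OF poY]
  obtain \<phi>' where \<phi>': "pointed_map Z' Y' \<phi>'" "\<And>z. z \<in> points Z \<Longrightarrow> \<phi>' (f z) = \<phi> z"
      "\<And>v. v \<in> points (cells n J A) \<Longrightarrow> \<phi>' (h v) = hY (cells_fun n B \<alpha> v)"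
  proof (rule pushout_map[OF Z po pointed_map_comp[OF \<phi> jY] pointed_map_comp[OF V\<alpha> hY]])
    show "\<phi> (g w) = hY (cells_fun n B \<alpha> (bdries_incl n A w))" if w: "w \<in> points (bdries n J A)" for w
      using commY[OF pointed_map_in[OF W\<alpha> w]] cells_fun_bdry_incl[OF A B \<alpha> w]
        bdries_fun_retract[OF A B \<alpha> \<beta> \<beta>\<alpha> w] by simp
  qed blast
  obtain \<psi>' where \<psi>': "pointed_map Y' Z' \<psi>'" "\<And>y. y \<in> points Y \<Longrightarrow> \<psi>' y = f (\<psi> y)"
      "\<And>v. v \<in> points (cells n J B) \<Longrightarrow> \<psi>' (hY v) = h (cells_fun n A \<beta> v)"
  proof (rule pushout_map[OF Yp poY pointed_map_comp[OF \<psi> f] pointed_map_comp[OF V\<beta> h]])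
    show "f (\<psi> (\<phi> (g (bdries_fun n A \<beta> w)))) = h (cells_fun n A \<beta> (bdries_incl n B w))"
      if w: "w \<in> points (bdries n J B)" for w
      using comm[OF pointed_map_in[OF W\<beta> w]] cells_fun_bdry_incl[OF B A \<beta> w]
        \<psi>\<phi>[OF pointed_map_in[OF g pointed_map_in[OF W\<beta> w]]]
      by simp
  qed blast
  have "\<psi>' (\<phi>' z) = z" if "z \<in> points Z'" for z
    using po that
  proof (cases rule: pushout_cases)
    case (1 x)
    then show ?thesis
      using \<phi>'(2) \<psi>'(2)[OF pointed_map_in[OF \<phi> 1(1)]] \<psi>\<phi> by simp
  next
    case (2 v)
    then show ?thesis
      using \<phi>'(3) \<psi>'(3)[OF pointed_map_in[OF V\<alpha> 2(1)]] cells_fun_retract[OF A B \<alpha> \<beta> \<beta>\<alpha> 2(1)] by simp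
  qed
  then show ?thesis
    by (rule that[OF poY Y' \<phi>'(1) \<psi>'(1) _ \<phi>'(2) \<psi>'(2) \<phi>'(3) \<psi>'(3)])
qed

text \<open>The ordinary homotopy extension property: with the path
  \<open>N (w, (1 - s) / 2)\<close>, the backward parameter \<open>s = 1 - 2 * r\<close> of
  \<open>fills\<close> becomes the time \<open>r\<close>.\<close>

lemma fillable_extension:
  assumes fill: "fillable W V c T" and F: "pointed_map V T F" and N: "htpy W T N"
    and N0: "\<And>w. w \<in> points W \<Longrightarrow> N (w, 0) = F (c w)"
  obtains U where "htpy V T U" "\<And>v. v \<in> points V \<Longrightarrow> U (v, 0) = F v"
    "\<And>w r. w \<in> points W \<Longrightarrow> r \<in> {0..1} \<Longrightarrow> U (c w, r) = N (w, r)"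
proof -
  let ?P = "\<lambda>p. N (fst p, (1 - snd p) / 2)"
  have "continuous_map (prod_topology (fst W) (top_of_set {-1..1})) (fst T) ?P"
    by (rule continuous_map_compose2'[of _ _ _ N, OF _ continuous_map_fst continuous_map_interval_reparam])
       (use N in \<open>auto simp: htpy_def intro!: continuous_intros\<close>)
  moreover have "\<forall>s\<in>{-1..1}. ?P (base W, s) = base T"
    using htpy_base[OF N] by simp
  moreover have "\<forall>w\<in>points W. ?P (w, 1) = F (c w)"
    using N0 by simp
  ultimately obtain U where "fills W V c T F ?P U"
    using fill F unfolding fillable_def by blast
  then show ?thesis
    by (intro that[of U]) (simp_all add: fills_def)
qed

text \<open>
  The new skeleton is glued along \<open>\<phi> \<circ> g \<circ> \<Sigma>\<beta>\<close>, so on the new cells the map induced by \<open>\<alpha>\<close> extends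
  \<open>\<phi>\<close> only up to the homotopy \<open>\<beta>\<alpha> \<simeq> id\<close>, which is absorbed in a collar.
\<close>

lemma homotopy_step:
  fixes Y :: "('j \<times> 'b \<times> real list) pointed" and J :: "'j set"
  assumes A: "pointed_space A" and B: "pointed_space B" and \<alpha>: "pointed_map A B \<alpha>"
    and \<beta>: "pointed_map B A \<beta>"
    and L: "htpy A A L" and L0: "\<And>a. a \<in> points A \<Longrightarrow> L (a, 0) = \<beta> (\<alpha> a)"
      and L1: "\<And>a. a \<in> points A \<Longrightarrow> L (a, 1) = a"
    and po: "cell_pushout n J A g Z Z' f h" and Z: "pointed_space Z"
    and \<phi>: "pointed_map Z Y \<phi>" and Y: "cw_stage B n Y"
  obtains Y' hY \<phi>' where
    "cell_pushout n J B (\<lambda>w. \<phi> (g (bdries_fun n A \<beta> w))) Y Y' (\<lambda>y. y) hY"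
    "cw_stage B (Suc n) Y'" "pointed_map Z' Y' \<phi>'" "\<And>z. z \<in> points Z \<Longrightarrow> \<phi>' (f z) = \<phi> z"
    "cell_htpy n J A Y Y' (\<lambda>y. y) (\<lambda>v. \<phi>' (h v)) (\<lambda>w. \<phi> (g w))
       (\<lambda>v. hY (cells_fun n B \<alpha> v)) (\<lambda>w. \<phi> (g (bdries_fun n A \<beta> (bdries_fun n B \<alpha> w))))"
proof -
  note W\<alpha> = bdries_fun_pointed_map[OF A \<alpha>, of n J] and W\<beta> = bdries_fun_pointed_map[OF B \<beta>, of n J]
    and V\<alpha> = cells_fun_pointed_map[OF A \<alpha>, of n J]
  note g = pushoutD(1)[OF po] and c = pushoutD(2)[OF po]
  have Yp: "pointed_space Y" using Y by (simp add: cw_stage_def)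
  obtain Y' hY where poY: "cell_pushout n J B (\<lambda>w. \<phi> (g (bdries_fun n A \<beta> w))) Y Y' (\<lambda>y. y) hY"
    and Y': "cw_stage B (Suc n) Y'"
    by (rule cw_stage_step[OF B Y pointed_map_comp[OF pointed_map_comp[OF W\<beta> g] \<phi>]])
  note jY = pushoutD(3)[OF poY] and hY = pushoutD(4)[OF poY] and commY = pushout_comm[OF poY]
  have Yp': "pointed_space Y'" using Y' by (simp add: cw_stage_def)
  \<comment> \<open>On boundaries the homotopy \<open>L\<close> deforms the map induced by
    \<open>\<beta>\<alpha>\<close> into the identity, so \<open>N\<close> runs from the boundary of
    the cells \<open>hY\<close> after \<open>\<alpha>\<close> to \<open>\<phi>\<close> after
    \<open>g\<close>.\<close>
  define N where "N = (\<lambda>(w, t). \<phi> (g (bdries_fun n A (\<lambda>a. L (a, t)) w)))"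
  have N: "htpy (bdries n J A) Y N"
    using htpy_post[OF bdries_fun_htpy[OF A L, of n J] pointed_map_comp[OF g \<phi>]]
      by (simp add: N_def case_prod_unfold)
  have N0: "N (w, 0) = \<phi> (g (bdries_fun n A \<beta> (bdries_fun n B \<alpha> w)))"
    if w: "w \<in> points (bdries n J A)" for w
    using bdries_fun_comp[OF A B \<alpha> \<beta> w] bdries_fun_cong[OF A L0 w, where B = A] by (simp add: N_def)
  have N1: "N (w, 1) = \<phi> (g w)" if w: "w \<in> points (bdries n J A)" for w
    using bdries_fun_id[OF A L1 w] by (simp add: N_def)
  obtain U where U: "htpy (cells n J A) Y' U" "\<And>v. v \<in> points (cells n J A)
    \<Longrightarrow> U (v, 0) = hY (cells_fun n B \<alpha> v)"
    and Uc: "\<And>w r. w \<in> points (bdries n J A) \<Longrightarrow> r \<in> {0..1} \<Longrightarrow> U (bdries_incl n A w, r) = N (w, r)"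
  proof (rule fillable_extension[OF fillable_bdries_incl[OF A Yp'] pointed_map_comp[OF V\<alpha> hY]
    htpy_post[OF N jY]])
    show "N (w, 0) = hY (cells_fun n B \<alpha> (bdries_incl n A w))" if w: "w \<in> points (bdries n J A)" for w
      using N0[OF w] commY[OF pointed_map_in[OF W\<alpha> w]] cells_fun_bdry_incl[OF A B \<alpha> w] by simp
  qed blast
  have U1: "pointed_map (cells n J A) Y' (\<lambda>v. U (v, 1))"
    by (rule htpy_at[OF U(1)]) simp
  \<comment> \<open>Taking the end of \<open>U\<close>, rather than the cell map of
    \<open>\<alpha>\<close> where it starts, makes the boundary values exactly \<open>\<phi>\<close>
    after \<open>g\<close>; the extension of \<open>\<phi>\<close> is strict.\<close>
  obtain \<phi>' where \<phi>': "pointed_map Z' Y' \<phi>'" "\<And>z. z \<in> points Z \<Longrightarrow> \<phi>' (f z) = \<phi> z"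
      "\<And>v. v \<in> points (cells n J A) \<Longrightarrow> \<phi>' (h v) = U (v, 1)"
  proof (rule pushout_map[OF Z po pointed_map_comp[OF \<phi> jY] U1])
    show "\<phi> (g w) = U (bdries_incl n A w, 1)" if w: "w \<in> points (bdries n J A)" for w
      using Uc[OF w, of 1] N1[OF w] by simp
  qed blast
  have ph: "cell_htpy n J A Y Y' (\<lambda>y. y) (\<lambda>v. \<phi>' (h v)) (\<lambda>w. \<phi> (g w))
       (\<lambda>v. hY (cells_fun n B \<alpha> v)) (\<lambda>w. \<phi> (g (bdries_fun n A \<beta> (bdries_fun n B \<alpha> w))))"
    by (rule pair_htpyI[OF htpy_rev[OF U(1)] htpy_rev[OF N]]) (simp_all add: \<phi>'(3) U(2) N0 N1 Uc)
  show ?thesis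
    by (rule that[OF poY Y' \<phi>'(1) _ ph]) (rule \<phi>'(2))
qed

section \<open>Skeletonwise construction of the complex with replaced cells, and ladders obtained
  from it\<close>

lemma pointed_map_from_point:
  "points X = {base X} \<Longrightarrow> pointed_space Y \<Longrightarrow> pointed_map X Y (\<lambda>_. base Y)"
  by (simp add: pointed_map_def pointed_space_def)

lemma pointed_space_cw_start: "pointed_space (cw_start B)"
  by (simp add: pointed_space_def points_start)

text \<open>Dependent choice runs over the triples of a stage and the two maps. The characteristic
  maps \<open>hY\<close> belong to the transitions between stages; they are existential in
  \<open>Q\<close> and are selected afterwards.\<close>

lemma build_retract:
  fixes S :: "nat \<Rightarrow> 'x pointed" and J :: "nat \<Rightarrow> 'j set" and B :: "'b pointed"
  assumes A: "pointed_space A" and B: "pointed_space B" and \<alpha>: "pointed_map A B \<alpha>"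
    and \<beta>: "pointed_map B A \<beta>"
    and \<beta>\<alpha>: "\<And>a. a \<in> points A \<Longrightarrow> \<beta> (\<alpha> a) = a" and S: "cw_data A J S g f h"
  obtains Y :: "nat \<Rightarrow> ('j \<times> 'b \<times> real list) pointed" and gY hY \<phi> \<psi> where
    "cw_data B J Y gY (\<lambda>_ y. y) hY" "\<And>n w. gY n w = \<phi> n (g n (bdries_fun n A \<beta> w))"
    "\<And>n. pointed_map (S n) (Y n) (\<phi> n)" "\<And>n. pointed_map (Y n) (S n) (\<psi> n)"
    "\<And>n x. x \<in> points (S n) \<Longrightarrow> \<psi> n (\<phi> n x) = x"
    "\<And>n x. x \<in> points (S n) \<Longrightarrow> \<phi> (Suc n) (f n x) = \<phi> n x"
      "\<And>n y. y \<in> points (Y n) \<Longrightarrow> \<psi> (Suc n) y = f n (\<psi> n y)"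
    "\<And>n v. v \<in> points (cells n (J n) A) \<Longrightarrow> \<phi> (Suc n) (h n v) = hY n (cells_fun n B \<alpha> v)"
    "\<And>n v. v \<in> points (cells n (J n) B) \<Longrightarrow> \<psi> (Suc n) (hY n v) = h n (cells_fun n A \<beta> v)"
proof -
  have S0: "points (S 0) = {base (S 0)}"
    and po: "\<And>n. cell_pushout n (J n) A (g n) (S n) (S (Suc n)) (f n) (h n)"
    using S by (auto simp: cw_data_def)
  define P where "P n s \<longleftrightarrow> (case s of (Y, \<phi>, \<psi>) \<Rightarrow> cw_stage B n Y \<and> pointed_map (S n) Y \<phi>
    \<and> pointed_map Y (S n) \<psi> \<and>
     (\<forall>x\<in>points (S n). \<psi> (\<phi> x) = x) \<and> (n = 0 \<longrightarrow> points Y = {base Y}))"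
    for n and s :: "('j \<times> 'b \<times> real list) pointed \<times> ('x \<Rightarrow> 'j \<times> 'b \<times> real list) \<times> ('j \<times> 'b \<times> real list \<Rightarrow> 'x)"
  define R where "R n Y \<phi> \<psi> Y' \<phi>' \<psi>' hY \<longleftrightarrow>
     cell_pushout n (J n) B (\<lambda>w. \<phi> (g n (bdries_fun n A \<beta> w))) Y Y' (\<lambda>y. y) hY \<and>
     (\<forall>x\<in>points (S n). \<phi>' (f n x) = \<phi> x) \<and> (\<forall>y\<in>points Y. \<psi>' y = f n (\<psi> y)) \<and>
     (\<forall>v\<in>points (cells n (J n) A). \<phi>' (h n v) = hY (cells_fun n B \<alpha> v)) \<and>
     (\<forall>v\<in>points (cells n (J n) B). \<psi>' (hY v) = h n (cells_fun n A \<beta> v))"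
    for n and Y Y' :: "('j \<times> 'b \<times> real list) pointed" and \<phi> \<psi> \<phi>' \<psi>' hY
  define Q where "Q n = (\<lambda>(Y, \<phi>, \<psi>) (Y', \<phi>', \<psi>'). \<exists>hY. R n Y \<phi> \<psi> Y' \<phi>' \<psi>' hY)" for n
  have base: "P 0 (cw_start B, \<lambda>_. base (cw_start B), \<lambda>_. base (S 0))"
    unfolding P_def prod.case
    by (intro conjI cw_stage_start pointed_map_from_point[OF S0 pointed_space_cw_start]
        pointed_map_from_point[OF points_start cw_data_pointed_space[OF S]]) (simp_all add: S0 points_start)
  have "\<exists>s'. P (Suc n) s' \<and> Q n s s'" if "P n s" for n s
  proof -
    obtain Y \<phi> \<psi> where s: "s = (Y, \<phi>, \<psi>)" by (cases s)
    have st: "cw_stage B n Y" "pointed_map (S n) Y \<phi>" "pointed_map Y (S n) \<psi>"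
      "\<And>x. x \<in> points (S n) \<Longrightarrow> \<psi> (\<phi> x) = x"
      using \<open>P n s\<close> by (auto simp: P_def s)
    show ?thesis
    proof (rule retract_step[OF A B \<alpha> \<beta> \<beta>\<alpha> po[of n] cw_data_pointed_space[OF S] st(2,3,4,1)])
      fix Y' hY \<phi>' \<psi>'
      assume *: "cell_pushout n (J n) B (\<lambda>w. \<phi> (g n (bdries_fun n A \<beta> w))) Y Y' (\<lambda>y. y) hY"
        "cw_stage B (Suc n) Y'" "pointed_map (S (Suc n)) Y' \<phi>'" "pointed_map Y' (S (Suc n)) \<psi>'"
        "\<And>z. z \<in> points (S (Suc n)) \<Longrightarrow> \<psi>' (\<phi>' z) = z"
        "\<And>z. z \<in> points (S n) \<Longrightarrow> \<phi>' (f n z) = \<phi> z" "\<And>y. y \<in> points Y \<Longrightarrow> \<psi>' y = f n (\<psi> y)"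
        "\<And>v. v \<in> points (cells n (J n) A) \<Longrightarrow> \<phi>' (h n v) = hY (cells_fun n B \<alpha> v)"
        "\<And>v. v \<in> points (cells n (J n) B) \<Longrightarrow> \<psi>' (hY v) = h n (cells_fun n A \<beta> v)"
      have "P (Suc n) (Y', \<phi>', \<psi>')"
        using * by (simp add: P_def)
      moreover have "Q n s (Y', \<phi>', \<psi>')"
        unfolding Q_def R_def s prod.case by (intro exI[of _ hY] conjI ballI *)
      ultimately show "\<exists>s'. P (Suc n) s' \<and> Q n s s'" by blast
    qed
  qed
  then obtain s where s: "\<And>n. P n (s n)" "\<And>n. Q n (s n) (s (Suc n))"
    using dependent_nat_choice[of P Q] base by metis
  define Y \<phi> \<psi> where "Y n = fst (s n)" and "\<phi> n = fst (snd (s n))" and "\<psi> n = snd (snd (s n))" for n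
  have sn: "s n = (Y n, \<phi> n, \<psi> n)" for n
    by (simp add: Y_def \<phi>_def \<psi>_def)
  have P: "cw_stage B n (Y n)" "pointed_map (S n) (Y n) (\<phi> n)" "pointed_map (Y n) (S n) (\<psi> n)"
    "\<forall>x\<in>points (S n). \<psi> n (\<phi> n x) = x" "n = 0 \<Longrightarrow> points (Y n) = {base (Y n)}" for n
    using s(1)[of n] by (simp_all add: P_def sn)
  have "\<exists>hY. R n (Y n) (\<phi> n) (\<psi> n) (Y (Suc n)) (\<phi> (Suc n)) (\<psi> (Suc n)) hY" for n
    using s(2)[of n] by (simp add: Q_def sn)
  from choice[OF allI[OF this]] obtain hY where
    Q: "\<forall>n. R n (Y n) (\<phi> n) (\<psi> n) (Y (Suc n)) (\<phi> (Suc n)) (\<psi> (Suc n)) (hY n)" ..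
  show ?thesis
  proof (rule that[where Y = Y and gY = "\<lambda>n w. \<phi> n (g n (bdries_fun n A \<beta> w))" and hY = hY and \<phi> = \<phi>
    and \<psi> = \<psi>])
    show "cw_data B J Y (\<lambda>n w. \<phi> n (g n (bdries_fun n A \<beta> w))) (\<lambda>_ y. y) hY"
      unfolding cw_data_def using P(5)[of 0] Q by (simp add: R_def)
  qed (use P Q in \<open>simp_all add: R_def\<close>)
qed

text \<open>One homotopy \<open>L\<close> from \<open>\<beta>\<alpha>\<close> to the identity is
  fixed for all dimensions. As before the characteristic maps are chosen after the stages; the
  relation \<open>R\<close> already contains the cell condition of a ladder.\<close>

lemma build_homotopy:
  fixes S :: "nat \<Rightarrow> 'x pointed" and J :: "nat \<Rightarrow> 'j set" and B :: "'b pointed"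
  assumes A: "pointed_space A" and B: "pointed_space B" and \<alpha>: "pointed_map A B \<alpha>"
    and \<beta>: "pointed_map B A \<beta>"
    and \<beta>\<alpha>: "pointed_homotopic A A (\<beta> \<circ> \<alpha>) id" and S: "cw_data A J S g f h"
  obtains Y :: "nat \<Rightarrow> ('j \<times> 'b \<times> real list) pointed" and gY hY \<phi> where
    "cw_data B J Y gY (\<lambda>_ y. y) hY" "ladder A B \<alpha> J S g f h Y gY (\<lambda>_ y. y) hY \<phi>"
proof -
  obtain L where L: "htpy A A L" "\<And>a. a \<in> points A \<Longrightarrow> L (a, 0) = \<beta> (\<alpha> a)"
    "\<And>a. a \<in> points A \<Longrightarrow> L (a, 1) = a"
    using \<beta>\<alpha> unfolding pointed_homotopic_iff[OF A] by auto
  have S0: "points (S 0) = {base (S 0)}"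
    and po: "\<And>n. cell_pushout n (J n) A (g n) (S n) (S (Suc n)) (f n) (h n)"
    using S by (auto simp: cw_data_def)
  define P where "P n s \<longleftrightarrow> (case s of (Y, \<phi>) \<Rightarrow> cw_stage B n Y \<and> pointed_map (S n) Y \<phi> \<and>
     (n = 0 \<longrightarrow> points Y = {base Y}))"
    for n and s :: "('j \<times> 'b \<times> real list) pointed \<times> ('x \<Rightarrow> 'j \<times> 'b \<times> real list)"
  define R where "R n Y \<phi> Y' \<phi>' hY \<longleftrightarrow>
     cell_pushout n (J n) B (\<lambda>w. \<phi> (g n (bdries_fun n A \<beta> w))) Y Y' (\<lambda>y. y) hY \<and>
     (\<forall>x\<in>points (S n). \<phi>' (f n x) = \<phi> x) \<and>
     cell_htpy n (J n) A Y Y' (\<lambda>y. y) (\<lambda>v. \<phi>' (h n v)) (\<lambda>w. \<phi> (g n w))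
       (\<lambda>v. hY (cells_fun n B \<alpha> v)) (\<lambda>w. \<phi> (g n (bdries_fun n A \<beta> (bdries_fun n B \<alpha> w))))"
    for n and Y Y' :: "('j \<times> 'b \<times> real list) pointed" and \<phi> \<phi>' hY
  define Q where "Q n = (\<lambda>(Y, \<phi>) (Y', \<phi>'). \<exists>hY. R n Y \<phi> Y' \<phi>' hY)" for n
  have base: "P 0 (cw_start B, \<lambda>_. base (cw_start B))"
    unfolding P_def prod.case
    by (intro conjI cw_stage_start pointed_map_from_point[OF S0 pointed_space_cw_start]) (simp add: points_start)
  have "\<exists>s'. P (Suc n) s' \<and> Q n s s'" if "P n s" for n s
  proof -
    obtain Y \<phi> where s: "s = (Y, \<phi>)" by (cases s)
    have st: "cw_stage B n Y" "pointed_map (S n) Y \<phi>"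
      using \<open>P n s\<close> by (auto simp: P_def s)
    show ?thesis
    proof (rule homotopy_step[OF A B \<alpha> \<beta> L po[of n] cw_data_pointed_space[OF S] st(2,1)])
      fix Y' hY \<phi>'
      assume *: "cell_pushout n (J n) B (\<lambda>w. \<phi> (g n (bdries_fun n A \<beta> w))) Y Y' (\<lambda>y. y) hY"
        "cw_stage B (Suc n) Y'" "pointed_map (S (Suc n)) Y' \<phi>'"
        "\<And>z. z \<in> points (S n) \<Longrightarrow> \<phi>' (f n z) = \<phi> z"
        "cell_htpy n (J n) A Y Y' (\<lambda>y. y) (\<lambda>v. \<phi>' (h n v)) (\<lambda>w. \<phi> (g n w))
          (\<lambda>v. hY (cells_fun n B \<alpha> v)) (\<lambda>w. \<phi> (g n (bdries_fun n A \<beta> (bdries_fun n B \<alpha> w))))"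
      have "P (Suc n) (Y', \<phi>')"
        using * by (simp add: P_def)
      moreover have "Q n s (Y', \<phi>')"
        unfolding Q_def R_def s prod.case by (intro exI[of _ hY] conjI ballI *)
      ultimately show "\<exists>s'. P (Suc n) s' \<and> Q n s s'" by blast
    qed
  qed
  then obtain s where s: "\<And>n. P n (s n)" "\<And>n. Q n (s n) (s (Suc n))"
    using dependent_nat_choice[of P Q] base by metis
  define Y \<phi> where "Y n = fst (s n)" and "\<phi> n = snd (s n)" for n
  have sn: "s n = (Y n, \<phi> n)" for n
    by (simp add: Y_def \<phi>_def)
  have P: "pointed_map (S n) (Y n) (\<phi> n)" "n = 0 \<Longrightarrow> points (Y n) = {base (Y n)}" for n
    using s(1)[of n] by (simp_all add: P_def sn)
  have "\<exists>hY. R n (Y n) (\<phi> n) (Y (Suc n)) (\<phi> (Suc n)) hY" for n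
    using s(2)[of n] by (simp add: Q_def sn)
  from choice[OF allI[OF this]]
    obtain hY where Q: "\<forall>n. R n (Y n) (\<phi> n) (Y (Suc n)) (\<phi> (Suc n)) (hY n)" ..
  show ?thesis
  proof (rule that[where Y = Y and gY = "\<lambda>n w. \<phi> n (g n (bdries_fun n A \<beta> w))" and hY = hY and \<phi> = \<phi>])
    show "cw_data B J Y (\<lambda>n w. \<phi> n (g n (bdries_fun n A \<beta> w))) (\<lambda>_ y. y) hY"
      unfolding cw_data_def using P(2)[of 0] Q by (simp add: R_def)
    show "ladder A B \<alpha> J S g f h Y (\<lambda>n w. \<phi> n (g n (bdries_fun n A \<beta> w))) (\<lambda>_ y. y) hY \<phi>"
      unfolding ladder_def using P(1) Q by (simp add: R_def)
  qed
qed

text \<open>Over each cell three homotopies of pairs are concatenated: that of \<open>\<phi>\<close>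
  followed by \<open>\<theta>\<close>, that of \<open>\<theta>\<close> preceded by the cell map of
  \<open>\<alpha>\<close>, and the one that \<open>L\<close> induces on the cells of the target. The
  last respects boundaries because each stage of \<open>L\<close> acts naturally on cells and their
  boundaries.\<close>

lemma ladder_comp:
  assumes A: "pointed_space A" and B: "pointed_space B" and \<alpha>: "pointed_map A B \<alpha>"
    and \<beta>: "pointed_map B A \<beta>"
    and \<beta>\<alpha>: "pointed_homotopic A A (\<beta> \<circ> \<alpha>) id"
    and S'': "cw_data A J S'' g'' f'' h''"
    and \<phi>: "ladder A B \<alpha> J S g f h S' g' f' h' \<phi>" and \<theta>: "ladder B A \<beta> J S' g' f' h' S'' g'' f'' h'' \<theta>"
  shows "ladder A A (\<lambda>a. a) J S g f h S'' g'' f'' h'' (\<lambda>n x. \<theta> n (\<phi> n x))"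
  unfolding ladder_def
proof (intro allI conjI ballI)
  fix n
  obtain L where L: "htpy A A L" "\<And>a. a \<in> points A \<Longrightarrow> L (a, 0) = \<beta> (\<alpha> a)"
    "\<And>a. a \<in> points A \<Longrightarrow> L (a, 1) = a"
    using \<beta>\<alpha> unfolding pointed_homotopic_iff[OF A] by auto
  have \<phi>n: "pointed_map (S n) (S' n) (\<phi> n)" "\<And>x. x \<in> points (S n) \<Longrightarrow> \<phi> (Suc n) (f n x) = f' n (\<phi> n x)"
    and ph: "cell_htpy n (J n) A (S' n) (S' (Suc n)) (f' n)
       (\<lambda>v. \<phi> (Suc n) (h n v)) (\<lambda>w. \<phi> n (g n w)) (\<lambda>v. h' n (cells_fun n B \<alpha> v)) (\<lambda>w. g' n (bdries_fun n B \<alpha> w))"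
    using \<phi> by (simp_all add: ladder_def)
  have \<theta>n: "pointed_map (S' n) (S'' n) (\<theta> n)" "pointed_map (S' (Suc n)) (S'' (Suc n)) (\<theta> (Suc n))"
      "\<And>x. x \<in> points (S' n) \<Longrightarrow> \<theta> (Suc n) (f' n x) = f'' n (\<theta> n x)"
    and ph': "cell_htpy n (J n) B (S'' n) (S'' (Suc n)) (f'' n)
       (\<lambda>v. \<theta> (Suc n) (h' n v)) (\<lambda>w. \<theta> n (g' n w)) (\<lambda>v. h'' n (cells_fun n A \<beta> v)) (\<lambda>w. g'' n (bdries_fun n A \<beta> w))"
    using \<theta> by (simp_all add: ladder_def)
  have po: "cell_pushout n (J n) A (g'' n) (S'' n) (S'' (Suc n)) (f'' n) (h'' n)"
    using S'' by (simp add: cw_data_def)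
  note cA = bdries_incl_pointed_map[OF A, of n "J n"]
  show "pointed_map (S n) (S'' n) (\<lambda>x. \<theta> n (\<phi> n x))"
    by (rule pointed_map_comp[OF \<phi>n(1) \<theta>n(1)])
  show "\<theta> (Suc n) (\<phi> (Suc n) (f n x)) = f'' n (\<theta> n (\<phi> n x))" if "x \<in> points (S n)" for x
    using \<phi>n(2)[OF that] \<theta>n(3)[OF pointed_map_in[OF \<phi>n(1) that]] by simp
  have 1: "cell_htpy n (J n) A (S'' n) (S'' (Suc n)) (f'' n)
       (\<lambda>v. \<theta> (Suc n) (\<phi> (Suc n) (h n v))) (\<lambda>w. \<theta> n (\<phi> n (g n w)))
       (\<lambda>v. \<theta> (Suc n) (h' n (cells_fun n B \<alpha> v))) (\<lambda>w. \<theta> n (g' n (bdries_fun n B \<alpha> w)))"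
    by (rule pair_htpy_post[OF ph \<theta>n(1,2)]) (rule \<theta>n(3))
  have 2: "cell_htpy n (J n) A (S'' n) (S'' (Suc n)) (f'' n)
       (\<lambda>v. \<theta> (Suc n) (h' n (cells_fun n B \<alpha> v))) (\<lambda>w. \<theta> n (g' n (bdries_fun n B \<alpha> w)))
       (\<lambda>v. h'' n (cells_fun n A \<beta> (cells_fun n B \<alpha> v))) (\<lambda>w. g'' n (bdries_fun n A \<beta> (bdries_fun n B \<alpha> w)))"
    by (rule pair_htpy_pre[OF ph' bdries_fun_pointed_map[OF A \<alpha>]
      cells_fun_pointed_map[OF A \<alpha>]]) (rule cells_fun_bdry_incl[OF A B \<alpha>])
  have H: "htpy (cells n (J n) A) (S'' (Suc n)) (\<lambda>(v, t). h'' n (cells_fun n A (\<lambda>a. L (a, t)) v))"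
    using htpy_post[OF cells_fun_htpy[OF A L(1)] pushoutD(4)[OF po]] by (simp add: case_prod_unfold)
  have K: "htpy (bdries n (J n) A) (S'' n) (\<lambda>(w, t). g'' n (bdries_fun n A (\<lambda>a. L (a, t)) w))"
    using htpy_post[OF bdries_fun_htpy[OF A L(1)] pushoutD(1)[OF po]] by (simp add: case_prod_unfold)
  have 3: "cell_htpy n (J n) A (S'' n) (S'' (Suc n)) (f'' n)
       (\<lambda>v. h'' n (cells_fun n A \<beta> (cells_fun n B \<alpha> v))) (\<lambda>w. g'' n (bdries_fun n A \<beta> (bdries_fun n B \<alpha> w)))
       (\<lambda>v. h'' n (cells_fun n A (\<lambda>a. a) v)) (\<lambda>w. g'' n (bdries_fun n A (\<lambda>a. a) w))"
  proof (rule pair_htpyI[OF H K], unfold prod.case)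
    show "h'' n (cells_fun n A (\<lambda>a. L (a, 0)) v) = h'' n (cells_fun n A \<beta> (cells_fun n B \<alpha> v))"
      "h'' n (cells_fun n A (\<lambda>a. L (a, 1)) v) = h'' n (cells_fun n A (\<lambda>a. a) v)"
        if v: "v \<in> points (cells n (J n) A)" for v
      using cells_fun_comp[OF A B \<alpha> \<beta> v] cells_fun_cong[OF A L(2) v, where B = A]
        cells_fun_cong[OF A L(3) v, where B = A] by simp_all
    show "g'' n (bdries_fun n A (\<lambda>a. L (a, 0)) w) = g'' n (bdries_fun n A \<beta> (bdries_fun n B \<alpha> w))"
      "g'' n (bdries_fun n A (\<lambda>a. L (a, 1)) w) = g'' n (bdries_fun n A (\<lambda>a. a) w)"
        if w: "w \<in> points (bdries n (J n) A)" for w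
      using bdries_fun_comp[OF A B \<alpha> \<beta> w] bdries_fun_cong[OF A L(2) w, where B = A]
        bdries_fun_cong[OF A L(3) w, where B = A] by simp_all
    fix w t assume w: "w \<in> points (bdries n (J n) A)" and t: "t \<in> {0..1::real}"
    note Lt = htpy_at[OF L(1) t]
    show "h'' n (cells_fun n A (\<lambda>a. L (a, t)) (bdries_incl n A w)) = f'' n (g'' n (bdries_fun n A (\<lambda>a. L (a, t)) w))"
      using cells_fun_bdry_incl[OF A A Lt w]
        pushout_comm[OF po pointed_map_in[OF bdries_fun_pointed_map[OF A Lt] w]] by simp
  qed
  show "cell_htpy n (J n) A (S'' n) (S'' (Suc n)) (f'' n)
       (\<lambda>v. \<theta> (Suc n) (\<phi> (Suc n) (h n v))) (\<lambda>w. \<theta> n (\<phi> n (g n w)))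
       (\<lambda>v. h'' n (cells_fun n A (\<lambda>a. a) v)) (\<lambda>w. g'' n (bdries_fun n A (\<lambda>a. a) w))"
    by (rule pair_htpy_trans[OF pair_htpy_trans[OF 1 2 cA] 3 cA])
qed

lemma pair_htpy_refl:
  assumes "pointed_map V Z' a" "pointed_map W Z b" "\<And>w. w \<in> points W \<Longrightarrow> a (c w) = j (b w)"
  shows "pair_htpy W V c Z Z' j a b a b"
  by (rule pair_htpyI[OF htpy_const[OF assms(1)] htpy_const[OF assms(2)]]) (simp_all add: assms(3))

text \<open>Constant homotopies are used over the cells. This brings the strict maps of the
  retraction case under the same comparison principle.\<close>

lemma ladder_strict:
  assumes A: "pointed_space A" and B: "pointed_space B" and \<alpha>: "pointed_map A B \<alpha>"
    and S': "cw_data B J S' g' f' h'" and \<phi>: "\<And>n. pointed_map (S n) (S' n) (\<phi> n)"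
    and \<phi>f: "\<And>n x. x \<in> points (S n) \<Longrightarrow> \<phi> (Suc n) (f n x) = f' n (\<phi> n x)"
    and \<phi>h: "\<And>n v. v \<in> points (cells n (J n) A) \<Longrightarrow> \<phi> (Suc n) (h n v) = h' n (cells_fun n B \<alpha> v)"
    and \<phi>g: "\<And>n w. w \<in> points (bdries n (J n) A) \<Longrightarrow> \<phi> n (g n w) = g' n (bdries_fun n B \<alpha> w)"
  shows "ladder A B \<alpha> J S g f h S' g' f' h' \<phi>"
  unfolding ladder_def
proof (intro allI conjI ballI \<phi> \<phi>f)
  fix n
  have po: "cell_pushout n (J n) B (g' n) (S' n) (S' (Suc n)) (f' n) (h' n)"
    using S' by (simp add: cw_data_def)
  have "cell_htpy n (J n) A (S' n) (S' (Suc n)) (f' n)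
     (\<lambda>v. h' n (cells_fun n B \<alpha> v)) (\<lambda>w. g' n (bdries_fun n B \<alpha> w)) (\<lambda>v. h' n (cells_fun n B \<alpha> v)) (\<lambda>w. g' n (bdries_fun n B \<alpha> w))"
  proof (rule pair_htpy_refl)
    show "pointed_map (cells n (J n) A) (S' (Suc n)) (\<lambda>v. h' n (cells_fun n B \<alpha> v))"
      by (rule pointed_map_comp[OF cells_fun_pointed_map[OF A \<alpha>] pushoutD(4)[OF po]])
    show "pointed_map (bdries n (J n) A) (S' n) (\<lambda>w. g' n (bdries_fun n B \<alpha> w))"
      by (rule pointed_map_comp[OF bdries_fun_pointed_map[OF A \<alpha>] pushoutD(1)[OF po]])
    show "h' n (cells_fun n B \<alpha> (bdries_incl n A w)) = f' n (g' n (bdries_fun n B \<alpha> w))"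
      if w: "w \<in> points (bdries n (J n) A)" for w
      using cells_fun_bdry_incl[OF A B \<alpha> w]
        pushout_comm[OF po pointed_map_in[OF bdries_fun_pointed_map[OF A \<alpha>] w]] by simp
  qed
  then show "cell_htpy n (J n) A (S' n) (S' (Suc n)) (f' n)
     (\<lambda>v. \<phi> (Suc n) (h n v)) (\<lambda>w. \<phi> n (g n w)) (\<lambda>v. h' n (cells_fun n B \<alpha> v)) (\<lambda>w. g' n (bdries_fun n B \<alpha> w))"
    by (rule pair_htpy_cong) (simp_all add: \<phi>h \<phi>g)
qed

section \<open>Maps of colimits, and the three assertions\<close>

lemma ladder_colimit_map:
  assumes S: "cw_data A J S g f h" and \<phi>: "ladder A B \<alpha> J S g f h S' g' f' h' \<phi>"
    and X: "sequential_colimit S f X k" and X': "sequential_colimit S' f' X' k'"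
  obtains r where "pointed_map X X' r" "\<And>n x. x \<in> points (S n) \<Longrightarrow> r (k n x) = k' n (\<phi> n x)"
proof (rule colimit_map[OF cw_data_pointed_space[OF S] X])
  have \<phi>n: "pointed_map (S n) (S' n) (\<phi> n)" "\<And>x. x \<in> points (S n)
    \<Longrightarrow> \<phi> (Suc n) (f n x) = f' n (\<phi> n x)" for n
    using \<phi> by (simp_all add: ladder_def)
  show "pointed_map (S n) X' (\<lambda>x. k' n (\<phi> n x))" for n
    by (rule pointed_map_comp[OF \<phi>n(1) colimitD(2)[OF X']])
  show "k' (Suc n) (\<phi> (Suc n) (f n x)) = k' n (\<phi> n x)" if "x \<in> points (S n)" for n x
    using \<phi>n(2)[OF that] colimitD(3)[OF X' pointed_map_in[OF \<phi>n(1) that]] by simp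
qed (rule that)

text \<open>Put \<open>s = p r2\<close> and \<open>l = q r3\<close>. Then
  \<open>s r1 \<simeq> id\<close> and \<open>l r2 \<simeq> id\<close>, while
  \<open>r2 r1 p \<simeq> id\<close>. Hence \<open>r1 s \<simeq> l r2 r1 s = l (r2 r1 p) r2 \<simeq>
  l r2 \<simeq> id\<close>, and \<open>s\<close> is a two-sided homotopy inverse of
  \<open>r1\<close>.\<close>

lemma two_of_six:
  assumes r1: "pointed_map X Y r1" and r2: "pointed_map Y Z r2" and r3: "pointed_map Z T r3"
    and e12: "pointed_homotopy_equivalence X Z (\<lambda>x. r2 (r1 x))"
    and e23: "pointed_homotopy_equivalence Y T (\<lambda>y. r3 (r2 y))"
  shows "pointed_homotopy_equivalence X Y r1"
proof -
  obtain p where p: "pointed_map Z X p" "pointed_homotopic X X (p \<circ> (\<lambda>x. r2 (r1 x))) id"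
    "pointed_homotopic Z Z ((\<lambda>x. r2 (r1 x)) \<circ> p) id"
    using e12 unfolding pointed_homotopy_equivalence_def by blast
  obtain q where q: "pointed_map T Y q" "pointed_homotopic Y Y (q \<circ> (\<lambda>y. r3 (r2 y))) id"
    using e23 unfolding pointed_homotopy_equivalence_def by blast
  let ?s = "\<lambda>y. p (r2 y)" and ?l = "\<lambda>z. q (r3 z)"
  have s: "pointed_map Y X ?s" and l: "pointed_map Z Y ?l"
    by (rule pointed_map_comp[OF r2 p(1)], rule pointed_map_comp[OF r3 q(1)])
  have sr: "pointed_homotopic X X (?s \<circ> r1) id"
    using p(2) by (simp add: o_def)
  have 1: "pointed_homotopic Y Y (\<lambda>y. q (r3 (r2 (r1 (p (r2 y)))))) (\<lambda>y. r1 (p (r2 y)))"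
    using pointed_homotopic_pre[OF q(2) pointed_map_comp[OF s r1]] by (simp add: o_def)
  have 2: "pointed_homotopic Y Y (\<lambda>y. q (r3 (r2 (r1 (p (r2 y)))))) (\<lambda>y. q (r3 (r2 y)))"
    using pointed_homotopic_post[OF pointed_homotopic_pre[OF p(3) r2] l] by (simp add: o_def)
  have 3: "pointed_homotopic Y Y (\<lambda>y. q (r3 (r2 y))) id"
    using q(2) by (simp add: o_def)
  have "pointed_homotopic Y Y (r1 \<circ> ?s) id"
    using pointed_homotopic_trans[OF pointed_homotopic_sym[OF 1] pointed_homotopic_trans[OF 2 3]]
      by (simp add: o_def)
  then show ?thesis
    unfolding pointed_homotopy_equivalence_def using r1 s sr by blast
qed

lemma stage_complex:
  fixes Y :: "nat \<Rightarrow> ('j \<times> 'b \<times> real list) pointed" and J :: "nat \<Rightarrow> 'j set" and B :: "'b pointed"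
  assumes B: "pointed_space B" and Y: "cw_data B J Y gY (\<lambda>_ y. y) hY"
  obtains T :: "('j \<times> 'b \<times> real list) pointed" where "sequential_colimit Y (\<lambda>_ y. y) T (\<lambda>_ y. y)"
    "CW_complex B T"
proof -
  have "pointed_map (Y n) (Y (Suc n)) (\<lambda>y. y)" for n
    using Y pushoutD(3)[of _ _ _ "Y n" _ "Y (Suc n)" "\<lambda>y. y"] unfolding cw_data_def by blast
  then obtain T where T: "sequential_colimit Y (\<lambda>_ y. y) T (\<lambda>_ y. y)"
    using inclusions_colimit[of Y] by blast
  have "CW_complex B T"
    \<comment> \<open>An index is turned into a point of the realisation type by adding fixed second
      and third coordinates; injectivity is all that is asked of this map.\<close>
    by (rule cw_data_imp_CW_complex[OF B Y T, of "\<lambda>j. (j, base B, [])"]) (simp add: inj_on_def)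
  then show ?thesis using that T by blast
qed

text \<open>The homotopy is a conditional conclusion about the same \<open>Y\<close>,
  \<open>\<phi>\<close> and \<open>\<psi>\<close>, so that one construction yields both the
  retraction and the deformation retraction.\<close>

theorem CW_complex_retract:
  fixes A :: "'a pointed" and B :: "'b pointed" and X :: "'x pointed"
  assumes A: "pointed_space A" and B: "pointed_space B" and X: "CW_complex A X"
    and \<alpha>: "pointed_map A B \<alpha>" and \<beta>: "pointed_map B A \<beta>" and \<beta>\<alpha>: "\<And>a. a \<in> points A \<Longrightarrow> \<beta> (\<alpha> a) = a"
  obtains Y :: "('x \<times> 'b \<times> real list) pointed" and \<phi> \<psi> where
    "CW_complex B Y" "pointed_map X Y \<phi>" "pointed_map Y X \<psi>" "\<And>x. x \<in> points X \<Longrightarrow> \<psi> (\<phi> x) = x"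
    "pointed_homotopic B B (\<alpha> \<circ> \<beta>) id \<Longrightarrow> pointed_homotopic Y Y (\<phi> \<circ> \<psi>) id"
proof -
  obtain J :: "nat \<Rightarrow> 'x set" and S :: "nat \<Rightarrow> 'x pointed" and g f h k
    where S: "cw_data A J S g f h" and k: "sequential_colimit S f X k"
    by (rule CW_complex_imp_cw_data[OF A X])
  obtain Y :: "nat \<Rightarrow> ('x \<times> 'b \<times> real list) pointed" and gY hY \<phi> \<psi> where
    Y: "cw_data B J Y gY (\<lambda>_ y. y) hY" and gY: "\<And>n w. gY n w = \<phi> n (g n (bdries_fun n A \<beta> w))"
    and \<phi>: "\<And>n. pointed_map (S n) (Y n) (\<phi> n)" and \<psi>: "\<And>n. pointed_map (Y n) (S n) (\<psi> n)"
    and \<psi>\<phi>: "\<And>n x. x \<in> points (S n) \<Longrightarrow> \<psi> n (\<phi> n x) = x"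
    and \<phi>f: "\<And>n x. x \<in> points (S n) \<Longrightarrow> \<phi> (Suc n) (f n x) = \<phi> n x"
      and \<psi>f: "\<And>n y. y \<in> points (Y n) \<Longrightarrow> \<psi> (Suc n) y = f n (\<psi> n y)"
    and \<phi>h: "\<And>n v. v \<in> points (cells n (J n) A) \<Longrightarrow> \<phi> (Suc n) (h n v) = hY n (cells_fun n B \<alpha> v)"
    and \<psi>h: "\<And>n v. v \<in> points (cells n (J n) B) \<Longrightarrow> \<psi> (Suc n) (hY n v) = h n (cells_fun n A \<beta> v)"
    apply (rule build_retract[OF A B \<alpha> \<beta> \<beta>\<alpha> S], assumption)
    subgoal premises p for Y gY hY \<phi> \<psi>
      by (rule that[where Y = Y and gY = gY and hY = hY and \<phi> = \<phi> and \<psi> = \<psi>]) (fact p)+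
    done
  obtain T where T: "sequential_colimit Y (\<lambda>_ y. y) T (\<lambda>_ y. y)" and TC: "CW_complex B T"
    by (rule stage_complex[OF B Y])
  have po: "cell_pushout n (J n) A (g n) (S n) (S (Suc n)) (f n) (h n)" for n
    using S by (simp add: cw_data_def)
  have gin: "g n w \<in> points (S n)" if "w \<in> points (bdries n (J n) A)" for n w
    using pointed_map_in[OF pushoutD(1)[OF po] that] .
  have l\<phi>: "ladder A B \<alpha> J S g f h Y gY (\<lambda>_ y. y) hY \<phi>"
    by (rule ladder_strict[OF A B \<alpha> Y \<phi>]) (simp_all add: gY \<phi>f \<phi>h bdries_fun_retract[OF A B \<alpha> \<beta> \<beta>\<alpha>])
  have l\<psi>: "ladder B A \<beta> J Y gY (\<lambda>_ y. y) hY S g f h \<psi>"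
    by (rule ladder_strict[OF B A \<beta> S \<psi>])
       (simp_all add: gY \<psi>f \<psi>h \<psi>\<phi> gin pointed_map_in[OF bdries_fun_pointed_map[OF B \<beta>]])
  obtain r where r: "pointed_map X T r" "\<And>n x. x \<in> points (S n) \<Longrightarrow> r (k n x) = \<phi> n x"
    by (rule ladder_colimit_map[OF S l\<phi> k T]) blast
  obtain s where s: "pointed_map T X s" "\<And>n y. y \<in> points (Y n) \<Longrightarrow> s y = k n (\<psi> n y)"
    by (rule ladder_colimit_map[OF Y l\<psi> T k]) blast
  have sr: "s (r x) = x" if "x \<in> points X" for x
    using k that
  proof (cases rule: colimit_cases)
    case (1 n y)
    then show ?thesis
      using r(2)[OF 1(1)] s(2)[OF pointed_map_in[OF \<phi> 1(1)]] \<psi>\<phi>[OF 1(1)] by simp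
  qed
  have rs: "pointed_homotopic T T (r \<circ> s) id" if \<alpha>\<beta>: "pointed_homotopic B B (\<alpha> \<circ> \<beta>) id"
  proof -
    let ?e = "\<lambda>y. r (s y)"
    have e: "pointed_map T T ?e"
      by (rule pointed_map_comp[OF s(1) r(1)])
    have "ladder B B (\<lambda>b. b) J Y gY (\<lambda>_ y. y) hY Y gY (\<lambda>_ y. y) hY (\<lambda>n y. \<phi> n (\<psi> n y))"
      by (rule ladder_comp[OF B A \<beta> \<alpha> \<alpha>\<beta> Y l\<psi> l\<phi>])
    then have "pointed_homotopy_equivalence T T ?e"
      by (rule ladder_equivalence[OF B Y Y _ T T e]) (simp add: s(2) r(2) pointed_map_in[OF \<psi>])
    then obtain q where q: "pointed_map T T q" "pointed_homotopic T T (q \<circ> ?e) id"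
      unfolding pointed_homotopy_equivalence_def by blast
    have Tp: "pointed_space T"
      by (rule colimit_pointed_space[OF Y T])
    \<comment> \<open>Since \<open>s r\<close> is the identity, \<open>?e\<close> after
      \<open>?e\<close> equals \<open>?e\<close> on points. Precomposing
      \<open>q ?e \<simeq> id\<close> with \<open>?e\<close> therefore gives
      \<open>q ?e \<simeq> ?e\<close>, and with \<open>q ?e \<simeq> id\<close> this yields
      \<open>?e \<simeq> id\<close>.\<close>
    have "pointed_homotopic T T (q \<circ> ?e \<circ> ?e) (id \<circ> ?e)"
      by (rule pointed_homotopic_pre[OF q(2) e])
    then have "pointed_homotopic T T (q \<circ> ?e) ?e"
      by (rule pointed_homotopic_eq[OF Tp]) (simp_all add: sr pointed_map_in[OF s(1)])
    from pointed_homotopic_trans[OF pointed_homotopic_sym[OF this] q(2)] show ?thesis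
      by (simp add: o_def)
  qed
  show ?thesis
    by (rule that[OF TC r(1) s(1)]) (rule sr, assumption, rule rs)
qed

theorem CW_complex_equivalence:
  fixes A :: "'a pointed" and B :: "'b pointed" and X :: "'x pointed"
  assumes A: "pointed_space A" and B: "pointed_space B" and X: "CW_complex A X"
    and \<beta>: "pointed_homotopy_equivalence B A \<beta>"
  obtains Y :: "('x \<times> 'b \<times> real list) pointed" and \<phi> where "CW_complex B Y"
    "pointed_homotopy_equivalence X Y \<phi>"
proof -
  obtain \<alpha> where \<alpha>: "pointed_map A B \<alpha>" and \<beta>p: "pointed_map B A \<beta>"
    and \<alpha>\<beta>: "pointed_homotopic B B (\<alpha> \<circ> \<beta>) id" and \<beta>\<alpha>: "pointed_homotopic A A (\<beta> \<circ> \<alpha>) id"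
    using \<beta> unfolding pointed_homotopy_equivalence_def by blast
  obtain J :: "nat \<Rightarrow> 'x set" and S :: "nat \<Rightarrow> 'x pointed" and g f h k
    where S: "cw_data A J S g f h" and k: "sequential_colimit S f X k"
    by (rule CW_complex_imp_cw_data[OF A X])
  obtain Y :: "nat \<Rightarrow> ('x \<times> 'b \<times> real list) pointed" and gY hY \<phi>1 where
    Y: "cw_data B J Y gY (\<lambda>_ y. y) hY" and l1: "ladder A B \<alpha> J S g f h Y gY (\<lambda>_ y. y) hY \<phi>1"
    by (rule build_homotopy[OF A B \<alpha> \<beta>p \<beta>\<alpha> S])
  \<comment> \<open>\<open>Z\<close> has cells of type \<open>A\<close> again and \<open>U\<close>
    cells of type \<open>B\<close>, all indexed by the same \<open>J\<close>. Thus \<open>Z\<close>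
    can be compared with \<open>X\<close>, and \<open>U\<close> with \<open>Y\<close>.\<close>
  obtain Z :: "nat \<Rightarrow> ('x \<times> 'a \<times> real list) pointed" and gZ hZ \<phi>2 where
    Z: "cw_data A J Z gZ (\<lambda>_ y. y) hZ" and l2: "ladder B A \<beta> J Y gY (\<lambda>_ y. y) hY Z gZ (\<lambda>_ y. y) hZ \<phi>2"
    by (rule build_homotopy[OF B A \<beta>p \<alpha> \<alpha>\<beta> Y])
  obtain U :: "nat \<Rightarrow> ('x \<times> 'b \<times> real list) pointed" and gU hU \<phi>3 where
    U: "cw_data B J U gU (\<lambda>_ y. y) hU" and l3: "ladder A B \<alpha> J Z gZ (\<lambda>_ y. y) hZ U gU (\<lambda>_ y. y) hU \<phi>3"
    by (rule build_homotopy[OF A B \<alpha> \<beta>p \<beta>\<alpha> Z])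
  obtain TY where TY: "sequential_colimit Y (\<lambda>_ y. y) TY (\<lambda>_ y. y)" and CY: "CW_complex B TY"
    by (rule stage_complex[OF B Y])
  obtain TZ where TZ: "sequential_colimit Z (\<lambda>_ y. y) TZ (\<lambda>_ y. y)"
    by (rule stage_complex[OF A Z])
  obtain TU where TU: "sequential_colimit U (\<lambda>_ y. y) TU (\<lambda>_ y. y)"
    by (rule stage_complex[OF B U])
  obtain r1 where r1: "pointed_map X TY r1" "\<And>n x. x \<in> points (S n) \<Longrightarrow> r1 (k n x) = \<phi>1 n x"
    by (rule ladder_colimit_map[OF S l1 k TY]) blast
  obtain r2 where r2: "pointed_map TY TZ r2" "\<And>n x. x \<in> points (Y n) \<Longrightarrow> r2 x = \<phi>2 n x"
    by (rule ladder_colimit_map[OF Y l2 TY TZ]) blast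
  obtain r3 where r3: "pointed_map TZ TU r3" "\<And>n x. x \<in> points (Z n) \<Longrightarrow> r3 x = \<phi>3 n x"
    by (rule ladder_colimit_map[OF Z l3 TZ TU]) blast
  have \<phi>1: "\<And>n. pointed_map (S n) (Y n) (\<phi>1 n)" and \<phi>2: "\<And>n. pointed_map (Y n) (Z n) (\<phi>2 n)"
    using l1 l2 by (simp_all add: ladder_def)
  have "pointed_homotopy_equivalence X TZ (\<lambda>x. r2 (r1 x))"
    by (rule ladder_equivalence[OF A S Z ladder_comp[OF A B \<alpha> \<beta>p \<beta>\<alpha> Z l1 l2]
      k TZ pointed_map_comp[OF r1(1) r2(1)]])
       (simp add: r1(2) r2(2)[OF pointed_map_in[OF \<phi>1]])
  moreover have "pointed_homotopy_equivalence TY TU (\<lambda>y. r3 (r2 y))"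
    by (rule ladder_equivalence[OF B Y U ladder_comp[OF B A \<beta>p \<alpha> \<alpha>\<beta> U l2 l3]
      TY TU pointed_map_comp[OF r2(1) r3(1)]])
       (simp add: r2(2) r3(2)[OF pointed_map_in[OF \<phi>2]])
  ultimately have "pointed_homotopy_equivalence X TY r1"
    by (rule two_of_six[OF r1(1) r2(1) r3(1)])
  then show ?thesis
    by (rule that[OF CY])
qed

theorem theorem1p2:
  fixes A :: "'a pointed" and B :: "'b pointed" and X :: "'x pointed"
    and \<alpha> :: "'a \<Rightarrow> 'b" and \<beta> :: "'b \<Rightarrow> 'a"
  assumes "pointed_space A" and "closedin (fst A) {base A}"
    and "pointed_space B" and "closedin (fst B) {base B}"
    and "CW_complex A X"
    and "pointed_map A B \<alpha>" and "pointed_map B A \<beta>"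
  shows
    "((\<forall>a \<in> points A. \<beta> (\<alpha> a) = a) \<longrightarrow>
       (\<exists>(Y :: ('x \<times> 'b \<times> real list) pointed) \<phi> \<psi>.
          CW_complex B Y \<and> pointed_map X Y \<phi> \<and> pointed_map Y X \<psi> \<and>
          (\<forall>x \<in> points X. \<psi> (\<phi> x) = x))) \<and>
     (pointed_homotopy_equivalence B A \<beta> \<longrightarrow>
       (\<exists>(Y :: ('x \<times> 'b \<times> real list) pointed) \<phi>.
          CW_complex B Y \<and> pointed_homotopy_equivalence X Y \<phi>)) \<and>
     ((\<forall>a \<in> points A. \<beta> (\<alpha> a) = a) \<and> pointed_homotopic B B (\<alpha> \<circ> \<beta>) id \<longrightarrow>
       (\<exists>(Y :: ('x \<times> 'b \<times> real list) pointed) \<phi> \<psi>.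
          CW_complex B Y \<and> pointed_map X Y \<phi> \<and> pointed_map Y X \<psi> \<and>
          (\<forall>x \<in> points X. \<psi> (\<phi> x) = x) \<and> pointed_homotopic Y Y (\<phi> \<circ> \<psi>) id))"
proof (intro conjI impI)
  assume \<beta>\<alpha>: "\<forall>a \<in> points A. \<beta> (\<alpha> a) = a"
  show "\<exists>(Y :: ('x \<times> 'b \<times> real list) pointed) \<phi> \<psi>.
          CW_complex B Y \<and> pointed_map X Y \<phi> \<and> pointed_map Y X \<psi> \<and> (\<forall>x \<in> points X. \<psi> (\<phi> x) = x)"
    by (rule CW_complex_retract[OF assms(1,3,5,6,7)]) (use \<beta>\<alpha> in blast)+
next
  assume "pointed_homotopy_equivalence B A \<beta>"
  then show "\<exists>(Y :: ('x \<times> 'b \<times> real list) pointed) \<phi>. CW_complex B Y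
    \<and> pointed_homotopy_equivalence X Y \<phi>"
    by (rule CW_complex_equivalence[OF assms(1,3,5)]) blast
next
  assume \<alpha>\<beta>: "(\<forall>a \<in> points A. \<beta> (\<alpha> a) = a) \<and> pointed_homotopic B B (\<alpha> \<circ> \<beta>) id"
  show "\<exists>(Y :: ('x \<times> 'b \<times> real list) pointed) \<phi> \<psi>.
          CW_complex B Y \<and> pointed_map X Y \<phi> \<and> pointed_map Y X \<psi> \<and>
          (\<forall>x \<in> points X. \<psi> (\<phi> x) = x) \<and> pointed_homotopic Y Y (\<phi> \<circ> \<psi>) id"
    by (rule CW_complex_retract[OF assms(1,3,5,6,7)]) (use \<alpha>\<beta> in blast)+
qed

end
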